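(* Let $n\ge 1$, let $\Omega\subset\mathbb{R}^n$ be a bounded domain with boundary of class $C^2$, let $\mu_1,\mu_2\in\mathbb{R}$ be arbitrary real numbers, let $\tau>0$ and $T>0$. Let $g:[0,\infty)\to[0,\infty)$ be a $C^1$ function with $g(0)>0$ and $1-\int_0^\infty g(s)\,ds=l>0$, and suppose there is a constant $\zeta>0$ with $g'(t)\le-\zeta g(t)$ for all $t>0$. Let $u_0\in H_0^1(\Omega)$, $u_1\in L^2(\Omega)$, $f_0\in L^2(-\tau,0;L^2(\Omega))$. Then there exists at most one weak solution on $(0,T)$ (in the sense defined in the context) of the problem $$\begin{cases}u_{tt}(x,t)-\Delta u(x,t)+\int_0^t g(t-s)\Delta u(x,s)\,ds+\mu_1u_t(x,t)+\mu_2u_t(x,t-\tau)=0,& x\in\Omega,\ t>0,\\ u(x,t)=0,& x\in\partial\Omega,\ t\ge0,\\ u(x,0)=u_0(x),\quad u_t(x,0)=u_1(x),& x\in\Omega,\\ u_t(x,t-\tau)=f_0(x,t-\tau),& x\in\Omega,\ 0<t<\tau.\end{cases}$$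
   Context: $(\cdot,\cdot)$ denotes the inner product of $L^2(\Omega)$ (also for vector-valued functions). For $T>0$ let $$U=\{u: u\in L^2(0,T;H_0^1(\Omega)),\ u_t\in L^2(0,T;L^2(\Omega))\},\qquad V=\{v\in U: v(\cdot,T)=0\}.$$ A function $u\in U$ is a weak solution of the problem on $(0,T)$ if for every $v\in V$ $$-\int_0^T(u_t,v_t)\,dt+\int_0^T(\nabla u(t),\nabla v(t))\,dt-\int_0^T\int_0^t g(t-s)(\nabla u(s),\nabla v(t))\,ds\,dt+\mu_1\int_0^T(u_t(t),v(t))\,dt+\mu_2\int_0^T(u_t(t-\tau),v(t))\,dt-(u_1,v(\cdot,0))=0,$$ and $u(\cdot,0)=u_0$, $u_t(\cdot,0)=u_1$, $u_t(x,t-\tau)=f_0(x,t-\tau)$ for $t\in(0,\tau)$. The last condition means that for $0<t<\tau$ the expression $u_t(t-\tau)$ in the identity above stands for the given history $f_0(\cdot,t-\tau)$. The initial values are understood through the representatives $u\in C([0,T];L^2(\Omega))$ and $u_t\in C([0,T];H^{-1}(\Omega))$. *)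

theory Defs
  imports "HOL-Analysis.Analysis"
begin

primrec C_k :: "nat \<Rightarrow> ('a::euclidean_space \<Rightarrow> real) \<Rightarrow> bool" where
  "C_k 0 f \<longleftrightarrow> continuous_on UNIV f"
| "C_k (Suc k) f \<longleftrightarrow>
     (\<exists>G. (\<forall>x. GDERIV f x :> G x) \<and> (\<forall>b\<in>Basis. C_k k (\<lambda>x. G x \<bullet> b)))"

definition test_fun :: "'a::euclidean_space set \<Rightarrow> ('a \<Rightarrow> real) \<Rightarrow> bool" where
  "test_fun \<Omega> \<phi> \<longleftrightarrow> (\<forall>k. C_k k \<phi>) \<and>
     compact (closure {x. \<phi> x \<noteq> 0}) \<and> closure {x. \<phi> x \<noteq> 0} \<subseteq> \<Omega>"

text \<open>Near each boundary point, the set is the strict epigraph, in some direction \<open>e\<close>, of a C2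
  function of the remaining \<open>n - 1\<close> coordinates. That function is encoded as a function \<open>\<gamma>\<close> on
  the whole space which is constant along \<open>e\<close>.\<close>

definition C2_boundary :: "'a::euclidean_space set \<Rightarrow> bool" where
  "C2_boundary \<Omega> \<longleftrightarrow>
     (\<forall>p\<in>frontier \<Omega>. \<exists>r>0. \<exists>e \<gamma>. norm e = 1 \<and> C_k 2 \<gamma> \<and> (\<forall>x s. \<gamma> (x + s *\<^sub>R e) = \<gamma> x) \<and>
        \<Omega> \<inter> ball p r = {x \<in> ball p r. \<gamma> x < x \<bullet> e})"

definition bounded_C2_domain :: "'a::euclidean_space set \<Rightarrow> bool" where
  "bounded_C2_domain \<Omega> \<longleftrightarrow>
     open \<Omega> \<and> connected \<Omega> \<and> \<Omega> \<noteq> {} \<and> bounded \<Omega> \<and> C2_boundary \<Omega>"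

text \<open>Elements of Lebesgue and Sobolev spaces are represented by functions on the whole Euclidean
  space; only their values almost everywhere on \<open>\<Omega>\<close> matter, so the norms below are seminorms
  on representatives.\<close>

definition L2 :: "'a::euclidean_space set \<Rightarrow> ('a \<Rightarrow> 'b::euclidean_space) set" where
  "L2 \<Omega> = {f \<in> borel_measurable (lebesgue_on \<Omega>).
             integrable (lebesgue_on \<Omega>) (\<lambda>x. (norm (f x))\<^sup>2)}"

definition L2_inner ::
    "'a::euclidean_space set \<Rightarrow> ('a \<Rightarrow> 'b::euclidean_space) \<Rightarrow> ('a \<Rightarrow> 'b) \<Rightarrow> real" where
  "L2_inner \<Omega> f h = (LINT x|lebesgue_on \<Omega>. f x \<bullet> h x)"

definition L2_norm :: "'a::euclidean_space set \<Rightarrow> ('a \<Rightarrow> 'b::euclidean_space) \<Rightarrow> real" where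
  "L2_norm \<Omega> f = sqrt (L2_inner \<Omega> f f)"

definition weak_grad ::
    "'a::euclidean_space set \<Rightarrow> ('a \<Rightarrow> real) \<Rightarrow> ('a \<Rightarrow> 'a) \<Rightarrow> bool" where
  "weak_grad \<Omega> u G \<longleftrightarrow>
     (\<forall>\<phi> D. test_fun \<Omega> \<phi> \<and> (\<forall>x. GDERIV \<phi> x :> D x) \<longrightarrow>
        (LINT x|lebesgue_on \<Omega>. u x *\<^sub>R D x) = - (LINT x|lebesgue_on \<Omega>. \<phi> x *\<^sub>R G x))"

definition H1 :: "'a::euclidean_space set \<Rightarrow> ('a \<Rightarrow> real) set" where
  "H1 \<Omega> = {u \<in> L2 \<Omega>. \<exists>G\<in>L2 \<Omega>. weak_grad \<Omega> u G}"

text \<open>The weak gradient of an element of \<open>H1 \<Omega>\<close>; it is determined up to null sets.\<close>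

definition grad :: "'a::euclidean_space set \<Rightarrow> ('a \<Rightarrow> real) \<Rightarrow> 'a \<Rightarrow> 'a" where
  "grad \<Omega> u = (SOME G. G \<in> L2 \<Omega> \<and> weak_grad \<Omega> u G)"

definition H1_norm :: "'a::euclidean_space set \<Rightarrow> ('a \<Rightarrow> real) \<Rightarrow> real" where
  "H1_norm \<Omega> u = sqrt ((L2_norm \<Omega> u)\<^sup>2 + (L2_norm \<Omega> (grad \<Omega> u))\<^sup>2)"

definition H01 :: "'a::euclidean_space set \<Rightarrow> ('a \<Rightarrow> real) set" where
  "H01 \<Omega> = {u \<in> H1 \<Omega>. \<exists>\<phi>. (\<forall>k::nat. test_fun \<Omega> (\<phi> k)) \<and>
                       (\<lambda>k. H1_norm \<Omega> (\<lambda>x. \<phi> k x - u x)) \<longlonglongrightarrow> 0}"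

text \<open>The dual space of \<open>H01 \<Omega>\<close>, with the operator norm. A functional is represented by a function
  that is arbitrary outside \<open>H01 \<Omega>\<close>.\<close>

definition Hm1 :: "'a::euclidean_space set \<Rightarrow> (('a \<Rightarrow> real) \<Rightarrow> real) set" where
  "Hm1 \<Omega> = {F. (\<forall>\<psi>\<in>H01 \<Omega>. \<forall>\<eta>\<in>H01 \<Omega>. \<forall>a b. F (\<lambda>x. a * \<psi> x + b * \<eta> x) = a * F \<psi> + b * F \<eta>) \<and>
                (\<exists>C. \<forall>\<psi>\<in>H01 \<Omega>. \<bar>F \<psi>\<bar> \<le> C * H1_norm \<Omega> \<psi>)}"

definition Hm1_norm :: "'a::euclidean_space set \<Rightarrow> (('a \<Rightarrow> real) \<Rightarrow> real) \<Rightarrow> real" where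
  "Hm1_norm \<Omega> F = (SUP \<psi>\<in>{\<psi> \<in> H01 \<Omega>. H1_norm \<Omega> \<psi> \<le> 1}. \<bar>F \<psi>\<bar>)"

text \<open>The library's Bochner integral needs the values to form a type of class \<open>banach\<close>. Here they
  lie in a space given by a carrier \<open>X\<close> of representatives and a seminorm \<open>N\<close>.\<close>

definition strongly_measurable ::
    "'t measure \<Rightarrow> ('c \<Rightarrow> real) set \<Rightarrow> (('c \<Rightarrow> real) \<Rightarrow> real) \<Rightarrow> ('t \<Rightarrow> 'c \<Rightarrow> real) \<Rightarrow> bool" where
  "strongly_measurable M X N u \<longleftrightarrow> (AE t in M. u t \<in> X) \<and>
     (\<exists>s. (\<forall>k::nat. simple_function M (s k) \<and> s k ` space M \<subseteq> X) \<and>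
          (AE t in M. (\<lambda>k. N (\<lambda>x. s k t x - u t x)) \<longlonglongrightarrow> 0))"

definition L2_Bochner ::
    "real \<Rightarrow> real \<Rightarrow> ('c \<Rightarrow> real) set \<Rightarrow> (('c \<Rightarrow> real) \<Rightarrow> real) \<Rightarrow> (real \<Rightarrow> 'c \<Rightarrow> real) set" where
  "L2_Bochner a b X N = {u. strongly_measurable (lebesgue_on {a<..<b}) X N u \<and>
                            integrable (lebesgue_on {a<..<b}) (\<lambda>t. (N (u t))\<^sup>2)}"

text \<open>\<open>J\<close> is (a representative of) the Bochner integral of \<open>u\<close> over the finite measure space \<open>M\<close>.\<close>

definition is_Bochner_integral ::
    "'t measure \<Rightarrow> ('c \<Rightarrow> real) set \<Rightarrow> (('c \<Rightarrow> real) \<Rightarrow> real) \<Rightarrow>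
     ('t \<Rightarrow> 'c \<Rightarrow> real) \<Rightarrow> ('c \<Rightarrow> real) \<Rightarrow> bool" where
  "is_Bochner_integral M X N u J \<longleftrightarrow> J \<in> X \<and> strongly_measurable M X N u \<and>
     (\<exists>s. (\<forall>k::nat. simple_function M (s k) \<and> s k ` space M \<subseteq> X) \<and>
          (\<lambda>k. \<integral>\<^sup>+t. ennreal (N (\<lambda>x. s k t x - u t x)) \<partial>M) \<longlonglongrightarrow> 0 \<and>
          (\<lambda>k. N (\<lambda>x. (\<Sum>c\<in>s k ` space M. measure M {t \<in> space M. s k t = c} * c x) - J x))
             \<longlonglongrightarrow> 0)"

definition weak_time_deriv ::
    "real \<Rightarrow> 'a::euclidean_space set \<Rightarrow> (real \<Rightarrow> 'a \<Rightarrow> real) \<Rightarrow> (real \<Rightarrow> 'a \<Rightarrow> real) \<Rightarrow> bool" where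
  "weak_time_deriv T \<Omega> u w \<longleftrightarrow>
     (\<forall>\<phi>. test_fun {0<..<T} \<phi> \<longrightarrow>
        (\<exists>J. is_Bochner_integral (lebesgue_on {0<..<T}) (L2 \<Omega>) (L2_norm \<Omega>)
               (\<lambda>t x. deriv \<phi> t * u t x) J \<and>
             is_Bochner_integral (lebesgue_on {0<..<T}) (L2 \<Omega>) (L2_norm \<Omega>)
               (\<lambda>t x. - \<phi> t * w t x) J))"

definition U_space :: "real \<Rightarrow> 'a::euclidean_space set \<Rightarrow> (real \<Rightarrow> 'a \<Rightarrow> real) set" where
  "U_space T \<Omega> = {u \<in> L2_Bochner 0 T (H01 \<Omega>) (H1_norm \<Omega>).
                    \<exists>w\<in>L2_Bochner 0 T (L2 \<Omega>) (L2_norm \<Omega>). weak_time_deriv T \<Omega> u w}"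

text \<open>The time derivative of an element of \<open>U_space T \<Omega>\<close>; it is determined almost everywhere.\<close>

definition time_deriv ::
    "real \<Rightarrow> 'a::euclidean_space set \<Rightarrow> (real \<Rightarrow> 'a \<Rightarrow> real) \<Rightarrow> real \<Rightarrow> 'a \<Rightarrow> real" where
  "time_deriv T \<Omega> u =
     (SOME w. w \<in> L2_Bochner 0 T (L2 \<Omega>) (L2_norm \<Omega>) \<and> weak_time_deriv T \<Omega> u w)"

definition C_interval ::
    "real \<Rightarrow> ('c \<Rightarrow> real) set \<Rightarrow> (('c \<Rightarrow> real) \<Rightarrow> real) \<Rightarrow> (real \<Rightarrow> 'c \<Rightarrow> real) set" where
  "C_interval T X N = {c. \<forall>t\<in>{0..T}. c t \<in> X \<and>
      ((\<lambda>s. N (\<lambda>x. c s x - c t x)) \<longlongrightarrow> 0) (at t within {0..T})}"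

text \<open>The representative in \<open>C([0,T]; L2 \<Omega>)\<close> of an element of \<open>U_space T \<Omega>\<close>, through which values
  at single times are read off.\<close>

definition cont_rep ::
    "real \<Rightarrow> 'a::euclidean_space set \<Rightarrow> (real \<Rightarrow> 'a \<Rightarrow> real) \<Rightarrow> real \<Rightarrow> 'a \<Rightarrow> real" where
  "cont_rep T \<Omega> u = (SOME c. c \<in> C_interval T (L2 \<Omega>) (L2_norm \<Omega>) \<and>
      (AE t in lebesgue_on {0<..<T}. AE x in lebesgue_on \<Omega>. c t x = u t x))"

definition V_space :: "real \<Rightarrow> 'a::euclidean_space set \<Rightarrow> (real \<Rightarrow> 'a \<Rightarrow> real) set" where
  "V_space T \<Omega> = {v \<in> U_space T \<Omega>. AE x in lebesgue_on \<Omega>. cont_rep T \<Omega> v T x = 0}"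

definition delayed_deriv ::
    "real \<Rightarrow> 'a::euclidean_space set \<Rightarrow> real \<Rightarrow> (real \<Rightarrow> 'a \<Rightarrow> real) \<Rightarrow> (real \<Rightarrow> 'a \<Rightarrow> real) \<Rightarrow>
     real \<Rightarrow> 'a \<Rightarrow> real" where
  "delayed_deriv T \<Omega> \<tau> f0 u t =
     (if t < \<tau> then f0 (t - \<tau>) else time_deriv T \<Omega> u (t - \<tau>))"

text \<open>In the initial condition for \<open>u\<^sub>t\<close>, the representative in \<open>C([0,T]; Hm1 \<Omega>)\<close> is taken with
  respect to the embedding of \<open>L2 \<Omega>\<close> into \<open>Hm1 \<Omega>\<close> that sends \<open>f\<close> to \<open>L2_inner \<Omega> f\<close>.\<close>

definition weak_solution ::
    "'a::euclidean_space set \<Rightarrow> real \<Rightarrow> real \<Rightarrow> (real \<Rightarrow> real) \<Rightarrow> real \<Rightarrow> real \<Rightarrow>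
     ('a \<Rightarrow> real) \<Rightarrow> ('a \<Rightarrow> real) \<Rightarrow> (real \<Rightarrow> 'a \<Rightarrow> real) \<Rightarrow> (real \<Rightarrow> 'a \<Rightarrow> real) \<Rightarrow> bool" where
  "weak_solution \<Omega> T \<tau> g \<mu>1 \<mu>2 u0 u1 f0 u \<longleftrightarrow>
     u \<in> U_space T \<Omega> \<and>
     (\<forall>v\<in>V_space T \<Omega>.
        - (LINT t|lebesgue_on {0<..<T}. L2_inner \<Omega> (time_deriv T \<Omega> u t) (time_deriv T \<Omega> v t))
        + (LINT t|lebesgue_on {0<..<T}. L2_inner \<Omega> (grad \<Omega> (u t)) (grad \<Omega> (v t)))
        - (LINT t|lebesgue_on {0<..<T}. LINT s|lebesgue_on {0<..<t}.
             g (t - s) * L2_inner \<Omega> (grad \<Omega> (u s)) (grad \<Omega> (v t)))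
        + \<mu>1 * (LINT t|lebesgue_on {0<..<T}. L2_inner \<Omega> (time_deriv T \<Omega> u t) (v t))
        + \<mu>2 * (LINT t|lebesgue_on {0<..<T}. L2_inner \<Omega> (delayed_deriv T \<Omega> \<tau> f0 u t) (v t))
        - L2_inner \<Omega> u1 (cont_rep T \<Omega> v 0) = 0) \<and>
     (AE x in lebesgue_on \<Omega>. cont_rep T \<Omega> u 0 x = u0 x) \<and>
     (\<exists>w\<in>C_interval T (Hm1 \<Omega>) (Hm1_norm \<Omega>).
        (AE t in lebesgue_on {0<..<T}.
           \<forall>\<psi>\<in>H01 \<Omega>. w t \<psi> = L2_inner \<Omega> (time_deriv T \<Omega> u t) \<psi>) \<and>
        (\<forall>\<psi>\<in>H01 \<Omega>. w 0 \<psi> = L2_inner \<Omega> u1 \<psi>))"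

end

theory Submission
  imports Defs
begin

text \<open>Let \<open>z\<close> be the difference of two solutions and \<open>y\<close> its time derivative. Testing with
  \<open>\<phi> t * \<psi> x\<close>, where \<open>\<psi>\<close> is fixed in \<open>H01\<close>, \<open>\<phi> T = 0\<close> and \<open>\<phi>'\<close> is an arbitrary test function of time, and
  integrating by parts in time gives for almost every \<open>t\<close> the equation
  \<open>(y t, \<psi>) + \<integral>\<^sub>0\<^sup>t h (t - r) (\<nabla>z r, \<nabla>\<psi>) dr + \<mu>1 (z t, \<psi>) + \<mu>2 (z (t - \<tau>), \<psi>) = 0\<close>,
  where \<open>h x = 1 - \<integral>\<^sub>0\<^sup>x g\<close> and \<open>z (t - \<tau>)\<close> is to be read as \<open>0\<close> for \<open>t < \<tau>\<close>. It is linear and continuous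
  in \<open>\<psi>\<close>, and \<open>z\<close> is almost everywhere a limit of simple functions, so one may
  put \<open>\<psi> = z t\<close> and integrate over \<open>(0, b)\<close>. The first term becomes half of the squared norm of
  \<open>z b\<close>. The second is half of the quadratic form of the kernel \<open>h \<bar>t - r\<bar>\<close>, which is nonnegative by
  Polya's criterion: \<open>h\<close> is positive, nonincreasing and convex because \<open>g\<close> has mass less than \<open>1\<close>,
  is nonnegative and is nonincreasing. Gronwall's inequality then yields \<open>z = 0\<close>.\<close>

section \<open>Test functions and the fundamental lemma\<close>

text \<open>The usual energy argument would test with the time derivative of z, but that derivative
  takes values only in \<open>L2\<close>, not in \<open>H01\<close>, so it is not an admissible
  multiplier. Integrating the equation once in time lowers the order: z itself becomes the
  multiplier, and the estimate controls z in \<open>L2\<close> instead of the full energy. The price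
  is the Volterra term, into which the elastic and the memory part merge: it contains gradients,
  which the \<open>L2\<close> norm cannot bound, so it can only be discarded by its sign. This is
  why positivity of the kernel is the heart of the matter. The terms with \<mu>1 and \<mu>2 have
  lost their time derivative and are bounded by norms of z, whatever their signs. A second obstacle
  is that functions are representatives measured by seminorms: equations hold off null sets that
  depend on \<psi>, and the product of two complete measures need not be complete. A fixed sequence
  of simple approximations of each function deals with both.\<close>

lemma C_k_const: "C_k k (\<lambda>x::'a::euclidean_space. c)"
proof (induction k arbitrary: c)
  case (Suc k)
  show ?case
    unfolding C_k.simps by (rule exI[of _ "\<lambda>x. 0"]) (auto intro: GDERIV_const Suc)
qed simp

lemma C_k_continuous: "C_k k f \<Longrightarrow> continuous_on UNIV f"
proof (cases k)
  case (Suc m)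
  assume "C_k k f"
  then obtain G where "\<And>x. GDERIV f x :> G x" using Suc by auto
  then have "\<And>x. f differentiable (at x)" unfolding gderiv_def differentiable_def by blast
  then show ?thesis by (simp add: differentiable_imp_continuous_within continuous_at_imp_continuous_on)
qed simp

text \<open>The recursion speaks only of the components of a gradient, so a lower order has to be
  recovered; the base case is that differentiability implies continuity.\<close>

lemma C_k_Suc_D: "C_k (Suc k) f \<Longrightarrow> C_k k f"
proof (induction k arbitrary: f)
  case 0
  then show ?case using C_k_continuous[of "Suc 0" f] by simp
next
  case (Suc k)
  then show ?case by (metis C_k.simps(2))
qed

lemma C_k_add: "C_k k f \<Longrightarrow> C_k k h \<Longrightarrow> C_k k (\<lambda>x. f x + h x)"
proof (induction k arbitrary: f h)
  case 0
  then show ?case by (auto intro: continuous_intros)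
next
  case (Suc k)
  from Suc.prems obtain F H where F: "\<And>x. GDERIV f x :> F x" "\<And>b. b\<in>Basis \<Longrightarrow> C_k k (\<lambda>x. F x \<bullet> b)"
    and H: "\<And>x. GDERIV h x :> H x" "\<And>b. b\<in>Basis \<Longrightarrow> C_k k (\<lambda>x. H x \<bullet> b)"
    unfolding C_k.simps by blast
  show ?case unfolding C_k.simps
    by (rule exI[of _ "\<lambda>x. F x + H x"]) (auto intro: GDERIV_add F H Suc.IH simp: inner_add_left)
qed

lemma C_k_mult: "C_k k f \<Longrightarrow> C_k k h \<Longrightarrow> C_k k (\<lambda>x. f x * h x)"
proof (induction k arbitrary: f h)
  case 0
  then show ?case by (auto intro: continuous_intros)
next
  case (Suc k)
  from Suc.prems obtain F H where F: "\<And>x. GDERIV f x :> F x" "\<And>b. b\<in>Basis \<Longrightarrow> C_k k (\<lambda>x. F x \<bullet> b)"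
    and H: "\<And>x. GDERIV h x :> H x" "\<And>b. b\<in>Basis \<Longrightarrow> C_k k (\<lambda>x. H x \<bullet> b)"
    unfolding C_k.simps by blast
  \<comment> \<open>The Leibniz rule multiplies a gradient by an undifferentiated factor, so the
    factors themselves are needed at order k as well.\<close>
  note fh = Suc.prems[THEN C_k_Suc_D]
  show ?case unfolding C_k.simps
  proof (intro exI[of _ "\<lambda>x. f x *\<^sub>R H x + h x *\<^sub>R F x"] conjI allI ballI)
    fix x show "GDERIV (\<lambda>x. f x * h x) x :> f x *\<^sub>R H x + h x *\<^sub>R F x"
      by (rule GDERIV_mult[OF F(1) H(1)])
  next
    fix b :: 'a assume b: "b \<in> Basis"
    have "C_k k (\<lambda>x. f x * (H x \<bullet> b) + h x * (F x \<bullet> b))"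
      using b by (intro C_k_add Suc.IH fh F H)
    then show "C_k k (\<lambda>x. (f x *\<^sub>R H x + h x *\<^sub>R F x) \<bullet> b)" by (simp add: inner_add_left)
  qed
qed

lemma C_k_prod: "finite A \<Longrightarrow> (\<And>i. i \<in> A \<Longrightarrow> C_k k (f i)) \<Longrightarrow> C_k k (\<lambda>x. \<Prod>i\<in>A. f i x)"
  by (induction A rule: finite_induct) (auto intro: C_k_const C_k_mult)

text \<open>The derivative of \<open>flat_exp n c\<close> is a linear combination of functions of the same family,
  so smoothness follows by induction for all \<open>n\<close> at once.\<close>

definition flat_exp :: "nat \<Rightarrow> real \<Rightarrow> real \<Rightarrow> real" where
  "flat_exp n c x = (if x \<le> 0 then 0 else exp (- c / x) / x ^ n)"

lemma flat_exp_tendsto_0: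
  assumes "c > 0" shows "((\<lambda>x. flat_exp n c x) \<longlongrightarrow> 0) (at 0)"
proof -
  have l: "((\<lambda>x. flat_exp n c x) \<longlongrightarrow> 0) (at_left 0)"
    by (rule tendsto_eventually) (auto simp: flat_exp_def eventually_at_filter)
  have "((\<lambda>x::real. (x ^ n) / exp x) \<longlongrightarrow> 0) at_top" by (rule tendsto_power_div_exp_0)
  moreover have "filterlim (\<lambda>x. c / x) at_top (at_right (0::real))"
    unfolding divide_inverse using assms
    by (intro filterlim_tendsto_pos_mult_at_top[OF tendsto_const] filterlim_inverse_at_top_right) auto
  ultimately have "((\<lambda>x::real. ((c/x) ^ n) / exp (c/x)) \<longlongrightarrow> 0) (at_right 0)"
    by (rule filterlim_compose)
  then have "((\<lambda>x::real. (1/c^n) * (((c/x) ^ n) / exp (c/x))) \<longlongrightarrow> (1/c^n)*0) (at_right 0)"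
    by (intro tendsto_mult tendsto_const)
  moreover have "eventually (\<lambda>x. (1/c^n) * (((c/x) ^ n) / exp (c/x)) = flat_exp n c x) (at_right 0)"
    using eventually_at_right_less[of "0::real"]
    by eventually_elim (use assms in \<open>auto simp: flat_exp_def exp_minus power_divide field_simps\<close>)
  ultimately have r: "((\<lambda>x. flat_exp n c x) \<longlongrightarrow> 0) (at_right 0)"
    by (simp add: filterlim_cong)
  show ?thesis using l r by (simp add: filterlim_split_at)
qed

text \<open>Only the origin is delicate. There the difference quotient of member n of the family is
  member n + 1, which has just been shown to tend to 0.\<close>

lemma flat_exp_deriv:
  assumes c: "c > 0"
  shows "(flat_exp n c has_real_derivative (c * flat_exp (n+2) c x - n * flat_exp (n+1) c x)) (at x)"
proof -
  consider "x < 0" | "x = 0" | "x > 0" by linarith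
  then show ?thesis
  proof cases
    case 1
    have "((\<lambda>x. 0) has_real_derivative 0) (at x)" by simp
    moreover have "eventually (\<lambda>y. 0 = flat_exp n c y) (nhds x)"
      by (rule eventually_mono[OF eventually_nhds_in_open[of "{..<0}" x]])
        (use 1 in \<open>auto simp: flat_exp_def\<close>)
    ultimately have "(flat_exp n c has_real_derivative 0) (at x)"
      by (subst DERIV_cong_ev[OF refl, of _ "\<lambda>y. 0"]) (auto elim: eventually_mono)
    then show ?thesis using 1 by (simp add: flat_exp_def)
  next
    case 2
    have "flat_exp n c y / y = flat_exp (n+1) c y" for y by (simp add: flat_exp_def)
    then have "((\<lambda>y. (flat_exp n c y - flat_exp n c 0) / (y - 0)) \<longlongrightarrow> 0) (at 0)"
      using flat_exp_tendsto_0[OF c, of "n+1"] by (simp add: flat_exp_def)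
    then have "(flat_exp n c has_real_derivative 0) (at 0)"
      by (simp add: has_field_derivative_iff)
    then show ?thesis using 2 by (simp add: flat_exp_def)
  next
    case 3
    \<comment> \<open>Natural subtraction truncates at n = 0, where the factor n makes both sides
      vanish.\<close>
    have p: "real n * x ^ (n - Suc 0) = real n * (x ^ n / x)" using 3 by (cases n) auto
    have "((\<lambda>x. exp (- c / x) / x ^ n) has_real_derivative
        (exp (- c / x) * (c / x\<^sup>2) * x ^ n - exp (- c / x) * (real n * x ^ (n - Suc 0))) / (x ^ n * x ^ n)) (at x)"
      using 3 by (auto intro!: derivative_eq_intros simp: power2_eq_square)
    then have "((\<lambda>x. exp (- c / x) / x ^ n) has_real_derivative
        (c * flat_exp (n+2) c x - n * flat_exp (n+1) c x)) (at x)"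
      by (rule DERIV_cong) (use 3 in \<open>simp add: p flat_exp_def field_simps power2_eq_square\<close>)
    moreover have "eventually (\<lambda>y. exp (- c / y) / y ^ n = flat_exp n c y) (nhds x)"
      by (rule eventually_mono[OF eventually_nhds_in_open[of "{0<..}" x]])
        (use 3 in \<open>auto simp: flat_exp_def\<close>)
    ultimately show ?thesis
      by (subst DERIV_cong_ev[OF refl, of _ "\<lambda>y. exp (- c / y) / y ^ n"]) (auto elim: eventually_mono)
  qed
qed

text \<open>The affine argument makes each one-sided factor of a box bump a direct instance, with i
  and its negative for opposite faces of the box.\<close>

lemma C_k_flat_exp:
  fixes i :: "'a::euclidean_space"
  assumes c: "c > 0"
  shows "C_k k (\<lambda>x. flat_exp n c (x \<bullet> i + a))"
proof (induction k arbitrary: n)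
  case 0
  have "continuous_on UNIV (flat_exp n c)"
    using flat_exp_deriv[OF c] by (meson DERIV_isCont continuous_at_imp_continuous_on)
  then have "continuous_on UNIV (flat_exp n c \<circ> (\<lambda>x. x \<bullet> i + a))"
    by (intro continuous_on_compose continuous_intros) (auto intro: continuous_on_subset)
  then show ?case by (simp add: o_def)
next
  case (Suc k)
  let ?D = "\<lambda>x. c * flat_exp (n+2) c x + (- real n) * flat_exp (n+1) c x"
  have A: "GDERIV (\<lambda>x. x \<bullet> i + a) x :> i" for x
    unfolding gderiv_def by (auto intro!: derivative_eq_intros)
  show ?case unfolding C_k.simps
  proof (intro exI[of _ "\<lambda>x. ?D (x \<bullet> i + a) *\<^sub>R i"] conjI allI ballI)
    fix x show "GDERIV (\<lambda>x. flat_exp n c (x \<bullet> i + a)) x :> ?D (x \<bullet> i + a) *\<^sub>R i"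
      using GDERIV_DERIV_compose[OF A flat_exp_deriv[OF c]] by simp
  next
    fix b :: 'a
    have "C_k k (\<lambda>x. (c * flat_exp (n+2) c (x \<bullet> i + a) + (- real n) * flat_exp (n+1) c (x \<bullet> i + a)) * (i \<bullet> b))"
      by (intro C_k_mult C_k_add C_k_const Suc)
    then show "C_k k (\<lambda>x. (?D (x \<bullet> i + a) *\<^sub>R i) \<bullet> b)" by simp
  qed
qed

text \<open>The parameter c is a sharpness. Each factor is exp (- c / r) with r the distance to a
  face, so the bump stays below 1 and turns into the indicator of the open box as c tends to
  0.\<close>

definition box_bump :: "real \<Rightarrow> 'a::euclidean_space \<Rightarrow> 'a \<Rightarrow> 'a \<Rightarrow> real" where
  "box_bump c a b x =
     (\<Prod>i\<in>Basis. flat_exp 0 c (x \<bullet> i + - (a \<bullet> i)) * flat_exp 0 c (x \<bullet> (- i) + b \<bullet> i))"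

lemma box_bump_pos_iff: "box_bump c a b x \<noteq> 0 \<longleftrightarrow> x \<in> box a b"
  unfolding box_bump_def by (auto simp: flat_exp_def mem_box)

lemma box_bump_bounds: "c > 0 \<Longrightarrow> 0 \<le> box_bump c a b x \<and> box_bump c a b x \<le> 1"
  unfolding box_bump_def
  by (intro conjI prod_nonneg prod_le_1) (auto simp: flat_exp_def mult_le_one divide_nonneg_pos)

lemma test_fun_box_bump:
  assumes "c > 0" "cbox a b \<subseteq> \<Omega>" shows "test_fun \<Omega> (box_bump c a b)"
proof -
  have "C_k k (box_bump c a b)" for k
    unfolding box_bump_def [abs_def] by (intro C_k_prod C_k_mult C_k_flat_exp assms) auto
  moreover have "{x. box_bump c a b x \<noteq> 0} = box a b" using box_bump_pos_iff by auto
  moreover have "closure (box a b) \<subseteq> cbox a b" by (rule closure_minimal[OF box_subset_cbox closed_cbox])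
  ultimately show ?thesis unfolding test_fun_def using assms
    by (auto simp: compact_eq_bounded_closed)
qed

lemma box_bump_tendsto:
  "(\<lambda>k. box_bump (inverse (real (Suc k))) a b x) \<longlonglongrightarrow> indicator (box a b) x"
proof (cases "x \<in> box a b")
  case True
  have 1: "(\<lambda>k. flat_exp 0 (inverse (real (Suc k))) r) \<longlonglongrightarrow> 1" if "r > 0" for r
  proof -
    have "(\<lambda>k. - inverse (real (Suc k)) / r) \<longlonglongrightarrow> - 0 / r"
      by (intro tendsto_intros LIMSEQ_inverse_real_of_nat) (use that in auto)
    from tendsto_exp[OF this] show ?thesis using that by (simp add: flat_exp_def)
  qed
  have "(\<lambda>k. box_bump (inverse (real (Suc k))) a b x) \<longlonglongrightarrow> (\<Prod>i\<in>(Basis::'a set). 1 * 1)"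
    unfolding box_bump_def
    by (intro tendsto_prod tendsto_mult 1) (use True in \<open>auto simp: mem_box\<close>)
  then show ?thesis using True by simp
next
  case False
  then have "box_bump (inverse (real (Suc k))) a b x = 0" for k using box_bump_pos_iff by blast
  then show ?thesis using False by simp
qed

lemma test_fun_continuous: "test_fun \<Omega> \<phi> \<Longrightarrow> continuous_on UNIV \<phi>"
  unfolding test_fun_def using C_k_continuous by blast

lemma test_fun_bounded:
  assumes "test_fun \<Omega> \<phi>" obtains B where "\<And>x. \<bar>\<phi> x\<bar> \<le> B" "B \<ge> 0"
proof -
  let ?K = "closure {x. \<phi> x \<noteq> 0}"
  have "compact (\<phi> ` ?K)" using assms test_fun_continuous[OF assms]
    by (intro compact_continuous_image) (auto simp: test_fun_def intro: continuous_on_subset)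
  then obtain B where B: "\<And>x. x \<in> ?K \<Longrightarrow> \<bar>\<phi> x\<bar> \<le> B" by (force dest!: compact_imp_bounded simp: bounded_iff)
  have "\<bar>\<phi> x\<bar> \<le> max B 0" for x
  proof (cases "\<phi> x = 0")
    case False
    then have "x \<in> ?K" using closure_subset by fastforce
    from B[OF this] show ?thesis by simp
  qed auto
  then show ?thesis using that by fastforce
qed

section \<open>The fundamental lemma of the calculus of variations\<close>

lemma integrable_bounded_mult:
  fixes f :: "'a \<Rightarrow> real"
  assumes "integrable M f" "h \<in> borel_measurable M" "\<And>x. x \<in> space M \<Longrightarrow> \<bar>h x\<bar> \<le> B"
  shows "integrable M (\<lambda>x. h x * f x)"
proof (rule Bochner_Integration.integrable_bound[of M "\<lambda>x. B * norm (f x)"])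
  show "AE x in M. norm (h x * f x) \<le> norm (B * norm (f x))"
    using assms(3) by (auto simp: abs_mult intro!: mult_mono AE_I2 order_trans[OF assms(3) abs_ge_self])
qed (use assms in auto)

lemma continuous_measurable_lebesgue_on:
  fixes f :: "'a::euclidean_space \<Rightarrow> 'b::euclidean_space"
  assumes "continuous_on UNIV f" "S \<in> sets lebesgue" shows "f \<in> borel_measurable (lebesgue_on S)"
proof -
  have "f \<in> borel_measurable lborel" using assms by (simp add: borel_measurable_continuous_onI)
  then have "f \<in> borel_measurable lebesgue" using measurable_completion by blast
  then show ?thesis by (rule measurable_restrict_space1)
qed

text \<open>The bumps with c = 1 / (k + 1) are admissible, bounded by 1 and converge to the
  indicator of the box, so dominated convergence with majorant \<bar>f\<bar> carries the hypothesis
  over to boxes.\<close>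

lemma fundamental_lemma_box:
  fixes f :: "'a::euclidean_space \<Rightarrow> real"
  assumes S: "\<Omega> \<in> sets lebesgue" and f: "integrable (lebesgue_on \<Omega>) f"
    and 0: "\<And>\<phi>. test_fun \<Omega> \<phi> \<Longrightarrow> (LINT x|lebesgue_on \<Omega>. \<phi> x * f x) = 0"
    and ab: "cbox a b \<subseteq> \<Omega>"
  shows "(LINT x|lebesgue_on \<Omega>. indicator (box a b) x * f x) = 0"
proof -
  let ?b = "\<lambda>k. box_bump (inverse (real (Suc k))) a b"
  have t: "test_fun \<Omega> (?b k)" for k using ab by (intro test_fun_box_bump) auto
  have "(\<lambda>k. LINT x|lebesgue_on \<Omega>. ?b k x * f x) \<longlonglongrightarrow> (LINT x|lebesgue_on \<Omega>. indicator (box a b) x * f x)"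
  proof (rule integral_dominated_convergence[where w="\<lambda>x. norm (f x)"])
    show "(\<lambda>x. ?b k x * f x) \<in> borel_measurable (lebesgue_on \<Omega>)" for k
      using f continuous_measurable_lebesgue_on[OF test_fun_continuous[OF t] S] by auto
    show "AE x in lebesgue_on \<Omega>. (\<lambda>k. ?b k x * f x) \<longlonglongrightarrow> indicator (box a b) x * f x"
      by (intro AE_I2 tendsto_mult box_bump_tendsto tendsto_const)
    show "AE x in lebesgue_on \<Omega>. norm (?b k x * f x) \<le> norm (f x)" for k
      using box_bump_bounds[of "inverse (real (Suc k))" a b]
      by (intro AE_I2) (auto simp: abs_mult mult_le_cancel_right1 intro: mult_left_le_one_le)
    show "(\<lambda>x. indicator (box a b) x * f x) \<in> borel_measurable (lebesgue_on \<Omega>)"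
      using f by (intro borel_measurable_times measurable_restrict_space1[OF borel_measurable_indicator])
        (auto dest: borel_measurable_integrable)
  qed (use f in auto)
  then show ?thesis using 0[OF t] by (simp add: LIMSEQ_const_iff)
qed

text \<open>The measures whose densities are the positive and the negative part agree on open boxes,
  an intersection-stable generator of the Borel sets, hence coincide; finite densities are
  determined almost everywhere. Since the generator is Borel, f is first replaced by a Borel
  function equal to it almost everywhere.\<close>

lemma AE_zero_if_box_integrals_zero:
  fixes f :: "'a::euclidean_space \<Rightarrow> real"
  assumes f: "integrable lebesgue f"
    and 0: "\<And>a b. (LINT x|lebesgue. indicator (box a b) x * f x) = 0"
  shows "AE x in lebesgue. f x = 0"
proof -
  obtain g where g: "g \<in> borel_measurable lborel" and fg: "AE x in lborel. f x = g x"
    using completion_ex_borel_measurable_real[of f lborel] f by auto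
  have fg': "AE x in lebesgue. f x = g x" using fg by (rule AE_completion)
  have "integrable lebesgue g" using integrable_cong_AE_imp[OF f _ fg'] g by (auto simp: eq_commute measurable_completion)
  then have gi: "integrable lborel g" using g by (simp add: integrable_completion)
  have g0: "(LINT x|lborel. indicator (box a b) x * g x) = 0" for a b
  proof -
    have "(LINT x|lborel. indicator (box a b) x * g x) = (LINT x|lebesgue. indicator (box a b) x * g x)"
      using g by (intro integral_completion[symmetric]) auto
    also have "\<dots> = (LINT x|lebesgue. indicator (box a b) x * f x)"
    proof (rule integral_cong_AE)
      show "(\<lambda>x. indicat_real (box a b) x * f x) \<in> borel_measurable lebesgue"
        by (intro borel_measurable_times borel_measurable_indicator borel_measurable_integrable[OF f]) auto
      show "(\<lambda>x. indicat_real (box a b) x * g x) \<in> borel_measurable lebesgue"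
        using g by (intro measurable_completion borel_measurable_times borel_measurable_indicator) auto
      show "AE x in lebesgue. indicat_real (box a b) x * g x = indicat_real (box a b) x * f x"
        using fg' by eventually_elim simp
    qed
    finally show ?thesis using 0 by simp
  qed
  define p where "p = (\<lambda>x. ennreal (max 0 (g x)))"
  define m where "m = (\<lambda>x. ennreal (max 0 (- g x)))"
  have meas: "p \<in> borel_measurable lborel" "m \<in> borel_measurable lborel"
    unfolding p_def m_def using g by auto
  let ?E = "range (\<lambda>(a, b). box a b :: 'a set)"
  have eq: "emeasure (density lborel p) (box a b) = emeasure (density lborel m) (box a b)"
    and fin: "emeasure (density lborel p) (box a b) \<noteq> \<infinity>" for a b
  proof -
    let ?p = "\<lambda>x. indicator (box a b) x * max 0 (g x)" and ?m = "\<lambda>x. indicator (box a b) x * max 0 (- g x)"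
    have i: "integrable lborel ?p" "integrable lborel ?m"
      using gi by (auto intro!: integrable_bounded_mult[where B=1] simp: indicator_def)
    have "(LINT x|lborel. ?p x) - (LINT x|lborel. ?m x) = (LINT x|lborel. indicator (box a b) x * g x)"
      by (subst Bochner_Integration.integral_diff[OF i, symmetric]) (auto intro!: Bochner_Integration.integral_cong simp: indicator_def)
    then have "(LINT x|lborel. ?p x) = (LINT x|lborel. ?m x)" using g0 by simp
    moreover have "emeasure (density lborel p) (box a b) = ennreal (LINT x|lborel. ?p x)"
      unfolding p_def using g i by (subst emeasure_density)
        (auto simp: nn_integral_eq_integral[symmetric] indicator_def intro!: nn_integral_cong)
    moreover have "emeasure (density lborel m) (box a b) = ennreal (LINT x|lborel. ?m x)"
      unfolding m_def using g i by (subst emeasure_density)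
        (auto simp: nn_integral_eq_integral[symmetric] indicator_def intro!: nn_integral_cong)
    ultimately show "emeasure (density lborel p) (box a b) = emeasure (density lborel m) (box a b)"
      "emeasure (density lborel p) (box a b) \<noteq> \<infinity>" by auto
  qed
  have "density lborel p = density lborel m"
  proof (rule measure_eqI_generator_eq)
    show "Int_stable ?E"
      by (auto simp: Int_stable_def box_Int_box)
    show "?E \<subseteq> Pow UNIV" "sets (density lborel p) = sigma_sets UNIV ?E" "sets (density lborel m) = sigma_sets UNIV ?E"
      by (simp_all add: borel_eq_box)
    let ?A = "\<lambda>n::nat. box (- (real n *\<^sub>R One)) (real n *\<^sub>R One) :: 'a set"
    show "range ?A \<subseteq> ?E" "(\<Union>i. ?A i) = UNIV"
      unfolding UN_box_eq_UNIV by auto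
    show "emeasure (density lborel p) (?A i) \<noteq> \<infinity>" for i by (rule fin)
    show "emeasure (density lborel p) X = emeasure (density lborel m) X" if "X \<in> ?E" for X
      using that eq by auto
  qed
  moreover have "(\<integral>\<^sup>+ x. p x \<partial>lborel) \<noteq> \<infinity>"
  proof -
    have "(\<integral>\<^sup>+ x. p x \<partial>lborel) \<le> (\<integral>\<^sup>+ x. ennreal (norm (g x)) \<partial>lborel)"
      unfolding p_def by (intro nn_integral_mono ennreal_leI) auto
    also have "\<dots> < \<infinity>" using gi by (simp add: integrable_iff_bounded)
    finally show ?thesis by simp
  qed
  ultimately have "AE x in lborel. p x = m x"
    using meas finite_density_unique[of p lborel m] by auto
  then have "AE x in lborel. g x = 0"
    by eventually_elim (auto simp: p_def m_def max_def split: if_splits)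
  then have "AE x in lebesgue. g x = 0" by (rule AE_completion)
  with fg' show ?thesis by eventually_elim simp
qed

text \<open>An open set is a countable union of boxes whose closures it contains, so it suffices to
  treat f cut off to one such box. Integrals of the cut-off function over arbitrary boxes are
  integrals of f over smaller boxes, which vanish.\<close>

theorem fundamental_lemma:
  fixes f :: "'a::euclidean_space \<Rightarrow> real"
  assumes S: "open \<Omega>" and f: "integrable (lebesgue_on \<Omega>) f"
    and 0: "\<And>\<phi>. test_fun \<Omega> \<phi> \<Longrightarrow> (LINT x|lebesgue_on \<Omega>. \<phi> x * f x) = 0"
  shows "AE x in lebesgue_on \<Omega>. f x = 0"
proof -
  have Sl: "\<Omega> \<in> sets lebesgue" using S by auto
  \<comment> \<open>Rational corners give countability. Asking for the closed box inside \<Omega>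
    keeps the supports of the approximating bumps inside \<Omega>.\<close>
  obtain D where D: "countable D" "\<And>X. X \<in> D \<Longrightarrow> \<exists>a b. X = box a b \<and> cbox a b \<subseteq> \<Omega>" "\<Union>D = \<Omega>"
  proof -
    let ?a = "\<lambda>f. (\<Sum>i\<in>Basis. fst (f i) *\<^sub>R i)" and ?b = "\<lambda>f. (\<Sum>i\<in>Basis. snd (f i) *\<^sub>R i)"
    let ?I = "{f\<in>Basis \<rightarrow>\<^sub>E \<rat> \<times> \<rat>. cbox (?a f) (?b f :: 'a) \<subseteq> \<Omega>}"
    let ?D = "(\<lambda>f. box (?a f) (?b f :: 'a)) ` ?I"
    have "countable ?I" by (simp add: countable_PiE countable_rat)
    moreover have "\<Union>?D = \<Omega>"
    proof (intro equalityI subsetI)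
      fix x assume "x \<in> \<Union>?D" then show "x \<in> \<Omega>" using box_subset_cbox by fastforce
    next
      fix x assume "x \<in> \<Omega>"
      then obtain e where e: "e > 0" "cball x e \<subseteq> \<Omega>" using S open_contains_cball by blast
      obtain a b where ab: "x \<in> box a b" "\<forall>i \<in> Basis. a \<bullet> i \<in> \<rat>" "\<forall>i \<in> Basis. b \<bullet> i \<in> \<rat>" "box a b \<subseteq> ball x e"
        using rational_boxes[OF e(1)] by metis
      have "cbox a b = closure (box a b)" using ab(1) by (subst closure_box) auto
      also have "\<dots> \<subseteq> cball x e" using ab(4) ball_subset_cball by (intro closure_minimal) auto
      finally have "cbox a b \<subseteq> \<Omega>" using e by auto
      then show "x \<in> \<Union>?D" using ab
        by (auto intro!: bexI[of _ "\<lambda>i\<in>Basis. (a \<bullet> i, b \<bullet> i)"] exI[of _ "\<lambda>i\<in>Basis. (a \<bullet> i, b \<bullet> i)"] simp: euclidean_representation)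
    qed
    ultimately show ?thesis using that[of ?D] by auto
  qed
  have "AE x in lebesgue. x \<in> X \<longrightarrow> f x = 0" if X: "X \<in> D" for X
  proof -
    obtain a b where ab: "X = box a b" "cbox a b \<subseteq> \<Omega>" using D X by blast
    then have sub: "box a b \<subseteq> \<Omega>" using box_subset_cbox by blast
    let ?F = "\<lambda>x. indicator (box a b) x * f x"
    have F: "integrable lebesgue ?F"
    proof -
      have "integrable (lebesgue_on \<Omega>) ?F" using f
        by (intro integrable_bounded_mult[where B=1] measurable_restrict_space1 borel_measurable_indicator) (auto simp: indicator_def)
      then have "integrable lebesgue (\<lambda>x. indicator \<Omega> x *\<^sub>R ?F x)" using Sl by (simp add: integrable_restrict_space)
      moreover have "(\<lambda>x. indicator \<Omega> x *\<^sub>R ?F x) = ?F" using sub by (intro ext) (auto simp: indicator_def)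
      ultimately show ?thesis by simp
    qed
    have "AE x in lebesgue. ?F x = 0"
    proof (rule AE_zero_if_box_integrals_zero[OF F])
      fix p q :: 'a
      obtain p' q' where pq: "box p q \<inter> box a b = box p' q'" using box_Int_box by blast
      have "(LINT x|lebesgue. indicator (box p q) x * ?F x) = (LINT x|lebesgue. indicator \<Omega> x *\<^sub>R (indicator (box p' q') x * f x))"
        using sub by (intro Bochner_Integration.integral_cong) (auto simp: pq[symmetric] indicator_def)
      also have "\<dots> = (LINT x|lebesgue_on \<Omega>. indicator (box p' q') x * f x)"
        using Sl by (simp add: integral_restrict_space)
      also have "\<dots> = 0"
      proof (cases "box p' q' = {}")
        case False
        have "cbox p' q' = closure (box p' q')" using False by (simp add: closure_box)
        also have "\<dots> \<subseteq> cbox a b" unfolding pq[symmetric]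
          by (metis box_subset_cbox closed_cbox closure_minimal le_infI2)
        finally show ?thesis using ab by (intro fundamental_lemma_box[OF Sl f 0]) auto
      qed simp
      finally show "(LINT x|lebesgue. indicator (box p q) x * ?F x) = 0" .
    qed
    then show ?thesis using ab by (auto simp: indicator_def elim!: eventually_mono)
  qed
  then have "AE x in lebesgue. \<forall>X\<in>D. x \<in> X \<longrightarrow> f x = 0"
    using D(1) by (intro AE_ball_countable') auto
  then have "AE x in lebesgue. x \<in> \<Omega> \<longrightarrow> f x = 0"
    by eventually_elim (use D(3) in auto)
  then show ?thesis using Sl by (simp add: AE_restrict_space_iff)
qed

section \<open>Semi-inner products, Lebesgue and Sobolev spaces\<close>

text \<open>Functions stand for classes modulo null sets, so the form is only semidefinite, and it
  lives on a carrier set instead of a type. One abstract treatment then serves \<open>L2\<close>,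
  the Dirichlet form and the full Sobolev product.\<close>

locale semi_inner =
  fixes X :: "('c \<Rightarrow> real) set" and ip :: "('c \<Rightarrow> real) \<Rightarrow> ('c \<Rightarrow> real) \<Rightarrow> real"
  assumes zero_mem: "(\<lambda>x. 0) \<in> X"
    and lin_mem: "\<And>a b f h. f \<in> X \<Longrightarrow> h \<in> X \<Longrightarrow> (\<lambda>x. a * f x + b * h x) \<in> X"
    and ip_sym: "\<And>f h. f \<in> X \<Longrightarrow> h \<in> X \<Longrightarrow> ip f h = ip h f"
    and ip_lin: "\<And>a b f h k. f \<in> X \<Longrightarrow> h \<in> X \<Longrightarrow> k \<in> X \<Longrightarrow>
                   ip (\<lambda>x. a * f x + b * h x) k = a * ip f k + b * ip h k"
    and ip_nonneg: "\<And>f. f \<in> X \<Longrightarrow> 0 \<le> ip f f"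
begin

definition nrm :: "('c \<Rightarrow> real) \<Rightarrow> real" where "nrm f = sqrt (ip f f)"

lemma ip_lin_right: "f \<in> X \<Longrightarrow> h \<in> X \<Longrightarrow> k \<in> X \<Longrightarrow> ip k (\<lambda>x. a * f x + b * h x) = a * ip k f + b * ip k h"
  using ip_lin[of f h k a b] ip_sym[of k "\<lambda>x. a * f x + b * h x"] ip_sym[of k f] ip_sym[of k h] lin_mem[of f h a b]
  by simp

lemma diff_mem: "f \<in> X \<Longrightarrow> h \<in> X \<Longrightarrow> (\<lambda>x. f x - h x) \<in> X"
  using lin_mem[of f h 1 "-1"] by simp

lemma add_mem: "f \<in> X \<Longrightarrow> h \<in> X \<Longrightarrow> (\<lambda>x. f x + h x) \<in> X"
  using lin_mem[of f h 1 "1"] by simp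

lemma scale_mem: "f \<in> X \<Longrightarrow> (\<lambda>x. a * f x) \<in> X"
  using lin_mem[of f f a 0] by simp

lemma ip_diff_left: "f \<in> X \<Longrightarrow> h \<in> X \<Longrightarrow> k \<in> X \<Longrightarrow> ip (\<lambda>x. f x - h x) k = ip f k - ip h k"
  using ip_lin[of f h k 1 "-1"] by simp

lemma ip_diff_right: "f \<in> X \<Longrightarrow> h \<in> X \<Longrightarrow> k \<in> X \<Longrightarrow> ip k (\<lambda>x. f x - h x) = ip k f - ip k h"
  using ip_lin_right[of f h k 1 "-1"] by simp

lemma ip_add_left: "f \<in> X \<Longrightarrow> h \<in> X \<Longrightarrow> k \<in> X \<Longrightarrow> ip (\<lambda>x. f x + h x) k = ip f k + ip h k"
  using ip_lin[of f h k 1 "1"] by simp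

lemma ip_add_right: "f \<in> X \<Longrightarrow> h \<in> X \<Longrightarrow> k \<in> X \<Longrightarrow> ip k (\<lambda>x. f x + h x) = ip k f + ip k h"
  using ip_lin_right[of f h k 1 "1"] by simp

lemma ip_scale_left: "f \<in> X \<Longrightarrow> k \<in> X \<Longrightarrow> ip (\<lambda>x. a * f x) k = a * ip f k"
  using ip_lin[of f f k a 0] by simp

lemma ip_scale_right: "f \<in> X \<Longrightarrow> k \<in> X \<Longrightarrow> ip k (\<lambda>x. a * f x) = a * ip k f"
  using ip_lin_right[of f f k a 0] by simp

lemma ip_zero_left: "k \<in> X \<Longrightarrow> ip (\<lambda>x. 0) k = 0"
  using ip_scale_left[OF zero_mem, of k 0] by simp

lemma nrm_nonneg: "f \<in> X \<Longrightarrow> 0 \<le> nrm f" by (simp add: nrm_def ip_nonneg)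

lemma nrm_sq: "f \<in> X \<Longrightarrow> (nrm f)\<^sup>2 = ip f f" by (simp add: nrm_def ip_nonneg)

lemma Cauchy_Schwarz: assumes f: "f \<in> X" and h: "h \<in> X" shows "\<bar>ip f h\<bar> \<le> nrm f * nrm h"
proof -
  define A B C where "A = ip f f" and "B = ip f h" and "C = ip h h"
  have nn: "0 \<le> A" "0 \<le> C" using f h by (auto simp: A_def C_def ip_nonneg)
  have q: "0 \<le> a * a * A + 2 * a * b * B + b * b * C" for a b
  proof -
    have "0 \<le> ip (\<lambda>x. a * f x + b * h x) (\<lambda>x. a * f x + b * h x)"
      using f h by (intro ip_nonneg lin_mem)
    also have "\<dots> = a * (a * A + b * B) + b * (a * B + b * C)"
      using f h lin_mem[OF f h, of a b] ip_sym[OF f h] by (simp add: ip_lin ip_lin_right A_def B_def C_def)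
    finally show ?thesis by (simp add: algebra_simps)
  qed
  have "B\<^sup>2 \<le> A * C"
  proof (cases "C = 0")
    case True
    have "B = 0"
    proof (rule ccontr)
      assume "B \<noteq> 0"
      \<comment> \<open>Semidefiniteness forces a separate treatment of vectors of norm 0. With C =
        0 this choice of coefficients makes the quadratic form equal to -1.\<close>
      then show False using q[of 1 "- (A + 1) / (2 * B)"] True nn by (simp add: field_simps)
    qed
    then show ?thesis using nn True by simp
  next
    case False
    \<comment> \<open>The coefficients a = C and b = - B give a multiple of the part of f orthogonal
      to h.\<close>
    have "0 \<le> C * (A * C - B\<^sup>2)" using q[of C "- B"] by (simp add: algebra_simps power2_eq_square)
    then show ?thesis using False nn by (simp add: zero_le_mult_iff)
  qed
  then have "sqrt (B\<^sup>2) \<le> sqrt (A * C)" by (rule real_sqrt_le_mono)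
  then show ?thesis by (simp add: nrm_def A_def B_def C_def real_sqrt_mult)
qed

lemma nrm_scale: "f \<in> X \<Longrightarrow> nrm (\<lambda>x. a * f x) = \<bar>a\<bar> * nrm f"
proof -
  assume f: "f \<in> X"
  have "ip (\<lambda>x. a * f x) (\<lambda>x. a * f x) = a\<^sup>2 * ip f f"
    using f scale_mem[OF f, of a] by (simp add: ip_scale_left ip_scale_right power2_eq_square)
  then show ?thesis by (simp add: nrm_def real_sqrt_mult)
qed

lemma nrm_add: assumes f: "f \<in> X" and h: "h \<in> X" shows "nrm (\<lambda>x. f x + h x) \<le> nrm f + nrm h"
proof (rule power2_le_imp_le)
  have "(nrm (\<lambda>x. f x + h x))\<^sup>2 = ip f f + 2 * ip f h + ip h h"
    using f h add_mem[OF f h] ip_sym[OF f h] by (simp add: nrm_sq ip_add_left ip_add_right)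
  also have "\<dots> \<le> (nrm f)\<^sup>2 + 2 * (nrm f * nrm h) + (nrm h)\<^sup>2"
    using Cauchy_Schwarz[OF f h] f h by (simp add: nrm_sq)
  also have "\<dots> = (nrm f + nrm h)\<^sup>2" by (simp add: power2_sum)
  finally show "(nrm (\<lambda>x. f x + h x))\<^sup>2 \<le> (nrm f + nrm h)\<^sup>2" .
  show "0 \<le> nrm f + nrm h" using f h by (simp add: nrm_nonneg)
qed

lemma nrm_diff_commute: "f \<in> X \<Longrightarrow> h \<in> X \<Longrightarrow> nrm (\<lambda>x. f x - h x) = nrm (\<lambda>x. h x - f x)"
  using nrm_scale[OF diff_mem, of f h "-1"] by simp

lemma nrm_triangle:
  "f \<in> X \<Longrightarrow> h \<in> X \<Longrightarrow> k \<in> X \<Longrightarrow> nrm (\<lambda>x. f x - k x) \<le> nrm (\<lambda>x. f x - h x) + nrm (\<lambda>x. h x - k x)"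
  using nrm_add[OF diff_mem[of f h] diff_mem[of h k]] by simp

lemma nrm_diff_le: "f \<in> X \<Longrightarrow> h \<in> X \<Longrightarrow> nrm f \<le> nrm h + nrm (\<lambda>x. f x - h x)"
  using nrm_add[of h "\<lambda>x. f x - h x"] diff_mem[of f h] by simp

lemma nrm_diff_abs: "f \<in> X \<Longrightarrow> h \<in> X \<Longrightarrow> \<bar>nrm f - nrm h\<bar> \<le> nrm (\<lambda>x. f x - h x)"
  using nrm_diff_le[of f h] nrm_diff_le[of h f] nrm_diff_commute[of f h] by simp

lemma sum_mem: "finite I \<Longrightarrow> (\<And>i. i \<in> I \<Longrightarrow> c i \<in> X) \<Longrightarrow> (\<lambda>x. \<Sum>i\<in>I. a i * c i x) \<in> X"
proof (induction I rule: finite_induct)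
  case (insert i I)
  then show ?case using lin_mem[of "c i" "\<lambda>x. \<Sum>i\<in>I. a i * c i x" "a i" 1] by simp
qed (simp add: zero_mem)

lemma ip_sum_left: "finite I \<Longrightarrow> (\<And>i. i \<in> I \<Longrightarrow> c i \<in> X) \<Longrightarrow> k \<in> X \<Longrightarrow>
   ip (\<lambda>x. \<Sum>i\<in>I. a i * c i x) k = (\<Sum>i\<in>I. a i * ip (c i) k)"
proof (induction I rule: finite_induct)
  case (insert i I)
  have e: "(\<lambda>x. \<Sum>j\<in>insert i I. a j * c j x) = (\<lambda>x. a i * c i x + 1 * (\<Sum>j\<in>I. a j * c j x))"
    using insert.hyps by simp
  have "ip (\<lambda>x. a i * c i x + 1 * (\<Sum>j\<in>I. a j * c j x)) k = a i * ip (c i) k + 1 * ip (\<lambda>x. \<Sum>j\<in>I. a j * c j x) k"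
    using insert.prems by (intro ip_lin sum_mem insert.hyps) blast+
  moreover have "ip (\<lambda>x. \<Sum>j\<in>I. a j * c j x) k = (\<Sum>j\<in>I. a j * ip (c j) k)"
    using insert.prems by (intro insert.IH) blast+
  moreover have "(\<Sum>j\<in>insert i I. a j * ip (c j) k) = a i * ip (c i) k + (\<Sum>j\<in>I. a j * ip (c j) k)"
    by (rule sum.insert[OF insert.hyps])
  ultimately show ?case unfolding e by linarith
next
  case empty
  then show ?case by (simp only: sum.empty ip_zero_left)
qed

end

text \<open>Symmetry, linearity and positivity are inherited, so \<open>H01\<close> inside
  \<open>H1\<close> only requires closure under linear combinations.\<close>

lemma semi_inner_subset:
  assumes "semi_inner X ip" "Y \<subseteq> X" "(\<lambda>x. 0) \<in> Y"
    "\<And>a b f h. f \<in> Y \<Longrightarrow> h \<in> Y \<Longrightarrow> (\<lambda>x. a * f x + b * h x) \<in> Y"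
  shows "semi_inner Y ip"
proof -
  interpret X: semi_inner X ip by fact
  show ?thesis
  proof (rule semi_inner.intro)
    show "(\<lambda>x. 0) \<in> Y" by fact
    show "(\<lambda>x. a * f x + b * h x) \<in> Y" if "f \<in> Y" "h \<in> Y" for a b f h
      using that by (rule assms(4))
    show "ip (\<lambda>x. a * f x + b * h x) k = a * ip f k + b * ip h k" if "f \<in> Y" "h \<in> Y" "k \<in> Y" for a b f h k
      using that[THEN subsetD[OF assms(2)]] by (rule X.ip_lin)
    show "ip f h = ip h f" if "f \<in> Y" "h \<in> Y" for f h
      using that[THEN subsetD[OF assms(2)]] by (rule X.ip_sym)
    show "0 \<le> ip f f" if "f \<in> Y" for f
      using that[THEN subsetD[OF assms(2)]] by (rule X.ip_nonneg)
  qed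
qed

locale bounded_open =
  fixes \<Omega> :: "'a::euclidean_space set"
  assumes open_dom: "open \<Omega>" and bounded_dom: "bounded \<Omega>"
begin

lemma sets_dom: "\<Omega> \<in> sets lebesgue" using open_dom by auto

lemma finite_measure_dom: "finite_measure (lebesgue_on \<Omega>)"
  using open_dom bounded_dom by (intro finite_measure_lebesgue_on lmeasurable_open)

end

section \<open>The space of square integrable functions\<close>

lemma L2_meas: "f \<in> L2 \<Omega> \<Longrightarrow> f \<in> borel_measurable (lebesgue_on \<Omega>)" by (simp add: L2_def)

lemma L2_inner_integrable:
  assumes "f \<in> L2 \<Omega>" "h \<in> L2 \<Omega>" shows "integrable (lebesgue_on \<Omega>) (\<lambda>x. f x \<bullet> h x)"
proof (rule Bochner_Integration.integrable_bound[of _ "\<lambda>x. (norm (f x))\<^sup>2 + (norm (h x))\<^sup>2"])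
  show "AE x in lebesgue_on \<Omega>. norm (f x \<bullet> h x) \<le> norm ((norm (f x))\<^sup>2 + (norm (h x))\<^sup>2)"
  proof (intro AE_I2)
    fix x
    have "norm (f x \<bullet> h x) \<le> norm (f x) * norm (h x)" by (simp add: Cauchy_Schwarz_ineq2)
    also have "\<dots> \<le> (norm (f x))\<^sup>2 + (norm (h x))\<^sup>2"
      using sum_squares_bound[of "norm (f x)" "norm (h x)"]
        mult_nonneg_nonneg[OF norm_ge_zero[of "f x"] norm_ge_zero[of "h x"]] by linarith
    finally show "norm (f x \<bullet> h x) \<le> norm ((norm (f x))\<^sup>2 + (norm (h x))\<^sup>2)" by simp
  qed
qed (use assms in \<open>auto simp: L2_def\<close>)

lemma L2_lin:
  assumes "f \<in> L2 \<Omega>" "h \<in> L2 \<Omega>" shows "(\<lambda>x. a *\<^sub>R f x + b *\<^sub>R h x) \<in> L2 \<Omega>"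
proof -
  have "(norm (a *\<^sub>R f x + b *\<^sub>R h x))\<^sup>2 = a\<^sup>2 * (norm (f x))\<^sup>2 + (2 * a * b) * (f x \<bullet> h x) + b\<^sup>2 * (norm (h x))\<^sup>2" for x
    unfolding power2_norm_eq_inner
    by (simp add: inner_add_left inner_add_right inner_commute power2_eq_square algebra_simps)
  moreover have "integrable (lebesgue_on \<Omega>) (\<lambda>x. a\<^sup>2 * (norm (f x))\<^sup>2 + (2 * a * b) * (f x \<bullet> h x) + b\<^sup>2 * (norm (h x))\<^sup>2)"
    using assms L2_inner_integrable[OF assms] by (auto simp: L2_def)
  ultimately show ?thesis using assms by (auto simp: L2_def)
qed

lemma L2_zero: "(\<lambda>x. 0) \<in> L2 \<Omega>" by (simp add: L2_def)

lemma L2_inner_lin: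
  assumes "f \<in> L2 \<Omega>" "h \<in> L2 \<Omega>" "k \<in> L2 \<Omega>"
  shows "L2_inner \<Omega> (\<lambda>x. a *\<^sub>R f x + b *\<^sub>R h x) k = a * L2_inner \<Omega> f k + b * L2_inner \<Omega> h k"
  using L2_inner_integrable[OF assms(1,3)] L2_inner_integrable[OF assms(2,3)]
  by (simp add: L2_inner_def inner_add_left)

lemma L2_inner_commute: "L2_inner \<Omega> f h = L2_inner \<Omega> h f"
  by (simp add: L2_inner_def inner_commute)

lemma L2_inner_nonneg: "0 \<le> L2_inner \<Omega> f f"
  by (simp add: L2_inner_def)

lemma L2_inner_cong_AE:
  assumes "AE x in lebesgue_on \<Omega>. f x = f' x" "AE x in lebesgue_on \<Omega>. h x = h' x"
    "f \<in> L2 \<Omega>" "f' \<in> L2 \<Omega>" "h \<in> L2 \<Omega>" "h' \<in> L2 \<Omega>"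
  shows "L2_inner \<Omega> f h = L2_inner \<Omega> f' h'"
  unfolding L2_inner_def using assms(1,2) L2_meas[OF assms(3)] L2_meas[OF assms(4)] L2_meas[OF assms(5)] L2_meas[OF assms(6)]
  by (intro integral_cong_AE) auto

interpretation L2i: semi_inner "L2 \<Omega>" "L2_inner \<Omega>" for \<Omega> :: "'a::euclidean_space set"
proof
  show "(\<lambda>x. a * f x + b * h x) \<in> L2 \<Omega>" if "f \<in> L2 \<Omega>" "h \<in> L2 \<Omega>" for a b and f h :: "'a \<Rightarrow> real"
    using L2_lin[OF that, of a b] by simp
  show "L2_inner \<Omega> (\<lambda>x. a * f x + b * h x) k = a * L2_inner \<Omega> f k + b * L2_inner \<Omega> h k"
    if "f \<in> L2 \<Omega>" "h \<in> L2 \<Omega>" "k \<in> L2 \<Omega>" for a b and f h k :: "'a \<Rightarrow> real"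
    using L2_inner_lin[OF that, of a b] by simp
qed (auto simp: L2_zero L2_inner_commute L2_inner_nonneg)

lemma L2i_nrm: "L2i.nrm \<Omega> = L2_norm \<Omega>"
  by (auto simp: fun_eq_iff L2i.nrm_def L2_norm_def)

lemma L2_norm_0_AE:
  assumes "f \<in> L2 \<Omega>" "L2_norm \<Omega> f = 0" shows "AE x in lebesgue_on \<Omega>. f x = 0"
proof -
  have "(LINT x|lebesgue_on \<Omega>. f x \<bullet> f x) = 0" using assms(2) by (simp add: L2_norm_def L2_inner_def)
  then have "AE x in lebesgue_on \<Omega>. f x \<bullet> f x = 0"
    using integral_nonneg_eq_0_iff_AE[OF L2_inner_integrable[OF assms(1) assms(1)]] by simp
  then show ?thesis by simp
qed

context bounded_open begin

lemma L2_integrable: assumes "f \<in> L2 \<Omega>" shows "integrable (lebesgue_on \<Omega>) f"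
proof -
  interpret finite_measure "lebesgue_on \<Omega>" by (rule finite_measure_dom)
  show ?thesis
  proof (rule Bochner_Integration.integrable_bound[of _ "\<lambda>x. 1 + (norm (f x))\<^sup>2"])
    show "AE x in lebesgue_on \<Omega>. norm (f x) \<le> norm (1 + (norm (f x))\<^sup>2)"
    proof (intro AE_I2)
      fix x
      have "2 * norm (f x) \<le> (norm (f x))\<^sup>2 + 1" using sum_squares_bound[of "norm (f x)" 1] by simp
      then have "norm (f x) \<le> 1 + (norm (f x))\<^sup>2" using norm_ge_zero[of "f x"] by linarith
      then show "norm (f x) \<le> norm (1 + (norm (f x))\<^sup>2)" by simp
    qed
  qed (use assms in \<open>auto simp: L2_def\<close>)
qed

end

text \<open>\<open>C_k\<close> yields some gradient with smooth components at each order; uniqueness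
  of gradients identifies it with the given D. Off the support \<phi> is locally zero, so
  differentiation does not enlarge the support.\<close>

lemma test_fun_gderiv:
  assumes t: "test_fun \<Omega> \<phi>" and D: "\<And>x. GDERIV \<phi> x :> D x" and b: "b \<in> Basis"
  shows "test_fun \<Omega> (\<lambda>x. D x \<bullet> b)"
proof -
  have DG: "D x = G x" if "\<And>x. GDERIV \<phi> x :> G x" for G x
  proof -
    have "(\<lambda>h. h \<bullet> D x) = (\<lambda>h. h \<bullet> G x)"
      using has_derivative_unique D[of x] that[of x] by (auto simp: gderiv_def)
    then have "(D x - G x) \<bullet> D x = (D x - G x) \<bullet> G x" by metis
    then show ?thesis using inner_diff_right[of "D x - G x" "D x" "G x"] by simp
  qed
  have "C_k k (\<lambda>x. D x \<bullet> b)" for k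
  proof -
    have "C_k (Suc k) \<phi>" using t unfolding test_fun_def by blast
    then obtain G where G: "\<And>x. GDERIV \<phi> x :> G x" "\<And>b. b \<in> Basis \<Longrightarrow> C_k k (\<lambda>x. G x \<bullet> b)"
      unfolding C_k.simps by blast
    then show ?thesis using DG[OF G(1)] b by simp
  qed
  moreover have sub: "{x. D x \<bullet> b \<noteq> 0} \<subseteq> closure {x. \<phi> x \<noteq> 0}"
  proof (rule ccontr)
    assume "\<not> ?thesis"
    then obtain x where x: "D x \<bullet> b \<noteq> 0" "x \<in> - closure {x. \<phi> x \<noteq> 0}" by blast
    have z: "0 = \<phi> y" if "y \<in> - closure {x. \<phi> x \<noteq> 0}" for y
      using subsetD[OF closure_subset, of y "{x. \<phi> x \<noteq> 0}"] that by auto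
    have "(\<phi> has_derivative (\<lambda>h. 0)) (at x)"
      by (rule has_derivative_transform_within_open[OF has_derivative_const[of 0] _ x(2) z]) auto
    then have "(\<lambda>h. h \<bullet> D x) = (\<lambda>h. 0)"
      using D[of x] has_derivative_unique[of \<phi> "\<lambda>h. h \<bullet> D x" x "\<lambda>h. 0"] by (simp add: gderiv_def)
    from fun_cong[OF this, of b] have "b \<bullet> D x = 0" .
    then show False using x by (simp add: inner_commute)
  qed
  moreover have "closure {x. D x \<bullet> b \<noteq> 0} \<subseteq> closure {x. \<phi> x \<noteq> 0}"
    by (rule closure_minimal[OF sub closed_closure])
  moreover have "compact (closure {x. D x \<bullet> b \<noteq> 0})"
    using t calculation(3) unfolding test_fun_def by (meson closed_closure compact_eq_bounded_closed bounded_subset)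
  ultimately show ?thesis using t unfolding test_fun_def by blast
qed

lemma test_fun_ex_gderiv:
  assumes "test_fun \<Omega> \<phi>" obtains D where "\<And>x. GDERIV \<phi> x :> D x"
proof -
  have "C_k (Suc 0) \<phi>" using assms unfolding test_fun_def by blast
  then show ?thesis using that unfolding C_k.simps by blast
qed

lemma test_fun_zero: "test_fun \<Omega> (\<lambda>x. 0)" by (simp add: test_fun_def C_k_const)

lemma test_fun_mult:
  assumes "test_fun \<Omega> \<phi>" "test_fun \<Omega> \<psi>" shows "test_fun \<Omega> (\<lambda>x. \<phi> x * \<psi> x)"
proof -
  have "closure {x. \<phi> x * \<psi> x \<noteq> 0} \<subseteq> closure {x. \<phi> x \<noteq> 0}" by (rule closure_mono) auto
  moreover from this have "compact (closure {x. \<phi> x * \<psi> x \<noteq> 0})"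
    using assms unfolding test_fun_def by (meson closed_closure compact_eq_bounded_closed bounded_subset)
  ultimately show ?thesis using assms unfolding test_fun_def by (auto intro: C_k_mult)
qed

lemma test_fun_lin:
  assumes "test_fun \<Omega> \<phi>" "test_fun \<Omega> \<psi>" shows "test_fun \<Omega> (\<lambda>x. a * \<phi> x + b * \<psi> x)"
proof -
  have "closure {x. a * \<phi> x + b * \<psi> x \<noteq> 0} \<subseteq> closure ({x. \<phi> x \<noteq> 0} \<union> {x. \<psi> x \<noteq> 0})"
    by (rule closure_mono) auto
  also have "\<dots> = closure {x. \<phi> x \<noteq> 0} \<union> closure {x. \<psi> x \<noteq> 0}" by (rule closure_Un)
  finally have sub: "closure {x. a * \<phi> x + b * \<psi> x \<noteq> 0} \<subseteq> closure {x. \<phi> x \<noteq> 0} \<union> closure {x. \<psi> x \<noteq> 0}" .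
  have "compact (closure {x. \<phi> x \<noteq> 0} \<union> closure {x. \<psi> x \<noteq> 0})"
    using assms unfolding test_fun_def by (intro compact_Un) auto
  then have "compact (closure {x. a * \<phi> x + b * \<psi> x \<noteq> 0})"
    using sub by (meson closed_closure compact_eq_bounded_closed bounded_subset)
  moreover have "C_k k (\<lambda>x. a * \<phi> x + b * \<psi> x)" for k
    using assms unfolding test_fun_def by (intro C_k_add C_k_mult C_k_const) auto
  ultimately show ?thesis using sub assms unfolding test_fun_def by blast
qed

lemma test_fun_zero_outside: "test_fun \<Omega> \<phi> \<Longrightarrow> x \<notin> \<Omega> \<Longrightarrow> \<phi> x = 0"
  unfolding test_fun_def using subsetD[OF closure_subset, of x "{x. \<phi> x \<noteq> 0}"] by auto

lemma gderiv_continuous: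
  assumes "test_fun \<Omega> \<phi>" "\<And>x. GDERIV \<phi> x :> D x"
  shows "continuous_on UNIV D"
proof -
  have "continuous_on UNIV (\<lambda>x. D x \<bullet> b)" if "b \<in> Basis" for b
    using test_fun_continuous[OF test_fun_gderiv[OF assms that]] .
  then show ?thesis by (rule continuous_on_componentwise[THEN iffD2, rule_format])
qed

text \<open>By translation invariance of Lebesgue measure every difference quotient has integral 0.
  The mean value theorem bounds the quotients uniformly and compact support supplies an integrable
  majorant, so the limit inherits the value 0.\<close>

lemma integral_test_fun_gderiv:
  assumes t: "test_fun UNIV \<phi>" and D: "\<And>x. GDERIV \<phi> x :> D x" and b: "b \<in> Basis"
  shows "integral\<^sup>L lborel (\<lambda>x. D x \<bullet> b) = 0"
proof -
  let ?K = "closure {x. \<phi> x \<noteq> 0}"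
  note tD = test_fun_gderiv[OF t D b]
  obtain B where B: "\<And>x. \<bar>D x \<bullet> b\<bar> \<le> B" "B \<ge> 0" using test_fun_bounded[OF tD] by blast
  obtain C where C: "\<And>x. \<bar>\<phi> x\<bar> \<le> C" "C \<ge> 0" using test_fun_bounded[OF t] by blast
  have "bounded ?K" using t by (auto simp: test_fun_def compact_imp_bounded)
  then obtain R where R: "\<And>x. \<phi> x \<noteq> 0 \<Longrightarrow> norm x \<le> R" using subsetD[OF closure_subset, of _ "{x. \<phi> x \<noteq> 0}"] by (auto simp: bounded_iff)
  define q where "q n x = (\<phi> (x + (1 / real (Suc n)) *\<^sub>R b) - \<phi> x) * real (Suc n)" for n x
  have cphi: "continuous_on UNIV \<phi>" using test_fun_continuous[OF t] .
  have mphi [measurable]: "\<phi> \<in> borel_measurable borel" using cphi by (rule borel_measurable_continuous_onI)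
  have int: "integrable lborel \<phi>"
  proof (rule Bochner_Integration.integrable_bound[of _ "\<lambda>x. C * indicator (cball 0 R) x"])
    show "integrable lborel (\<lambda>x::'a. C * indicator (cball 0 R) x)"
      by (intro integrable_mult_right integrable_real_indicator) (use emeasure_bounded_finite[OF bounded_cball] in auto)
    show "AE x in lborel. norm (\<phi> x) \<le> norm (C * indicator (cball 0 R) x)"
      using C R by (intro AE_I2) (auto simp: indicator_def)
  qed auto
  have q0: "integral\<^sup>L lborel (q n) = 0" for n
  proof -
    let ?c = "(1 / real (Suc n)) *\<^sub>R b"
    have sh: "integrable lborel (\<lambda>x. \<phi> (x + ?c))" "integral\<^sup>L lborel (\<lambda>x. \<phi> (x + ?c)) = integral\<^sup>L lborel \<phi>"
      using integrable_distr_eq[of "(+) ?c" lborel borel \<phi>] integral_distr[of "(+) ?c" lborel borel \<phi>] int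
      by (simp_all add: lborel_distr_plus add.commute)
    show ?thesis unfolding q_def using sh int by simp
  qed
  have lim: "(\<lambda>n. q n x) \<longlonglongrightarrow> D x \<bullet> b" for x
  proof -
    have "((\<lambda>t. \<phi> (x + t *\<^sub>R b)) has_derivative (\<lambda>t. (t *\<^sub>R b) \<bullet> D x)) (at 0)"
      using D[of x] unfolding gderiv_def
      by (intro has_derivative_compose[of "\<lambda>t. x + t *\<^sub>R b", where g=\<phi>]) (auto intro!: derivative_eq_intros)
    then have "((\<lambda>t. \<phi> (x + t *\<^sub>R b)) has_real_derivative (D x \<bullet> b)) (at 0)"
      by (simp add: has_field_derivative_def mult.commute[of _ "b \<bullet> _"] inner_commute mult_commute_abs)
    then have "((\<lambda>t. (\<phi> (x + t *\<^sub>R b) - \<phi> x) / t) \<longlongrightarrow> D x \<bullet> b) (at 0)"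
      by (simp add: has_field_derivative_iff)
    moreover have "filterlim (\<lambda>n. 1 / real (Suc n)) (at 0) sequentially"
      using LIMSEQ_inverse_real_of_nat by (auto simp: filterlim_at inverse_eq_divide)
    ultimately have "(\<lambda>n. (\<phi> (x + (1 / real (Suc n)) *\<^sub>R b) - \<phi> x) / (1 / real (Suc n))) \<longlonglongrightarrow> D x \<bullet> b"
      by (rule filterlim_compose)
    then show ?thesis by (simp add: q_def)
  qed
  have qB: "\<bar>q n x\<bar> \<le> B" for n x
  proof -
    have "\<exists>z. 0 < z \<and> z < 1 / real (Suc n) \<and> \<phi> (x + (1 / real (Suc n)) *\<^sub>R b) - \<phi> (x + 0 *\<^sub>R b) = (1 / real (Suc n) - 0) * (D (x + z *\<^sub>R b) \<bullet> b)"
    proof (rule MVT2)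
      fix s :: real
      have "((\<lambda>t. \<phi> (x + t *\<^sub>R b)) has_derivative (\<lambda>t. (t *\<^sub>R b) \<bullet> D (x + s *\<^sub>R b))) (at s)"
        using D unfolding gderiv_def
        by (intro has_derivative_compose[of "\<lambda>t. x + t *\<^sub>R b", where g=\<phi>]) (auto intro!: derivative_eq_intros)
      then show "((\<lambda>t. \<phi> (x + t *\<^sub>R b)) has_real_derivative (D (x + s *\<^sub>R b) \<bullet> b)) (at s)"
        by (simp add: has_field_derivative_def mult.commute[of _ "b \<bullet> _"] inner_commute mult_commute_abs)
    qed simp
    then obtain z where "q n x = D (x + z *\<^sub>R b) \<bullet> b" by (auto simp: q_def)
    then show ?thesis using B by simp
  qed
  \<comment> \<open>The step length is at most 1, so one ball with radius enlarged by 1 contains the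
    supports of all quotients.\<close>
  have q_out: "q n x = 0" if "norm x > R + 1" for n x
  proof -
    have "norm (x + (1 / real (Suc n)) *\<^sub>R b) \<ge> norm x - norm ((1 / real (Suc n)) *\<^sub>R b)"
      by (metis norm_diff_ineq)
    moreover have "norm ((1 / real (Suc n)) *\<^sub>R b) \<le> 1" using b by simp
    ultimately have "norm (x + (1 / real (Suc n)) *\<^sub>R b) > R" using that by linarith
    then have "\<phi> (x + (1 / real (Suc n)) *\<^sub>R b) = 0" using R by fastforce
    moreover have "\<phi> x = 0" using R that by fastforce
    ultimately show ?thesis by (simp add: q_def)
  qed
  have "(\<lambda>n. integral\<^sup>L lborel (q n)) \<longlonglongrightarrow> integral\<^sup>L lborel (\<lambda>x. D x \<bullet> b)"
  proof (rule integral_dominated_convergence[where w="\<lambda>x. B * indicator (cball 0 (R+1)) x"])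
    show "integrable lborel (\<lambda>x::'a. B * indicator (cball 0 (R+1)) x)"
      by (intro integrable_mult_right integrable_real_indicator) (use emeasure_bounded_finite[OF bounded_cball] in auto)
    show "AE x in lborel. norm (q n x) \<le> B * indicator (cball 0 (R+1)) x" for n
      using qB q_out by (intro AE_I2) (force simp: indicator_def)
    show "(\<lambda>x. D x \<bullet> b) \<in> borel_measurable lborel"
      using test_fun_continuous[OF tD] by (simp add: borel_measurable_continuous_onI)
    show "q n \<in> borel_measurable lborel" for n unfolding q_def by measurable
  qed (use lim in auto)
  then show ?thesis by (simp add: q0 LIMSEQ_const_iff)
qed

lemma integral_lebesgue_on_test_fun:
  assumes "test_fun \<Omega> \<phi>" "\<Omega> \<in> sets lebesgue"
  shows "(LINT x|lebesgue_on \<Omega>. \<phi> x) = integral\<^sup>L lborel \<phi>"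
proof -
  have "(LINT x|lebesgue_on \<Omega>. \<phi> x) = (LINT x|lebesgue. indicator \<Omega> x *\<^sub>R \<phi> x)"
    using assms by (simp add: integral_restrict_space)
  also have "\<dots> = (LINT x|lebesgue. \<phi> x)"
    using test_fun_zero_outside[OF assms(1)] by (intro Bochner_Integration.integral_cong) (auto simp: indicator_def)
  also have "\<dots> = integral\<^sup>L lborel \<phi>"
    using test_fun_continuous[OF assms(1)] by (intro integral_completion) (simp add: borel_measurable_continuous_onI)
  finally show ?thesis .
qed

section \<open>Weak gradients and the Sobolev spaces\<close>

context bounded_open begin

lemma bounded_continuous_L2:
  fixes f :: "'a \<Rightarrow> 'b::euclidean_space"
  assumes "continuous_on UNIV f" "\<And>x. norm (f x) \<le> B"
  shows "f \<in> L2 \<Omega>"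
proof -
  interpret finite_measure "lebesgue_on \<Omega>" by (rule finite_measure_dom)
  note [measurable] = continuous_measurable_lebesgue_on[OF assms(1) sets_dom]
  have "(norm (f x))\<^sup>2 \<le> B\<^sup>2" for x using assms(2)[of x] by (intro power_mono) auto
  then show ?thesis unfolding L2_def
    by (auto intro!: integrable_const_bound[where B="B\<^sup>2"])
qed

lemma test_fun_L2: "test_fun \<Omega> \<phi> \<Longrightarrow> \<phi> \<in> L2 \<Omega>"
  using test_fun_bounded[of \<Omega> \<phi>] bounded_continuous_L2[OF test_fun_continuous] by (metis real_norm_def)

lemma gderiv_bounded:
  assumes "test_fun \<Omega> \<phi>" "\<And>x. GDERIV \<phi> x :> D x"
  obtains B where "\<And>x. norm (D x) \<le> B"
proof -
  have "\<exists>B. \<forall>x. \<bar>D x \<bullet> b\<bar> \<le> B" if "b \<in> Basis" for b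
    using test_fun_bounded[OF test_fun_gderiv[OF assms that]] by metis
  then obtain B where B: "\<And>b x. b \<in> Basis \<Longrightarrow> \<bar>D x \<bullet> b\<bar> \<le> B b" by metis
  have "norm (D x) \<le> (\<Sum>b\<in>Basis. B b)" for x
    using norm_le_l1[of "D x"] sum_mono[of Basis "\<lambda>b. \<bar>D x \<bullet> b\<bar>" B] B by force
  then show ?thesis using that by blast
qed

lemma gderiv_L2:
  assumes "test_fun \<Omega> \<phi>" "\<And>x. GDERIV \<phi> x :> D x" shows "D \<in> L2 \<Omega>"
  using gderiv_bounded[OF assms] bounded_continuous_L2[OF gderiv_continuous[OF assms]] by metis

lemma L2_mult_test_integrable:
  fixes G :: "'a \<Rightarrow> 'b::euclidean_space"
  assumes "G \<in> L2 \<Omega>" "test_fun \<Omega> \<phi>"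
  shows "integrable (lebesgue_on \<Omega>) (\<lambda>x. \<phi> x *\<^sub>R G x)"
proof -
  obtain B where B: "\<And>x. \<bar>\<phi> x\<bar> \<le> B" "B \<ge> 0" using test_fun_bounded[OF assms(2)] by blast
  have [measurable]: "\<phi> \<in> borel_measurable (lebesgue_on \<Omega>)" "G \<in> borel_measurable (lebesgue_on \<Omega>)"
    using continuous_measurable_lebesgue_on[OF test_fun_continuous[OF assms(2)] sets_dom] L2_meas[OF assms(1)] by auto
  show ?thesis
  proof (rule Bochner_Integration.integrable_bound[of _ "\<lambda>x. B *\<^sub>R G x"])
    show "AE x in lebesgue_on \<Omega>. norm (\<phi> x *\<^sub>R G x) \<le> norm (B *\<^sub>R G x)"
      using B by (intro AE_I2) (auto intro: mult_right_mono)
  qed (use L2_integrable[OF assms(1)] in auto)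
qed

lemma L2_mult_gderiv_integrable:
  assumes "u \<in> L2 \<Omega>" "test_fun \<Omega> \<phi>" "\<And>x. GDERIV \<phi> x :> D x"
  shows "integrable (lebesgue_on \<Omega>) (\<lambda>x. u x *\<^sub>R D x)"
proof -
  obtain B where B: "\<And>x. norm (D x) \<le> B" using gderiv_bounded[OF assms(2,3)] by blast
  then have "B \<ge> 0" using norm_ge_zero order_trans by blast
  have [measurable]: "D \<in> borel_measurable (lebesgue_on \<Omega>)" "u \<in> borel_measurable (lebesgue_on \<Omega>)"
    using L2_meas[OF gderiv_L2[OF assms(2,3)]] L2_meas[OF assms(1)] by auto
  show ?thesis
  proof (rule Bochner_Integration.integrable_bound[of _ "\<lambda>x. B *\<^sub>R u x"])
    show "AE x in lebesgue_on \<Omega>. norm (u x *\<^sub>R D x) \<le> norm (B *\<^sub>R u x)"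
      using B \<open>B \<ge> 0\<close> by (intro AE_I2) (auto simp: abs_mult mult.commute[of B] intro: mult_left_mono)
  qed (use L2_integrable[OF assms(1)] in auto)
qed

text \<open>Integration by parts is the vanishing of the integral of the gradient of \<phi> \<psi>,
  read off in each coordinate.\<close>

lemma weak_grad_test_fun:
  assumes t: "test_fun \<Omega> \<phi>" and D: "\<And>x. GDERIV \<phi> x :> D x"
  shows "weak_grad \<Omega> \<phi> D"
  unfolding weak_grad_def
proof (intro allI impI, elim conjE)
  fix \<psi> E assume p: "test_fun \<Omega> \<psi>" and E: "\<forall>x. GDERIV \<psi> x :> E x"
  have i: "integrable (lebesgue_on \<Omega>) (\<lambda>x. \<phi> x *\<^sub>R E x)" "integrable (lebesgue_on \<Omega>) (\<lambda>x. \<psi> x *\<^sub>R D x)"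
    using t p D E by (auto intro: L2_mult_gderiv_integrable test_fun_L2)
  have "(LINT x|lebesgue_on \<Omega>. \<phi> x *\<^sub>R E x + \<psi> x *\<^sub>R D x) = 0"
  proof (rule euclidean_eqI)
    fix b :: 'a assume b: "b \<in> Basis"
    have pt: "test_fun \<Omega> (\<lambda>x. \<phi> x * \<psi> x)" by (rule test_fun_mult[OF t p])
    then have pt': "test_fun UNIV (\<lambda>x. \<phi> x * \<psi> x)" by (auto simp: test_fun_def)
    have G: "GDERIV (\<lambda>x. \<phi> x * \<psi> x) x :> \<phi> x *\<^sub>R E x + \<psi> x *\<^sub>R D x" for x
      using D E by (intro GDERIV_mult) auto
    have "(LINT x|lebesgue_on \<Omega>. \<phi> x *\<^sub>R E x + \<psi> x *\<^sub>R D x) \<bullet> b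
        = (LINT x|lebesgue_on \<Omega>. (\<phi> x *\<^sub>R E x + \<psi> x *\<^sub>R D x) \<bullet> b)"
      using i by (subst integral_inner_left) auto
    also have "\<dots> = (LINT x|lborel. (\<phi> x *\<^sub>R E x + \<psi> x *\<^sub>R D x) \<bullet> b)"
      by (rule integral_lebesgue_on_test_fun[OF test_fun_gderiv[OF pt G b] sets_dom])
    also have "\<dots> = 0" by (rule integral_test_fun_gderiv[OF pt' G b])
    finally show "(LINT x|lebesgue_on \<Omega>. \<phi> x *\<^sub>R E x + \<psi> x *\<^sub>R D x) \<bullet> b = 0 \<bullet> b" by simp
  qed
  then show "(LINT x|lebesgue_on \<Omega>. \<phi> x *\<^sub>R E x) = - (LINT x|lebesgue_on \<Omega>. \<psi> x *\<^sub>R D x)"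
    using i by (simp add: eq_neg_iff_add_eq_0)
qed

lemma test_fun_H1: assumes "test_fun \<Omega> \<phi>" shows "\<phi> \<in> H1 \<Omega>"
proof -
  obtain D where D: "\<And>x. GDERIV \<phi> x :> D x" using test_fun_ex_gderiv[OF assms] by blast
  then show ?thesis unfolding H1_def using test_fun_L2[OF assms] gderiv_L2[OF assms D] weak_grad_test_fun[OF assms D] by blast
qed

text \<open>The fundamental lemma is applied to each coordinate of the difference. Through this
  result the choice made in \<open>grad\<close> has no effect beyond null sets.\<close>

lemma weak_grad_unique:
  assumes u: "weak_grad \<Omega> u G" "weak_grad \<Omega> u G'" and G: "G \<in> L2 \<Omega>" "G' \<in> L2 \<Omega>"
  shows "AE x in lebesgue_on \<Omega>. G x = G' x"
proof -
  have "AE x in lebesgue_on \<Omega>. (G x - G' x) \<bullet> b = 0" if b: "b \<in> Basis" for b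
  proof (rule fundamental_lemma[OF open_dom])
    show "integrable (lebesgue_on \<Omega>) (\<lambda>x. (G x - G' x) \<bullet> b)"
      using L2_integrable[OF G(1)] L2_integrable[OF G(2)] by auto
    fix \<phi> assume t: "test_fun \<Omega> \<phi>"
    obtain D where D: "\<And>x. GDERIV \<phi> x :> D x" using test_fun_ex_gderiv[OF t] by blast
    have e: "(LINT x|lebesgue_on \<Omega>. \<phi> x *\<^sub>R G x) = (LINT x|lebesgue_on \<Omega>. \<phi> x *\<^sub>R G' x)"
    proof -
      have "test_fun \<Omega> \<phi> \<and> (\<forall>x. GDERIV \<phi> x :> D x)" using t D by simp
      from u(1)[unfolded weak_grad_def, rule_format, OF this] u(2)[unfolded weak_grad_def, rule_format, OF this]
      show ?thesis by simp
    qed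
    note i = L2_mult_test_integrable[OF G(1) t] L2_mult_test_integrable[OF G(2) t]
    have "(LINT x|lebesgue_on \<Omega>. \<phi> x * ((G x - G' x) \<bullet> b)) = (LINT x|lebesgue_on \<Omega>. (\<phi> x *\<^sub>R G x - \<phi> x *\<^sub>R G' x) \<bullet> b)"
      by (intro Bochner_Integration.integral_cong) (auto simp: inner_diff_left algebra_simps)
    also have "\<dots> = (LINT x|lebesgue_on \<Omega>. \<phi> x *\<^sub>R G x - \<phi> x *\<^sub>R G' x) \<bullet> b"
      using i by (subst integral_inner_left) auto
    also have "\<dots> = 0" using e i by simp
    finally show "(LINT x|lebesgue_on \<Omega>. \<phi> x * ((G x - G' x) \<bullet> b)) = 0" .
  qed
  then have "AE x in lebesgue_on \<Omega>. \<forall>b\<in>Basis. (G x - G' x) \<bullet> b = 0"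
    by (intro AE_finite_allI) auto
  then show ?thesis by eventually_elim (rule euclidean_eqI, simp add: inner_diff_left)
qed

lemma H1_L2: "u \<in> H1 \<Omega> \<Longrightarrow> u \<in> L2 \<Omega>" by (simp add: H1_def)

lemma grad_spec: assumes "u \<in> H1 \<Omega>" shows grad_L2: "grad \<Omega> u \<in> L2 \<Omega>" and weak_grad_grad: "weak_grad \<Omega> u (grad \<Omega> u)"
proof -
  have "\<exists>G. G \<in> L2 \<Omega> \<and> weak_grad \<Omega> u G" using assms by (auto simp: H1_def)
  from someI_ex[OF this] show "grad \<Omega> u \<in> L2 \<Omega>" "weak_grad \<Omega> u (grad \<Omega> u)" by (auto simp: grad_def)
qed

lemma grad_eqI: "G \<in> L2 \<Omega> \<Longrightarrow> weak_grad \<Omega> u G \<Longrightarrow> u \<in> L2 \<Omega> \<Longrightarrow> AE x in lebesgue_on \<Omega>. grad \<Omega> u x = G x"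
  using grad_spec[of u] by (intro weak_grad_unique[of u]) (auto simp: H1_def)

lemma weak_grad_lin:
  assumes "weak_grad \<Omega> u G" "weak_grad \<Omega> v H" "u \<in> L2 \<Omega>" "v \<in> L2 \<Omega>" "G \<in> L2 \<Omega>" "H \<in> L2 \<Omega>"
  shows "weak_grad \<Omega> (\<lambda>x. a * u x + b * v x) (\<lambda>x. a *\<^sub>R G x + b *\<^sub>R H x)"
  unfolding weak_grad_def
proof (intro allI impI, elim conjE)
  fix \<phi> D assume t: "test_fun \<Omega> \<phi>" and D: "\<forall>x. GDERIV \<phi> x :> D x"
  then have D': "\<And>x. GDERIV \<phi> x :> D x" by blast
  note i = L2_mult_gderiv_integrable[OF assms(3) t D'] L2_mult_gderiv_integrable[OF assms(4) t D']
    L2_mult_test_integrable[OF assms(5) t] L2_mult_test_integrable[OF assms(6) t]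
  have "(LINT x|lebesgue_on \<Omega>. (a * u x + b * v x) *\<^sub>R D x) = (LINT x|lebesgue_on \<Omega>. a *\<^sub>R (u x *\<^sub>R D x) + b *\<^sub>R (v x *\<^sub>R D x))"
    by (simp add: scaleR_add_left)
  also have "\<dots> = a *\<^sub>R (LINT x|lebesgue_on \<Omega>. u x *\<^sub>R D x) + b *\<^sub>R (LINT x|lebesgue_on \<Omega>. v x *\<^sub>R D x)"
    using i by (subst Bochner_Integration.integral_add) (auto simp del: scaleR_scaleR)
  also have "\<dots> = - (a *\<^sub>R (LINT x|lebesgue_on \<Omega>. \<phi> x *\<^sub>R G x) + b *\<^sub>R (LINT x|lebesgue_on \<Omega>. \<phi> x *\<^sub>R H x))"
    using assms(1,2) t D by (simp add: weak_grad_def)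
  also have "a *\<^sub>R (LINT x|lebesgue_on \<Omega>. \<phi> x *\<^sub>R G x) + b *\<^sub>R (LINT x|lebesgue_on \<Omega>. \<phi> x *\<^sub>R H x)
      = (LINT x|lebesgue_on \<Omega>. a *\<^sub>R (\<phi> x *\<^sub>R G x) + b *\<^sub>R (\<phi> x *\<^sub>R H x))"
    using i by (subst Bochner_Integration.integral_add) (auto simp del: scaleR_scaleR)
  also have "\<dots> = (LINT x|lebesgue_on \<Omega>. \<phi> x *\<^sub>R (a *\<^sub>R G x + b *\<^sub>R H x))"
    by (simp add: scaleR_add_right mult.commute)
  finally show "(LINT x|lebesgue_on \<Omega>. (a * u x + b * v x) *\<^sub>R D x) = - (LINT x|lebesgue_on \<Omega>. \<phi> x *\<^sub>R (a *\<^sub>R G x + b *\<^sub>R H x))" .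
qed

text \<open>Because \<open>grad\<close> is a choice, additivity and homogeneity of the gradient can
  only be had almost everywhere, from uniqueness.\<close>

lemma
  assumes u: "u \<in> H1 \<Omega>" and v: "v \<in> H1 \<Omega>"
  shows H1_lin_mem: "(\<lambda>x. a * u x + b * v x) \<in> H1 \<Omega>"
    and grad_lin: "AE x in lebesgue_on \<Omega>. grad \<Omega> (\<lambda>x. a * u x + b * v x) x = a *\<^sub>R grad \<Omega> u x + b *\<^sub>R grad \<Omega> v x"
proof -
  have 1: "weak_grad \<Omega> (\<lambda>x. a * u x + b * v x) (\<lambda>x. a *\<^sub>R grad \<Omega> u x + b *\<^sub>R grad \<Omega> v x)"
    using u v by (intro weak_grad_lin weak_grad_grad grad_L2 H1_L2)
  have 2: "(\<lambda>x. a *\<^sub>R grad \<Omega> u x + b *\<^sub>R grad \<Omega> v x) \<in> L2 \<Omega>" using u v by (intro L2_lin grad_L2)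
  have 3: "(\<lambda>x. a * u x + b * v x) \<in> L2 \<Omega>" using L2i.lin_mem[OF H1_L2[OF u] H1_L2[OF v]] .
  show "(\<lambda>x. a * u x + b * v x) \<in> H1 \<Omega>" using 1 2 3 by (auto simp: H1_def)
  show "AE x in lebesgue_on \<Omega>. grad \<Omega> (\<lambda>x. a * u x + b * v x) x = a *\<^sub>R grad \<Omega> u x + b *\<^sub>R grad \<Omega> v x"
    by (rule grad_eqI[OF 2 1 3])
qed

definition grad_inner :: "('a \<Rightarrow> real) \<Rightarrow> ('a \<Rightarrow> real) \<Rightarrow> real" where
  "grad_inner u v = L2_inner \<Omega> (grad \<Omega> u) (grad \<Omega> v)"

definition H1_inner :: "('a \<Rightarrow> real) \<Rightarrow> ('a \<Rightarrow> real) \<Rightarrow> real" where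
  "H1_inner u v = L2_inner \<Omega> u v + grad_inner u v"

lemma H1_zero: "(\<lambda>x. 0) \<in> H1 \<Omega>"
  using test_fun_H1[OF test_fun_zero] .

lemma grad_inner_lin:
  assumes "f \<in> H1 \<Omega>" "h \<in> H1 \<Omega>" "k \<in> H1 \<Omega>"
  shows "grad_inner (\<lambda>x. a * f x + b * h x) k = a * grad_inner f k + b * grad_inner h k"
proof -
  have "grad_inner (\<lambda>x. a * f x + b * h x) k = L2_inner \<Omega> (\<lambda>x. a *\<^sub>R grad \<Omega> f x + b *\<^sub>R grad \<Omega> h x) (grad \<Omega> k)"
    unfolding grad_inner_def using assms
    by (intro L2_inner_cong_AE grad_lin grad_L2 L2_lin H1_lin_mem) auto
  then show ?thesis using assms by (simp add: L2_inner_lin grad_L2 grad_inner_def)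
qed

sublocale H1g: semi_inner "H1 \<Omega>" grad_inner
proof unfold_locales
  fix f h show "grad_inner f h = grad_inner h f" unfolding grad_inner_def by (rule L2_inner_commute)
next
  fix f show "0 \<le> grad_inner f f" unfolding grad_inner_def by (rule L2_inner_nonneg)
qed (simp_all add: H1_zero H1_lin_mem grad_inner_lin)

sublocale H1s: semi_inner "H1 \<Omega>" H1_inner
proof unfold_locales
  fix a b and f h k :: "'a \<Rightarrow> real" assume "f \<in> H1 \<Omega>" "h \<in> H1 \<Omega>" "k \<in> H1 \<Omega>"
  note fhk = this
  have "L2_inner \<Omega> (\<lambda>x. a * f x + b * h x) k = a * L2_inner \<Omega> f k + b * L2_inner \<Omega> h k"
    by (rule L2i.ip_lin[OF fhk[THEN H1_L2]])
  moreover have "grad_inner (\<lambda>x. a * f x + b * h x) k = a * grad_inner f k + b * grad_inner h k"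
    by (rule grad_inner_lin[OF fhk])
  ultimately show "H1_inner (\<lambda>x. a * f x + b * h x) k = a * H1_inner f k + b * H1_inner h k"
    unfolding H1_inner_def by (simp only: distrib_left)
next
  fix f h assume "f \<in> H1 \<Omega>" "h \<in> H1 \<Omega>"
  then show "H1_inner f h = H1_inner h f"
    unfolding H1_inner_def using H1g.ip_sym[of f h] L2_inner_commute[of \<Omega> f h] by linarith
next
  fix f assume "f \<in> H1 \<Omega>"
  then show "0 \<le> H1_inner f f" unfolding H1_inner_def by (simp add: H1g.ip_nonneg L2_inner_nonneg)
qed (simp_all add: H1_zero H1_lin_mem)

lemma H1s_nrm: "H1s.nrm u = H1_norm \<Omega> u"
proof -
  have "(L2_norm \<Omega> u)\<^sup>2 + (L2_norm \<Omega> (grad \<Omega> u))\<^sup>2 = H1_inner u u"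
    unfolding L2_norm_def H1_inner_def grad_inner_def
    by (intro arg_cong2[where f="(+)"] real_sqrt_pow2 L2_inner_nonneg)
  then show ?thesis unfolding H1s.nrm_def H1_norm_def by (simp only:)
qed

lemma L2_norm_le_H1_norm: assumes "u \<in> H1 \<Omega>" shows "L2_norm \<Omega> u \<le> H1_norm \<Omega> u"
proof -
  have "sqrt (L2_inner \<Omega> u u) \<le> sqrt (H1_inner u u)"
    unfolding H1_inner_def by (intro real_sqrt_le_mono) (use H1g.ip_nonneg[OF assms] in linarith)
  then show ?thesis using H1s_nrm[of u] H1s.nrm_def[of u] L2_norm_def[of \<Omega> u] by argo
qed

lemma grad_nrm_le_H1_norm: assumes "u \<in> H1 \<Omega>" shows "H1g.nrm u \<le> H1_norm \<Omega> u"
proof -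
  have "sqrt (grad_inner u u) \<le> sqrt (H1_inner u u)"
    unfolding H1_inner_def by (intro real_sqrt_le_mono) (use L2_inner_nonneg[of \<Omega> u] in linarith)
  then show ?thesis using H1s_nrm[of u] H1s.nrm_def[of u] H1g.nrm_def[of u] by argo
qed

lemma H01_H1: "u \<in> H01 \<Omega> \<Longrightarrow> u \<in> H1 \<Omega>" by (simp add: H01_def)

lemma H01_lin_mem:
  assumes "u \<in> H01 \<Omega>" "v \<in> H01 \<Omega>" shows "(\<lambda>x. a * u x + b * v x) \<in> H01 \<Omega>"
proof -
  have "\<exists>p. (\<forall>k::nat. test_fun \<Omega> (p k)) \<and> (\<lambda>k. H1_norm \<Omega> (\<lambda>x. p k x - u x)) \<longlonglongrightarrow> 0"
    using assms(1) by (simp add: H01_def)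
  then obtain p where p: "\<And>k. test_fun \<Omega> (p k)" "(\<lambda>k. H1_norm \<Omega> (\<lambda>x. p k x - u x)) \<longlonglongrightarrow> 0"
    by (elim exE conjE) (rule that, auto)
  have "\<exists>q. (\<forall>k::nat. test_fun \<Omega> (q k)) \<and> (\<lambda>k. H1_norm \<Omega> (\<lambda>x. q k x - v x)) \<longlonglongrightarrow> 0"
    using assms(2) by (simp add: H01_def)
  then obtain q where q: "\<And>k. test_fun \<Omega> (q k)" "(\<lambda>k. H1_norm \<Omega> (\<lambda>x. q k x - v x)) \<longlonglongrightarrow> 0"
    by (elim exE conjE) (rule that, auto)
  note uv = assms[THEN H01_H1] and pq = test_fun_H1[OF p(1)] test_fun_H1[OF q(1)]
  let ?r = "\<lambda>k x. a * p k x + b * q k x"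
  have nn: "0 \<le> H1_norm \<Omega> f" for f unfolding H1_norm_def by (rule real_sqrt_ge_zero) auto
  have le: "H1_norm \<Omega> (\<lambda>x. ?r k x - (a * u x + b * v x)) \<le> \<bar>a\<bar> * H1_norm \<Omega> (\<lambda>x. p k x - u x) + \<bar>b\<bar> * H1_norm \<Omega> (\<lambda>x. q k x - v x)" for k
  proof -
    have "(\<lambda>x. ?r k x - (a * u x + b * v x)) = (\<lambda>x. a * (p k x - u x) + b * (q k x - v x))" by (auto simp: algebra_simps)
    then show ?thesis
      using H1s.nrm_add[OF H1s.scale_mem[OF H1s.diff_mem[OF pq(1)[of k] uv(1)], of a] H1s.scale_mem[OF H1s.diff_mem[OF pq(2)[of k] uv(2)], of b]]
        H1s.nrm_scale[OF H1s.diff_mem[OF pq(1)[of k] uv(1)], of a] H1s.nrm_scale[OF H1s.diff_mem[OF pq(2)[of k] uv(2)], of b]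
      by (simp add: H1s_nrm)
  qed
  have "(\<lambda>k. \<bar>a\<bar> * H1_norm \<Omega> (\<lambda>x. p k x - u x) + \<bar>b\<bar> * H1_norm \<Omega> (\<lambda>x. q k x - v x)) \<longlonglongrightarrow> \<bar>a\<bar> * 0 + \<bar>b\<bar> * 0"
    by (intro tendsto_intros p q)
  then have "(\<lambda>k. H1_norm \<Omega> (\<lambda>x. ?r k x - (a * u x + b * v x))) \<longlonglongrightarrow> 0"
    using tendsto_sandwich[of "\<lambda>_. 0" "\<lambda>k. H1_norm \<Omega> (\<lambda>x. ?r k x - (a * u x + b * v x))" sequentially
        "\<lambda>k. \<bar>a\<bar> * H1_norm \<Omega> (\<lambda>x. p k x - u x) + \<bar>b\<bar> * H1_norm \<Omega> (\<lambda>x. q k x - v x)" 0]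
    by (simp add: le nn)
  moreover have "\<forall>k. test_fun \<Omega> (?r k)" using p(1) q(1) by (blast intro: test_fun_lin)
  ultimately have "\<exists>r. (\<forall>k. test_fun \<Omega> (r k)) \<and> (\<lambda>k. H1_norm \<Omega> (\<lambda>x. r k x - (a * u x + b * v x))) \<longlonglongrightarrow> 0"
    by (intro exI[of _ ?r] conjI)
  then show ?thesis unfolding H01_def using H1_lin_mem[OF uv] by simp
qed

lemma H01_zero: "(\<lambda>x. 0) \<in> H01 \<Omega>"
proof -
  have "H1_norm \<Omega> (\<lambda>x. 0) = 0" using H1s.nrm_scale[OF H1_zero, of 0] by (simp add: H1s_nrm)
  then have "\<exists>r. (\<forall>k::nat. test_fun \<Omega> (r k)) \<and> (\<lambda>k. H1_norm \<Omega> (\<lambda>x. r k x - 0)) \<longlonglongrightarrow> 0"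
    using test_fun_zero by (intro exI[of _ "\<lambda>k x. 0"]) simp
  then show ?thesis using H1_zero by (simp add: H01_def)
qed

sublocale H01g: semi_inner "H01 \<Omega>" grad_inner
  by (rule semi_inner_subset[OF H1g.semi_inner_axioms]) (auto simp: H01_zero H01_lin_mem H01_H1)

sublocale H01s: semi_inner "H01 \<Omega>" H1_inner
  by (rule semi_inner_subset[OF H1s.semi_inner_axioms]) (auto simp: H01_zero H01_lin_mem H01_H1)

lemma H01s_nrm: "H01s.nrm u = H1_norm \<Omega> u"
  by (simp add: H01s.nrm_def H1s_nrm[symmetric] H1s.nrm_def)

lemma H01_L2: "u \<in> H01 \<Omega> \<Longrightarrow> u \<in> L2 \<Omega>" using H01_H1 H1_L2 by blast

end

section \<open>Simple approximations and Bochner integrals\<close>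

lemma complete_measure_lebesgue_on:
  assumes S: "S \<in> sets lebesgue" shows "complete_measure (lebesgue_on S)"
proof
  fix A B assume AB: "B \<subseteq> A" "A \<in> null_sets (lebesgue_on S)"
  have A: "A \<subseteq> S \<and> A \<in> null_sets lebesgue" using AB(2) null_sets_restrict_space[OF S, of A] by blast
  then have "B \<in> null_sets lebesgue" using completion.complete2[OF AB(1)] by blast
  then have "B \<in> null_sets (lebesgue_on S)" using A AB(1) null_sets_restrict_space[OF S, of B] by blast
  then show "B \<in> sets (lebesgue_on S)" by auto
qed

text \<open>Completeness lets measurability pass to functions known only up to null sets, such as
  pairings with \<open>grad\<close> or \<open>time_deriv\<close>, which are arbitrary
  choices.\<close>

lemma (in complete_measure) borel_measurable_AE_cong:
  assumes f: "f \<in> borel_measurable M" and eq: "AE x in M. f x = g x"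
  shows "g \<in> borel_measurable M"
proof (rule measurableI)
  fix A :: "'b set" assume A: "A \<in> sets borel"
  show "g -` A \<inter> space M \<in> sets M"
  proof (rule in_sets_AE[where A="f -` A \<inter> space M"])
    show "AE x in M. (x \<in> f -` A \<inter> space M) = (x \<in> g -` A \<inter> space M)" using eq by eventually_elim auto
    show "f -` A \<inter> space M \<in> sets M" using f A by (rule measurable_sets)
  qed auto
qed auto

text \<open>The values of s are functions, a type without a suitable \<sigma>-algebra. As there are
  finitely many of them, any real functional f whatever may be composed with s and
  integrated.\<close>

lemma simple_function_sum_vimage:
  fixes f :: "'b \<Rightarrow> real"
  assumes M: "finite_measure M" and s: "simple_function M s"
  shows "integrable M (\<lambda>t. f (s t))"
    and "(LINT t|M. f (s t)) = (\<Sum>c\<in>s ` space M. measure M {t \<in> space M. s t = c} * f c)"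
proof -
  interpret finite_measure M by fact
  have fin: "finite (s ` space M)" using s by (rule simple_functionD)
  have sets: "{t \<in> space M. s t = c} \<in> sets M" for c
    using simple_functionD(2)[OF s, of "{c}"] by (simp add: vimage_def Int_def conj_commute)
  have eq: "f (s t) = (\<Sum>c\<in>s ` space M. f c * indicator {t \<in> space M. s t = c} t)" if "t \<in> space M" for t
  proof -
    have "(\<Sum>c\<in>s ` space M. f c * indicator {t \<in> space M. s t = c} t) = (\<Sum>c\<in>s ` space M. if c = s t then f c else 0)"
      using that by (intro sum.cong) (auto simp: indicator_def)
    also have "\<dots> = f (s t)" using fin that by simp
    finally show ?thesis by simp
  qed
  have i: "integrable M (\<lambda>t. f c * indicator {t \<in> space M. s t = c} t)" for c
    using sets by (intro integrable_mult_right integrable_real_indicator) (auto simp: emeasure_eq_measure)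
  have hb: "has_bochner_integral M (\<lambda>t. \<Sum>c\<in>s ` space M. f c * indicator {t \<in> space M. s t = c} t)
      (\<Sum>c\<in>s ` space M. measure M {t \<in> space M. s t = c} * f c)"
  proof (intro has_bochner_integral_sum)
    fix c
    have "(LINT t|M. f c * indicator {t \<in> space M. s t = c} t) = f c * measure M {t \<in> space M. s t = c}"
      using sets.Int_space_eq2[OF sets[of c]] by simp
    then show "has_bochner_integral M (\<lambda>t. f c * indicator {t \<in> space M. s t = c} t) (measure M {t \<in> space M. s t = c} * f c)"
      using has_bochner_integral_integrable[OF i[of c]] by (simp only: mult.commute)
  qed
  then have "has_bochner_integral M (\<lambda>t. f (s t)) (\<Sum>c\<in>s ` space M. measure M {t \<in> space M. s t = c} * f c)"
    using eq by (subst has_bochner_integral_cong[OF refl eq refl]) auto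
  then show "integrable M (\<lambda>t. f (s t))"
    and "(LINT t|M. f (s t)) = (\<Sum>c\<in>s ` space M. measure M {t \<in> space M. s t = c} * f c)"
    by (auto simp: has_bochner_integral_iff)
qed

section \<open>Functions of time with values in a semi-inner product space\<close>

context semi_inner begin

lemma nrm_zero: "nrm (\<lambda>x. 0) = 0"
  unfolding nrm_def ip_zero_left[OF zero_mem] by simp

text \<open>All conditions hold everywhere on the measure space, so that inner products of such functions
  are measurable on product spaces, which are not complete.\<close>

definition regular :: "'t measure \<Rightarrow> ('t \<Rightarrow> 'c \<Rightarrow> real) \<Rightarrow> (nat \<Rightarrow> 't \<Rightarrow> 'c \<Rightarrow> real) \<Rightarrow> ('t \<Rightarrow> real) \<Rightarrow> bool" where
  "regular M u s B \<longleftrightarrow> (\<forall>t. u t \<in> X) \<and> (\<forall>k t. s k t \<in> X) \<and> (\<forall>k. simple_function M (s k)) \<and>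
     (\<forall>t\<in>space M. nrm (u t) \<le> B t) \<and> (\<forall>k. \<forall>t\<in>space M. nrm (s k t) \<le> B t) \<and>
     (\<forall>t\<in>space M. (\<lambda>k. nrm (\<lambda>x. s k t x - u t x)) \<longlonglongrightarrow> 0) \<and>
     B \<in> borel_measurable M \<and> integrable M (\<lambda>t. (B t)\<^sup>2)"

lemma regularD:
  assumes "regular M u s B"
  shows "u t \<in> X" "s k t \<in> X" "simple_function M (s k)" "t \<in> space M \<Longrightarrow> nrm (u t) \<le> B t"
    "t \<in> space M \<Longrightarrow> nrm (s k t) \<le> B t" "t \<in> space M \<Longrightarrow> (\<lambda>k. nrm (\<lambda>x. s k t x - u t x)) \<longlonglongrightarrow> 0"
    "B \<in> borel_measurable M" "integrable M (\<lambda>t. (B t)\<^sup>2)"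
  using assms unfolding regular_def by auto

lemma regular_B_nonneg: "regular M u s B \<Longrightarrow> t \<in> space M \<Longrightarrow> 0 \<le> B t"
  by (rule order_trans[OF nrm_nonneg regularD(4)]) (rule regularD(1))

lemma regular_B_integrable:
  assumes "finite_measure M" "regular M u s B" shows "integrable M B"
proof -
  interpret finite_measure M by fact
  note B = regularD(7,8)[OF assms(2)]
  show ?thesis
  proof (rule Bochner_Integration.integrable_bound[of _ "\<lambda>t. 1 + (B t)\<^sup>2"])
    show "AE t in M. norm (B t) \<le> norm (1 + (B t)\<^sup>2)"
    proof (intro AE_I2)
      fix t
      have "2 * \<bar>B t\<bar> \<le> (B t)\<^sup>2 + 1" using sum_squares_bound[of "\<bar>B t\<bar>" 1] by simp
      then show "norm (B t) \<le> norm (1 + (B t)\<^sup>2)" by simp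
    qed
  qed (use B in auto)
qed

lemma regular_const:
  assumes "finite_measure M" "\<psi> \<in> X" shows "regular M (\<lambda>t. \<psi>) (\<lambda>k t. \<psi>) (\<lambda>t. nrm \<psi>)"
proof -
  interpret finite_measure M by fact
  show ?thesis unfolding regular_def using assms by (simp add: nrm_zero)
qed

lemma ip_diff_bound:
  assumes "f \<in> X" "f' \<in> X" "h \<in> X" "h' \<in> X"
  shows "\<bar>ip f h - ip f' h'\<bar> \<le> nrm (\<lambda>x. f x - f' x) * nrm h + nrm f' * nrm (\<lambda>x. h x - h' x)"
proof -
  have "ip f h - ip f' h' = ip (\<lambda>x. f x - f' x) h + ip f' (\<lambda>x. h x - h' x)"
    using ip_diff_left[OF assms(1,2,3)] ip_diff_right[OF assms(3,4,2)] by simp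
  then show ?thesis
    using Cauchy_Schwarz[OF diff_mem[OF assms(1,2)] assms(3)] Cauchy_Schwarz[OF assms(2) diff_mem[OF assms(3,4)]]
    by linarith
qed

lemma tendsto_nrm:
  assumes "\<And>k. s k \<in> X" "u \<in> X" "(\<lambda>k. nrm (\<lambda>x. s k x - u x)) \<longlonglongrightarrow> 0"
  shows "(\<lambda>k. nrm (s k)) \<longlonglongrightarrow> nrm u"
proof -
  have "(\<lambda>k. nrm (s k) - nrm u) \<longlonglongrightarrow> 0"
  proof (rule Lim_null_comparison[OF _ assms(3)])
    show "eventually (\<lambda>k. norm (nrm (s k) - nrm u) \<le> nrm (\<lambda>x. s k x - u x)) sequentially"
      using nrm_diff_abs[OF assms(1) assms(2)] by simp
  qed
  then show ?thesis by (simp add: LIM_zero_iff)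
qed

lemma tendsto_ip:
  assumes s: "\<And>k. s k \<in> X" "u \<in> X" "(\<lambda>k. nrm (\<lambda>x. s k x - u x)) \<longlonglongrightarrow> 0"
    and r: "\<And>k. r k \<in> X" "v \<in> X" "(\<lambda>k. nrm (\<lambda>x. r k x - v x)) \<longlonglongrightarrow> 0"
  shows "(\<lambda>k. ip (s k) (r k)) \<longlonglongrightarrow> ip u v"
proof -
  have "(\<lambda>k. nrm (\<lambda>x. s k x - u x) * nrm (r k) + nrm u * nrm (\<lambda>x. r k x - v x)) \<longlonglongrightarrow> 0 * nrm v + nrm u * 0"
    by (intro tendsto_intros s r tendsto_nrm)
  then have "(\<lambda>k. nrm (\<lambda>x. s k x - u x) * nrm (r k) + nrm u * nrm (\<lambda>x. r k x - v x)) \<longlonglongrightarrow> 0" by simp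
  then have "(\<lambda>k. ip (s k) (r k) - ip u v) \<longlonglongrightarrow> 0"
  proof (rule Lim_null_comparison[rotated])
    show "eventually (\<lambda>k. norm (ip (s k) (r k) - ip u v) \<le> nrm (\<lambda>x. s k x - u x) * nrm (r k) + nrm u * nrm (\<lambda>x. r k x - v x)) sequentially"
      using ip_diff_bound[OF s(1) s(2) r(1) r(2)] by simp
  qed
  then show ?thesis by (simp add: LIM_zero_iff)
qed

lemma kernel_measurable:
  assumes u: "regular M u s B" and v: "regular M' v r C"
  shows "(\<lambda>p. ip (u (fst p)) (v (snd p))) \<in> borel_measurable (M \<Otimes>\<^sub>M M')"
proof (rule borel_measurable_LIMSEQ_real)
  fix p assume p: "p \<in> space (M \<Otimes>\<^sub>M M')"
  show "(\<lambda>k. ip (s k (fst p)) (r k (snd p))) \<longlonglongrightarrow> ip (u (fst p)) (v (snd p))"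
    using p by (intro tendsto_ip regularD(1,2)[OF u] regularD(1,2)[OF v] regularD(6)[OF u] regularD(6)[OF v]) (auto simp: space_pair_measure)
next
  fix k
  have s: "simple_function (M \<Otimes>\<^sub>M M') (\<lambda>p. s k (fst p))"
    using simple_function_comp[OF measurable_fst regularD(3)[OF u, of k], of M'] by (simp add: comp_def)
  have r: "simple_function (M \<Otimes>\<^sub>M M') (\<lambda>p. r k (snd p))"
    using simple_function_comp[OF measurable_snd regularD(3)[OF v, of k], of M] by (simp add: comp_def)
  show "(\<lambda>p. ip (s k (fst p)) (r k (snd p))) \<in> borel_measurable (M \<Otimes>\<^sub>M M')"
    by (intro borel_measurable_simple_function simple_function_compose2[OF s r])
qed

lemma ip_measurable:
  assumes u: "regular M u s B" and v: "regular M v r C"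
  shows "(\<lambda>t. ip (u t) (v t)) \<in> borel_measurable M"
proof -
  have "(\<lambda>t. (t, t)) \<in> M \<rightarrow>\<^sub>M M \<Otimes>\<^sub>M M" by measurable
  from measurable_compose[OF this kernel_measurable[OF u v]] show ?thesis by simp
qed

lemma ip_bound:
  assumes u: "regular M u s B" and v: "regular M' v r C" and t: "t \<in> space M" "t' \<in> space M'"
  shows "\<bar>ip (u t) (v t')\<bar> \<le> B t * C t'"
proof -
  have "\<bar>ip (u t) (v t')\<bar> \<le> nrm (u t) * nrm (v t')" by (intro Cauchy_Schwarz regularD(1)[OF u] regularD(1)[OF v])
  also have "\<dots> \<le> B t * C t'"
    by (intro mult_mono regularD(4)[OF u t(1)] regularD(4)[OF v t(2)] regular_B_nonneg[OF u t(1)] nrm_nonneg regularD(1)[OF v])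
  finally show ?thesis .
qed

lemma ip_bound_approx:
  assumes u: "regular M u s B" and v: "regular M' v r C" and t: "t \<in> space M" "t' \<in> space M'"
  shows "\<bar>ip (s k t) (r j t')\<bar> \<le> B t * C t'"
proof -
  have "\<bar>ip (s k t) (r j t')\<bar> \<le> nrm (s k t) * nrm (r j t')" by (intro Cauchy_Schwarz regularD(2)[OF u] regularD(2)[OF v])
  also have "\<dots> \<le> B t * C t'"
    by (intro mult_mono regularD(5)[OF u t(1)] regularD(5)[OF v t(2)] regular_B_nonneg[OF u t(1)] nrm_nonneg regularD(2)[OF v])
  finally show ?thesis .
qed

lemma integrable_B_mult:
  assumes u: "regular M u s B" and v: "regular M v r C"
  shows "integrable M (\<lambda>t. B t * C t)"
proof (rule Bochner_Integration.integrable_bound[of _ "\<lambda>t. (B t)\<^sup>2 + (C t)\<^sup>2"])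
  show "AE t in M. norm (B t * C t) \<le> norm ((B t)\<^sup>2 + (C t)\<^sup>2)"
  proof (intro AE_I2)
    fix t
    have "2 * \<bar>B t\<bar> * \<bar>C t\<bar> \<le> (B t)\<^sup>2 + (C t)\<^sup>2" using sum_squares_bound[of "\<bar>B t\<bar>" "\<bar>C t\<bar>"] by simp
    moreover have "0 \<le> \<bar>B t\<bar> * \<bar>C t\<bar>" by simp
    ultimately have "\<bar>B t\<bar> * \<bar>C t\<bar> \<le> (B t)\<^sup>2 + (C t)\<^sup>2" by linarith
    then show "norm (B t * C t) \<le> norm ((B t)\<^sup>2 + (C t)\<^sup>2)" by (simp add: abs_mult)
  qed
qed (use regularD(7,8)[OF u] regularD(7,8)[OF v] in auto)

lemma ip_integrable:
  assumes u: "regular M u s B" and v: "regular M v r C"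
  shows "integrable M (\<lambda>t. ip (u t) (v t))"
proof (rule Bochner_Integration.integrable_bound[OF integrable_B_mult[OF u v] ip_measurable[OF u v]])
  show "AE t in M. norm (ip (u t) (v t)) \<le> norm (B t * C t)"
    using ip_bound[OF u v] by (intro AE_I2) (auto intro: order_trans[OF _ abs_ge_self])
qed

lemma ip_const_integrable:
  assumes "finite_measure M" "regular M u s B" "\<psi> \<in> X"
  shows "integrable M (\<lambda>t. ip (u t) \<psi>)"
  by (rule ip_integrable[OF assms(2) regular_const[OF assms(1,3)]])

lemma integrable_B_kernel:
  assumes "finite_measure M" and u: "regular M u s B" and v: "regular M v r C"
  shows "integrable (M \<Otimes>\<^sub>M M) (\<lambda>p. B (fst p) * C (snd p))"
proof -
  interpret finite_measure M by fact
  interpret pair_sigma_finite M M ..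
  note B = regular_B_integrable[OF assms(1) u] regularD(7)[OF u]
  note C = regular_B_integrable[OF assms(1) v] regularD(7)[OF v]
  note [measurable] = B(2) C(2)
  show ?thesis
  proof (rule Fubini_integrable)
    show "(\<lambda>p. B (fst p) * C (snd p)) \<in> borel_measurable (M \<Otimes>\<^sub>M M)" by measurable
    show "integrable M (\<lambda>x. \<integral>y. norm (B (fst (x, y)) * C (snd (x, y))) \<partial>M)"
      using B C by (simp add: abs_mult)
    show "AE x in M. integrable M (\<lambda>y. B (fst (x, y)) * C (snd (x, y)))"
      using C by simp
  qed
qed

lemma kernel_integrable:
  assumes "finite_measure M" and u: "regular M u s B" and v: "regular M v r C"
  shows "integrable (M \<Otimes>\<^sub>M M) (\<lambda>p. ip (u (fst p)) (v (snd p)))"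
proof (rule Bochner_Integration.integrable_bound[OF integrable_B_kernel[OF assms] kernel_measurable[OF u v]])
  show "AE p in M \<Otimes>\<^sub>M M. norm (ip (u (fst p)) (v (snd p))) \<le> norm (B (fst p) * C (snd p))"
    using ip_bound[OF u v] by (intro AE_I2) (auto simp: space_pair_measure intro: order_trans[OF _ abs_ge_self])
qed

text \<open>The exceptional null set may depend on \<open>\<psi>\<close>, but the approximations take only countably many values.\<close>

lemma AE_at_regular:
  assumes u: "regular M u s B"
    and 0: "\<And>\<psi>. \<psi> \<in> X \<Longrightarrow> AE t in M. F t \<psi> = (0::real)"
    and lim: "AE t in M. (\<lambda>k. F t (s k t)) \<longlonglongrightarrow> F t (u t)"
  shows "AE t in M. F t (u t) = 0"
proof -
  let ?S = "\<Union>k. s k ` space M"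
  have "countable ?S"
    using simple_functionD(1)[OF regularD(3)[OF u]] by (intro countable_UN) (auto intro: countable_finite)
  moreover have "AE t in M. F t c = 0" if "c \<in> ?S" for c
    using that 0 regularD(2)[OF u] by auto
  ultimately have "AE t in M. \<forall>c\<in>?S. F t c = 0" by (intro AE_ball_countable') auto
  with lim AE_space show ?thesis
  proof eventually_elim
    case (elim t)
    then have "F t (s k t) = 0" for k by auto
    then show ?case using elim(1) by (simp add: LIMSEQ_const_iff)
  qed
qed

text \<open>The diagonal choice \<psi> = u t is what the preceding lemma permits, although each
  \<psi> comes with its own null set.\<close>

lemma AE_zero_if_weakly_zero:
  assumes u: "regular M u s B" and 0: "\<And>\<psi>. \<psi> \<in> X \<Longrightarrow> AE t in M. ip (u t) \<psi> = 0"
  shows "AE t in M. nrm (u t) = 0"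
proof -
  have "AE t in M. ip (u t) (u t) = 0"
  proof (rule AE_at_regular[OF u 0])
    show "AE t in M. (\<lambda>k. ip (u t) (s k t)) \<longlonglongrightarrow> ip (u t) (u t)"
      by (intro AE_I2 tendsto_ip regularD(1,2)[OF u] regularD(6)[OF u]) (auto simp: nrm_zero)
  qed
  then show ?thesis by eventually_elim (simp add: nrm_def)
qed

text \<open>Everything is set to zero on the exceptional null set, and an approximation whose norm
  exceeds B is cut to zero. At each time the cut is eventually inactive because the norms
  converge.\<close>

lemma regularize:
  assumes M: "finite_measure M" and sm: "strongly_measurable M X nrm u"
    and int: "integrable M (\<lambda>t. (nrm (u t))\<^sup>2)"
  obtains u' s B where "regular M u' s B" "AE t in M. u' t = u t"
proof -
  interpret finite_measure M by fact
  have "\<exists>s. (\<forall>k::nat. simple_function M (s k) \<and> s k ` space M \<subseteq> X) \<and> (AE t in M. (\<lambda>k. nrm (\<lambda>x. s k t x - u t x)) \<longlonglongrightarrow> 0)"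
    using sm unfolding strongly_measurable_def by (rule conjunct2)
  then obtain s where s': "\<forall>k::nat. simple_function M (s k) \<and> s k ` space M \<subseteq> X"
    and lim: "AE t in M. (\<lambda>k. nrm (\<lambda>x. s k t x - u t x)) \<longlonglongrightarrow> 0" by (elim exE conjE)
  have s: "simple_function M (s k)" "s k ` space M \<subseteq> X" for k using s' by blast+
  have "AE t in M. u t \<in> X" using sm unfolding strongly_measurable_def by (rule conjunct1)
  with lim have "AE t in M. u t \<in> X \<and> (\<lambda>k. nrm (\<lambda>x. s k t x - u t x)) \<longlonglongrightarrow> 0" by eventually_elim simp
  then obtain N where N: "N \<in> null_sets M"
    "\<And>t. t \<in> space M - N \<Longrightarrow> u t \<in> X \<and> (\<lambda>k. nrm (\<lambda>x. s k t x - u t x)) \<longlonglongrightarrow> 0"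
    by (rule AE_E3) blast
  define u' where "u' t = (if t \<in> space M - N then u t else (\<lambda>x. 0))" for t
  define s0 where "s0 k t = (if t \<in> space M - N then s k t else (\<lambda>x. 0))" for k t
  have u'X: "u' t \<in> X" for t using N(2)[of t] by (simp add: u'_def zero_mem)
  have s0X: "s0 k t \<in> X" for k t using s(2)[of k] by (auto simp: s0_def zero_mem)
  have lim0: "(\<lambda>k. nrm (\<lambda>x. s0 k t x - u' t x)) \<longlonglongrightarrow> 0" for t
    using N(2)[of t] by (cases "t \<in> space M - N") (auto simp: s0_def u'_def nrm_zero)
  have sm0: "simple_function M (s0 k)" for k
    unfolding s0_def using N(1) s(1)[of k] by (intro simple_function_If_set) (auto simp: null_sets_def)
  have nm: "(\<lambda>t. nrm (s0 k t)) \<in> borel_measurable M" for k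
    by (intro borel_measurable_simple_function simple_function_compose1[OF sm0])
  have um: "(\<lambda>t. nrm (u' t)) \<in> borel_measurable M"
    by (rule borel_measurable_LIMSEQ_real[OF _ nm]) (rule tendsto_nrm[OF s0X u'X lim0])
  have aeq: "AE t in M. u' t = u t"
    using AE_not_in[OF N(1)] AE_space by eventually_elim (simp add: u'_def)
  have ui: "integrable M (\<lambda>t. (nrm (u' t))\<^sup>2)"
  proof (rule integrable_cong_AE_imp[OF int])
    show "AE t in M. (nrm (u t))\<^sup>2 = (nrm (u' t))\<^sup>2" using aeq by eventually_elim simp
  qed (use um in auto)
  \<comment> \<open>The added 1 leaves strict room above the limit of the norms, so the cut is
    eventually inactive; it stays square integrable since the measure is finite.\<close>
  define B where "B t = nrm (u' t) + 1" for t
  define s1 where "s1 k t = (if nrm (s0 k t) \<le> B t then s0 k t else (\<lambda>x. 0))" for k t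
  have B0: "0 \<le> B t" for t using nrm_nonneg[OF u'X] by (simp add: B_def add_nonneg_nonneg)
  have "regular M u' s1 B" unfolding regular_def
  proof (intro conjI allI ballI)
    show "u' t \<in> X" for t by (rule u'X)
    show "s1 k t \<in> X" for k t using s0X zero_mem by (simp add: s1_def)
    show "B \<in> borel_measurable M" unfolding B_def using um by auto
    show "nrm (u' t) \<le> B t" for t by (simp add: B_def)
    show "nrm (s1 k t) \<le> B t" for k t using B0 by (simp add: s1_def nrm_zero)
    show "simple_function M (s1 k)" for k
      unfolding s1_def B_def using sm0[of k] nm[of k] um by (intro simple_function_If) auto
    show "(\<lambda>k. nrm (\<lambda>x. s1 k t x - u' t x)) \<longlonglongrightarrow> 0" for t
    proof (rule Lim_transform_eventually[OF lim0[of t]])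
      have "eventually (\<lambda>k. nrm (s0 k t) < B t) sequentially"
        using order_tendstoD(2)[OF tendsto_nrm[OF s0X u'X lim0]] by (simp add: B_def)
      then show "eventually (\<lambda>k. nrm (\<lambda>x. s0 k t x - u' t x) = nrm (\<lambda>x. s1 k t x - u' t x)) sequentially"
        by eventually_elim (simp add: s1_def)
    qed
    show "integrable M (\<lambda>t. (B t)\<^sup>2)"
    proof (rule Bochner_Integration.integrable_bound[of _ "\<lambda>t. 2 * (nrm (u' t))\<^sup>2 + 2"])
      show "AE t in M. norm ((B t)\<^sup>2) \<le> norm (2 * (nrm (u' t))\<^sup>2 + 2)"
      proof (intro AE_I2)
        fix t
        have "(B t)\<^sup>2 = (nrm (u' t))\<^sup>2 + 2 * nrm (u' t) * 1 + 1\<^sup>2" unfolding B_def by (simp add: power2_sum)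
        then have "(B t)\<^sup>2 \<le> 2 * (nrm (u' t))\<^sup>2 + 2"
          using sum_squares_bound[of "nrm (u' t)" 1] by simp
        then show "norm ((B t)\<^sup>2) \<le> norm (2 * (nrm (u' t))\<^sup>2 + 2)"
          by (simp add: order_trans[OF _ abs_ge_self])
      qed
    qed (use ui um in \<open>auto simp: B_def\<close>)
  qed
  then show thesis using aeq by (rule that)
qed

lemma regular_lin:
  assumes u: "regular M u s B" and v: "regular M v r C"
  shows "regular M (\<lambda>t x. a * u t x + b * v t x) (\<lambda>k t x. a * s k t x + b * r k t x) (\<lambda>t. \<bar>a\<bar> * B t + \<bar>b\<bar> * C t)"
proof -
  have nl: "nrm (\<lambda>x. a * f x + b * h x) \<le> \<bar>a\<bar> * nrm f + \<bar>b\<bar> * nrm h" if "f \<in> X" "h \<in> X" for f h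
    using nrm_add[OF scale_mem[OF that(1), of a] scale_mem[OF that(2), of b]] nrm_scale[OF that(1), of a] nrm_scale[OF that(2), of b]
    by simp
  show ?thesis unfolding regular_def
  proof (intro conjI allI ballI)
    show "(\<lambda>x. a * u t x + b * v t x) \<in> X" for t by (intro lin_mem regularD(1)[OF u] regularD(1)[OF v])
    show "(\<lambda>x. a * s k t x + b * r k t x) \<in> X" for k t by (intro lin_mem regularD(2)[OF u] regularD(2)[OF v])
    show "simple_function M (\<lambda>t x. a * s k t x + b * r k t x)" for k
      by (rule simple_function_compose2[OF regularD(3)[OF u] regularD(3)[OF v], of "\<lambda>f h x. a * f x + b * h x"])
    show "nrm (\<lambda>x. a * u t x + b * v t x) \<le> \<bar>a\<bar> * B t + \<bar>b\<bar> * C t" if t: "t \<in> space M" for t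
      by (rule order_trans[OF nl]) (intro regularD(1)[OF u] regularD(1)[OF v] add_mono mult_left_mono regularD(4)[OF u t] regularD(4)[OF v t] abs_ge_zero)+
    show "nrm (\<lambda>x. a * s k t x + b * r k t x) \<le> \<bar>a\<bar> * B t + \<bar>b\<bar> * C t" if t: "t \<in> space M" for k t
      by (rule order_trans[OF nl]) (intro regularD(2)[OF u] regularD(2)[OF v] add_mono mult_left_mono regularD(5)[OF u t] regularD(5)[OF v t] abs_ge_zero)+
    show "(\<lambda>t. \<bar>a\<bar> * B t + \<bar>b\<bar> * C t) \<in> borel_measurable M" using regularD(7)[OF u] regularD(7)[OF v] by auto
    have "(\<bar>a\<bar> * B t + \<bar>b\<bar> * C t)\<^sup>2 = a\<^sup>2 * (B t)\<^sup>2 + (2 * \<bar>a\<bar> * \<bar>b\<bar>) * (B t * C t) + b\<^sup>2 * (C t)\<^sup>2" for t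
      by (simp add: power2_sum power_mult_distrib)
    then show "integrable M (\<lambda>t. (\<bar>a\<bar> * B t + \<bar>b\<bar> * C t)\<^sup>2)"
      using regularD(8)[OF u] regularD(8)[OF v] integrable_B_mult[OF u v] by simp
    show "(\<lambda>k. nrm (\<lambda>x. a * s k t x + b * r k t x - (a * u t x + b * v t x))) \<longlonglongrightarrow> 0" if t: "t \<in> space M" for t
    proof (rule Lim_null_comparison[of _ "\<lambda>k. \<bar>a\<bar> * nrm (\<lambda>x. s k t x - u t x) + \<bar>b\<bar> * nrm (\<lambda>x. r k t x - v t x)"])
      have "(\<lambda>k. \<bar>a\<bar> * nrm (\<lambda>x. s k t x - u t x) + \<bar>b\<bar> * nrm (\<lambda>x. r k t x - v t x)) \<longlonglongrightarrow> \<bar>a\<bar> * 0 + \<bar>b\<bar> * 0"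
        by (intro tendsto_intros regularD(6)[OF u t] regularD(6)[OF v t])
      then show "(\<lambda>k. \<bar>a\<bar> * nrm (\<lambda>x. s k t x - u t x) + \<bar>b\<bar> * nrm (\<lambda>x. r k t x - v t x)) \<longlonglongrightarrow> 0" by simp
      show "eventually (\<lambda>k. norm (nrm (\<lambda>x. a * s k t x + b * r k t x - (a * u t x + b * v t x)))
          \<le> \<bar>a\<bar> * nrm (\<lambda>x. s k t x - u t x) + \<bar>b\<bar> * nrm (\<lambda>x. r k t x - v t x)) sequentially"
      proof (intro always_eventually allI)
        fix k
        have e: "(\<lambda>x. a * s k t x + b * r k t x - (a * u t x + b * v t x)) = (\<lambda>x. a * (s k t x - u t x) + b * (r k t x - v t x))"
          by (auto simp: algebra_simps)
        have m: "(\<lambda>x. s k t x - u t x) \<in> X" "(\<lambda>x. r k t x - v t x) \<in> X"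
          by (intro diff_mem regularD(1,2)[OF u] regularD(1,2)[OF v])+
        show "norm (nrm (\<lambda>x. a * s k t x + b * r k t x - (a * u t x + b * v t x)))
          \<le> \<bar>a\<bar> * nrm (\<lambda>x. s k t x - u t x) + \<bar>b\<bar> * nrm (\<lambda>x. r k t x - v t x)"
          unfolding e using nl[OF m] nrm_nonneg[OF lin_mem[OF m]] by simp
      qed
    qed
  qed
qed

text \<open>By Cauchy-Schwarz the pairings with \<psi> of the simple functions converge in the mean
  to the pairing of q, while their integrals are pairings of \<psi> with the finite sums that
  converge to J. The definition of the integral gives no measurability of scalar quantities; it is
  recovered from the pointwise approximations r and completeness of M.\<close>

lemma Bochner_integral_ip:
  assumes M: "finite_measure M" "complete_measure M" and J: "is_Bochner_integral M X nrm q J" and psi: "\<psi> \<in> X"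
  shows "integrable M (\<lambda>t. ip (q t) \<psi>)" and "ip J \<psi> = (LINT t|M. ip (q t) \<psi>)"
proof -
  interpret finite_measure M by fact
  interpret complete_measure M by fact
  have JX: "J \<in> X" using J unfolding is_Bochner_integral_def by (rule conjunct1)
  have sm: "strongly_measurable M X nrm q"
    using J unfolding is_Bochner_integral_def by (rule conjunct1[OF conjunct2])
  obtain s where s': "\<forall>k::nat. simple_function M (s k) \<and> s k ` space M \<subseteq> X"
    and lim: "(\<lambda>k. \<integral>\<^sup>+t. ennreal (nrm (\<lambda>x. s k t x - q t x)) \<partial>M) \<longlonglongrightarrow> 0"
    and limJ: "(\<lambda>k. nrm (\<lambda>x. (\<Sum>c\<in>s k ` space M. measure M {t \<in> space M. s k t = c} * c x) - J x)) \<longlonglongrightarrow> 0"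
    using J unfolding is_Bochner_integral_def by (elim exE conjE)
  have s: "simple_function M (s k)" "s k ` space M \<subseteq> X" for k using s' by blast+
  have qX: "AE t in M. q t \<in> X" using sm unfolding strongly_measurable_def by (rule conjunct1)
  obtain r where r': "\<forall>k::nat. simple_function M (r k) \<and> r k ` space M \<subseteq> X"
    and rlim: "AE t in M. (\<lambda>k. nrm (\<lambda>x. r k t x - q t x)) \<longlonglongrightarrow> 0"
    using sm unfolding strongly_measurable_def by (elim exE conjE)
  have r: "simple_function M (r k)" "r k ` space M \<subseteq> X" for k using r' by blast+
  \<comment> \<open>A limit of measurable functions is taken everywhere, convergent or not; it
    agrees almost everywhere with the pairing of q and makes it measurable.\<close>
  define Q where "Q t = lim (\<lambda>k. ip (r k t) \<psi>)" for t
  have Qm: "Q \<in> borel_measurable M"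
    unfolding Q_def by (intro borel_measurable_lim_metric borel_measurable_simple_function simple_function_compose1[OF r(1)])
  have "AE t in M. Q t = ip (q t) \<psi>"
    using qX rlim AE_space
  proof eventually_elim
    case (elim t)
    have "(\<lambda>k. ip (r k t) \<psi>) \<longlonglongrightarrow> ip (q t) \<psi>"
      using elim r(2) psi by (intro tendsto_ip) (auto simp: nrm_zero)
    then show ?case unfolding Q_def by (rule limI)
  qed
  then have qm [measurable]: "(\<lambda>t. ip (q t) \<psi>) \<in> borel_measurable M"
    by (rule borel_measurable_AE_cong[OF Qm])
  have si: "integrable M (\<lambda>t. ip (s k t) \<psi>)" for k by (rule simple_function_sum_vimage(1)[OF M(1) s(1)])
  have fin: "finite (s k ` space M)" for k using s(1) by (rule simple_functionD)
  have sint: "(LINT t|M. ip (s k t) \<psi>) = ip (\<lambda>x. \<Sum>c\<in>s k ` space M. measure M {t \<in> space M. s k t = c} * c x) \<psi>" for k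
  proof -
    have "(LINT t|M. ip (s k t) \<psi>) = (\<Sum>c\<in>s k ` space M. measure M {t \<in> space M. s k t = c} * ip c \<psi>)"
      by (rule simple_function_sum_vimage(2)[OF M(1) s(1)])
    also have "\<dots> = ip (\<lambda>x. \<Sum>c\<in>s k ` space M. measure M {t \<in> space M. s k t = c} * c x) \<psi>"
      by (rule ip_sum_left[symmetric, OF fin subsetD[OF s(2)] psi])
    finally show ?thesis .
  qed
  have le: "(\<integral>\<^sup>+t. ennreal \<bar>ip (s k t) \<psi> - ip (q t) \<psi>\<bar> \<partial>M) \<le> ennreal (nrm \<psi>) * (\<integral>\<^sup>+t. ennreal (nrm (\<lambda>x. s k t x - q t x)) \<partial>M)" for k
  proof -
    have "(\<integral>\<^sup>+t. ennreal \<bar>ip (s k t) \<psi> - ip (q t) \<psi>\<bar> \<partial>M) \<le> (\<integral>\<^sup>+t. ennreal (nrm \<psi>) * ennreal (nrm (\<lambda>x. s k t x - q t x)) \<partial>M)"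
    proof (rule nn_integral_mono_AE)
      show "AE t in M. ennreal \<bar>ip (s k t) \<psi> - ip (q t) \<psi>\<bar> \<le> ennreal (nrm \<psi>) * ennreal (nrm (\<lambda>x. s k t x - q t x))"
        using qX AE_space
      proof eventually_elim
        case (elim t)
        then have st: "s k t \<in> X" using s(2) by auto
        have "\<bar>ip (s k t) \<psi> - ip (q t) \<psi>\<bar> = \<bar>ip (\<lambda>x. s k t x - q t x) \<psi>\<bar>"
          using ip_diff_left[OF st elim(1) psi] by simp
        also have "\<dots> \<le> nrm (\<lambda>x. s k t x - q t x) * nrm \<psi>"
          by (rule Cauchy_Schwarz[OF diff_mem[OF st elim(1)] psi])
        finally show ?case
          using nrm_nonneg[OF psi] nrm_nonneg[OF diff_mem[OF st elim(1)]]
          by (simp add: ennreal_mult[symmetric] mult.commute)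
      qed
    qed
    also have "\<dots> \<le> ennreal (nrm \<psi>) * (\<integral>\<^sup>+t. ennreal (nrm (\<lambda>x. s k t x - q t x)) \<partial>M)"
    proof -
      \<comment> \<open>Taking the constant out of the nonnegative integral needs measurability of
        the error norm, which is again a limit along r.\<close>
      obtain f where f: "f \<in> borel_measurable M" "AE t in M. f t = nrm (\<lambda>x. s k t x - q t x)"
      proof
        define f where "f t = lim (\<lambda>j. nrm (\<lambda>x. s k t x - r j t x))" for t
        show "f \<in> borel_measurable M" unfolding f_def
          by (intro borel_measurable_lim_metric borel_measurable_simple_function simple_function_compose2[OF s(1) r(1), of "\<lambda>a b. nrm (\<lambda>x. a x - b x)"])
        show "AE t in M. f t = nrm (\<lambda>x. s k t x - q t x)"
          using qX rlim AE_space
        proof eventually_elim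
          case (elim t)
          have st: "s k t \<in> X" using s(2)[of k] elim(3) by auto
          have rt: "r j t \<in> X" for j using r(2)[of j] elim(3) by auto
          have "(\<lambda>j. nrm (\<lambda>x. s k t x - r j t x)) \<longlonglongrightarrow> nrm (\<lambda>x. s k t x - q t x)"
          proof (rule tendsto_nrm)
            show "(\<lambda>x. s k t x - r j t x) \<in> X" for j by (rule diff_mem[OF st rt])
            show "(\<lambda>x. s k t x - q t x) \<in> X" by (rule diff_mem[OF st elim(1)])
            have "nrm (\<lambda>x. s k t x - r j t x - (s k t x - q t x)) = nrm (\<lambda>x. r j t x - q t x)" for j
              using nrm_diff_commute[OF elim(1) rt, of j] by simp
            then show "(\<lambda>j. nrm (\<lambda>x. s k t x - r j t x - (s k t x - q t x))) \<longlonglongrightarrow> 0" using elim(2) by simp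
          qed
          then show ?case unfolding f_def by (rule limI)
        qed
      qed
      have nm [measurable]: "(\<lambda>t. nrm (\<lambda>x. s k t x - q t x)) \<in> borel_measurable M"
        by (rule borel_measurable_AE_cong[OF f])
      show ?thesis by (subst nn_integral_cmult) auto
    qed
    finally show ?thesis .
  qed
  have lim2: "(\<lambda>k. \<integral>\<^sup>+t. ennreal \<bar>ip (s k t) \<psi> - ip (q t) \<psi>\<bar> \<partial>M) \<longlonglongrightarrow> 0"
  proof (rule tendsto_sandwich[of "\<lambda>_. 0"])
    have "(\<lambda>k. ennreal (nrm \<psi>) * (\<integral>\<^sup>+t. ennreal (nrm (\<lambda>x. s k t x - q t x)) \<partial>M)) \<longlonglongrightarrow> ennreal (nrm \<psi>) * 0"
      by (rule ennreal_tendsto_cmult[OF _ lim]) simp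
    then show "(\<lambda>k. ennreal (nrm \<psi>) * (\<integral>\<^sup>+t. ennreal (nrm (\<lambda>x. s k t x - q t x)) \<partial>M)) \<longlonglongrightarrow> 0" by simp
  qed (use le in auto)
  \<comment> \<open>A single approximation at finite distance in the mean already makes the pairing
    of q integrable.\<close>
  have "eventually (\<lambda>k. (\<integral>\<^sup>+t. ennreal \<bar>ip (s k t) \<psi> - ip (q t) \<psi>\<bar> \<partial>M) < 1) sequentially"
    using order_tendstoD(2)[OF lim2, of 1] by simp
  then obtain k where k: "(\<integral>\<^sup>+t. ennreal \<bar>ip (s k t) \<psi> - ip (q t) \<psi>\<bar> \<partial>M) < 1"
    by (auto simp: eventually_sequentially)
  have sm': "(\<lambda>t. ip (s k t) \<psi>) \<in> borel_measurable M" for k using si by auto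
  have "integrable M (\<lambda>t. ip (s k t) \<psi> - ip (q t) \<psi>)"
  proof (rule integrableI_bounded)
    show "(\<integral>\<^sup>+ x. ennreal (norm (ip (s k x) \<psi> - ip (q x) \<psi>)) \<partial>M) < \<infinity>" using k by (simp add: order_less_trans[OF k])
  qed (use sm' in auto)
  then have "integrable M (\<lambda>t. ip (s k t) \<psi> - (ip (s k t) \<psi> - ip (q t) \<psi>))" using si by (rule Bochner_Integration.integrable_diff[rotated])
  then show qi: "integrable M (\<lambda>t. ip (q t) \<psi>)" by simp
  have "(\<lambda>k. LINT t|M. ip (s k t) \<psi>) \<longlonglongrightarrow> (LINT t|M. ip (q t) \<psi>)"
  proof (rule tendsto_L1_int[OF si qi])
    show "(\<lambda>k. \<integral>\<^sup>+ t. ennreal (norm (ip (s k t) \<psi> - ip (q t) \<psi>)) \<partial>M) \<longlonglongrightarrow> 0" using lim2 by simp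
  qed
  moreover have "(\<lambda>k. LINT t|M. ip (s k t) \<psi>) \<longlonglongrightarrow> ip J \<psi>"
    unfolding sint
  proof (rule tendsto_ip[OF _ JX limJ psi psi])
    show "(\<lambda>x. \<Sum>c\<in>s k ` space M. measure M {t \<in> space M. s k t = c} * c x) \<in> X" for k
      using s(2)[of k] by (intro sum_mem fin) auto
  qed (simp add: nrm_zero)
  ultimately show "ip J \<psi> = (LINT t|M. ip (q t) \<psi>)" by (rule LIMSEQ_unique[rotated])
qed

text \<open>With \<psi> fixed, simple approximations of the scalar factor suffice, and all vector
  norms reduce to \<open>\<bar>a k t - \<alpha> t\<bar> * nrm \<psi>\<close>. These integrals are
  what is needed to place products of a time and a space factor in \<open>U_space\<close>.\<close>

lemma scalar_mult_Bochner:
  assumes M: "finite_measure M" and a: "integrable M \<alpha>" and psi: "\<psi> \<in> X"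
  shows "is_Bochner_integral M X nrm (\<lambda>t x. \<alpha> t * \<psi> x) (\<lambda>x. (LINT t|M. \<alpha> t) * \<psi> x)"
proof -
  have am: "\<alpha> \<in> borel_measurable M" using a by auto
  obtain a where a': "\<And>k. simple_function M (a k)" "\<And>t. t \<in> space M \<Longrightarrow> (\<lambda>k. a k t) \<longlonglongrightarrow> \<alpha> t"
      "\<And>k t. t \<in> space M \<Longrightarrow> \<bar>a k t\<bar> \<le> 2 * \<bar>\<alpha> t\<bar>"
  proof -
    obtain a where a': "\<forall>i. simple_function M (a i)" "\<forall>x\<in>space M. (\<lambda>i. a i x) \<longlonglongrightarrow> \<alpha> x"
        "\<forall>i. \<forall>x\<in>space M. dist (a i x) 0 \<le> 2 * dist (\<alpha> x) 0"
      using borel_measurable_implies_sequence_metric[OF am, of 0] by (elim exE conjE)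
    show thesis by (rule that[of a]) (use a' in \<open>simp_all add: dist_real_def\<close>)
  qed
  have ai: "integrable M (a k)" for k using simple_function_sum_vimage(1)[OF M a'(1), of "\<lambda>r. r"] by simp
  have pX: "(\<lambda>x. c * \<psi> x) \<in> X" for c by (rule scale_mem[OF psi])
  have df: "nrm (\<lambda>x. c * \<psi> x - d * \<psi> x) = \<bar>c - d\<bar> * nrm \<psi>" for c d
    using nrm_scale[OF psi, of "c - d"] by (simp add: left_diff_distrib)
  have sf: "simple_function M (\<lambda>t x. a k t * \<psi> x)" for k
    by (rule simple_function_compose1[OF a'(1), of "\<lambda>c x. c * \<psi> x"])
  have l1: "(\<lambda>k. LINT t|M. \<bar>a k t - \<alpha> t\<bar>) \<longlonglongrightarrow> (LINT t|M. 0)"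
  \<comment> \<open>The constant 3 is 2 + 1: the approximations satisfy
    \<open>\<bar>a k t\<bar> \<le> 2 * \<bar>\<alpha> t\<bar>\<close>.\<close>
  proof (rule integral_dominated_convergence[where w="\<lambda>t. 3 * \<bar>\<alpha> t\<bar>"])
    show "AE t in M. (\<lambda>k. \<bar>a k t - \<alpha> t\<bar>) \<longlonglongrightarrow> 0"
    proof (intro AE_I2)
      fix t assume "t \<in> space M"
      from tendsto_diff[OF a'(2)[OF this] tendsto_const[of "\<alpha> t"]]
      show "(\<lambda>k. \<bar>a k t - \<alpha> t\<bar>) \<longlonglongrightarrow> 0" by (simp add: tendsto_rabs_zero_iff)
    qed
    show "AE t in M. norm \<bar>a k t - \<alpha> t\<bar> \<le> 3 * \<bar>\<alpha> t\<bar>" for k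
    proof (intro AE_I2)
      fix t assume "t \<in> space M"
      from a'(3)[OF this, of k] show "norm \<bar>a k t - \<alpha> t\<bar> \<le> 3 * \<bar>\<alpha> t\<bar>" by simp
    qed
  qed (use a ai in auto)
  have nl: "(\<lambda>k. \<integral>\<^sup>+t. ennreal (nrm (\<lambda>x. a k t * \<psi> x - \<alpha> t * \<psi> x)) \<partial>M) \<longlonglongrightarrow> 0"
  proof -
    have "(\<integral>\<^sup>+t. ennreal (nrm (\<lambda>x. a k t * \<psi> x - \<alpha> t * \<psi> x)) \<partial>M) = ennreal ((LINT t|M. \<bar>a k t - \<alpha> t\<bar>) * nrm \<psi>)" for k
      unfolding df using a ai[of k] nrm_nonneg[OF psi]
      by (subst nn_integral_eq_integral) auto
    moreover have "(\<lambda>k. ennreal ((LINT t|M. \<bar>a k t - \<alpha> t\<bar>) * nrm \<psi>)) \<longlonglongrightarrow> ennreal (0 * nrm \<psi>)"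
      using l1 by (intro tendsto_ennrealI tendsto_mult tendsto_const) simp
    ultimately show ?thesis by simp
  qed
  have sm: "strongly_measurable M X nrm (\<lambda>t x. \<alpha> t * \<psi> x)"
    unfolding strongly_measurable_def
  proof (intro conjI AE_I2 exI[of _ "\<lambda>k t x. a k t * \<psi> x"] allI)
    fix t assume t: "t \<in> space M"
    have "(\<lambda>k. \<bar>a k t - \<alpha> t\<bar> * nrm \<psi>) \<longlonglongrightarrow> \<bar>\<alpha> t - \<alpha> t\<bar> * nrm \<psi>"
      by (intro tendsto_intros a'(2)[OF t])
    then show "(\<lambda>k. nrm (\<lambda>x. a k t * \<psi> x - \<alpha> t * \<psi> x)) \<longlonglongrightarrow> 0" unfolding df by simp
  qed (use pX sf in auto)
  \<comment> \<open>The vector sum is computed at each point x, by using evaluation at x as the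
    functional on the values.\<close>
  have sum: "(\<Sum>c\<in>(\<lambda>t x. a k t * \<psi> x) ` space M. measure M {t \<in> space M. (\<lambda>x. a k t * \<psi> x) = c} * c x)
     = (LINT t|M. a k t) * \<psi> x" for k x
    using simple_function_sum_vimage(2)[OF M sf, of "\<lambda>c. c x" k] by simp
  have "(\<lambda>k. LINT t|M. a k t) \<longlonglongrightarrow> (LINT t|M. \<alpha> t)"
  proof (rule tendsto_L1_int[OF ai a])
    have "(\<integral>\<^sup>+ t. ennreal (norm (a k t - \<alpha> t)) \<partial>M) = ennreal (LINT t|M. \<bar>a k t - \<alpha> t\<bar>)" for k
      using a ai[of k] by (subst nn_integral_eq_integral) auto
    then show "(\<lambda>k. \<integral>\<^sup>+ t. ennreal (norm (a k t - \<alpha> t)) \<partial>M) \<longlonglongrightarrow> 0"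
      using tendsto_ennrealI[OF l1] by simp
  qed
  then have "(\<lambda>k. \<bar>(LINT t|M. a k t) - (LINT t|M. \<alpha> t)\<bar> * nrm \<psi>) \<longlonglongrightarrow> \<bar>(LINT t|M. \<alpha> t) - (LINT t|M. \<alpha> t)\<bar> * nrm \<psi>"
    by (intro tendsto_intros)
  then have lj: "(\<lambda>k. nrm (\<lambda>x. (\<Sum>c\<in>(\<lambda>t x. a k t * \<psi> x) ` space M. measure M {t \<in> space M. (\<lambda>x. a k t * \<psi> x) = c} * c x) - (LINT t|M. \<alpha> t) * \<psi> x)) \<longlonglongrightarrow> 0"
    unfolding sum df by simp
  show ?thesis unfolding is_Bochner_integral_def
    by (intro conjI exI[of _ "\<lambda>k t x. a k t * \<psi> x"] allI pX sm nl lj sf) (use pX in auto)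
qed

end

section \<open>Scalar functions of time\<close>

lemma lebesgue_on_integral_eq:
  fixes f :: "real \<Rightarrow> real"
  assumes "S \<in> sets lebesgue" shows "(LINT x|lebesgue_on S. f x) = (LINT x|lebesgue. indicator S x * f x)"
  using assms by (simp add: integral_restrict_space)

lemma lebesgue_on_integrable_iff:
  fixes f :: "real \<Rightarrow> real"
  assumes "S \<in> sets lebesgue" shows "integrable (lebesgue_on S) f \<longleftrightarrow> integrable lebesgue (\<lambda>x. indicator S x * f x)"
  using assms by (simp add: integrable_restrict_space)

lemma integral_deriv_interval:
  fixes F f :: "real \<Rightarrow> real"
  assumes ab: "a \<le> b" and c: "continuous_on {a..b} f"
    and D: "\<And>x. x \<in> {a..b} \<Longrightarrow> (F has_real_derivative f x) (at x within {a..b})"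
  shows "integrable (lebesgue_on {a<..<b}) f" "(LINT x|lebesgue_on {a<..<b}. f x) = F b - F a"
proof -
  have "f absolutely_integrable_on {a..b}"
    using absolutely_integrable_continuous[of a b f] c by simp
  then have ai: "f absolutely_integrable_on {a<..<b}"
    by (rule set_integrable_subset) auto
  then show i: "integrable (lebesgue_on {a<..<b}) f"
    by (simp add: integrable_restrict_space set_integrable_def)
  have "(f has_integral (F b - F a)) {a..b}"
    by (intro fundamental_theorem_of_calculus ab) (use D in \<open>auto simp: has_real_derivative_iff_has_vector_derivative\<close>)
  then have "integral {a<..<b} f = F b - F a"
    using integral_open_interval_real[of a b f] by (simp add: integral_unique)
  moreover have "(LINT x|lebesgue_on {a<..<b}. f x) = integral {a<..<b} f"
    using lebesgue_integral_eq_integral[OF i] by simp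
  ultimately show "(LINT x|lebesgue_on {a<..<b}. f x) = F b - F a" by simp
qed

lemma continuous_antiderivative:
  fixes f :: "real \<Rightarrow> real"
  assumes "continuous_on UNIV f"
  obtains F where "\<And>x. (F has_real_derivative f x) (at x)"
proof
  fix x :: real
  let ?a = "- \<bar>x\<bar> - 1" and ?b = "\<bar>x\<bar> + 1"
  have "((\<lambda>u. interval_lebesgue_integral lborel (ereal 0) (ereal u) f) has_vector_derivative f x) (at x within {?a..?b})"
    using assms by (intro interval_integral_FTC2) (auto intro: continuous_on_subset)
  moreover have "at x within {?a..?b} = at x" by (rule at_within_interior) auto
  ultimately show "((\<lambda>u. interval_lebesgue_integral lborel (ereal 0) (ereal u) f) has_real_derivative f x) (at x)"
    by (simp add: has_real_derivative_iff_has_vector_derivative)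
qed

lemma C_k_antiderivative:
  fixes F f :: "real \<Rightarrow> real"
  assumes "\<And>x. (F has_real_derivative f x) (at x)" "\<And>k. C_k k f" shows "C_k k F"
proof (cases k)
  case 0
  have "continuous_on UNIV F" using assms(1) by (meson DERIV_isCont continuous_at_imp_continuous_on)
  then show ?thesis using 0 by simp
next
  case (Suc m)
  have "\<forall>x. GDERIV F x :> f x" using assms(1) by simp
  moreover have "\<forall>b\<in>Basis. C_k m (\<lambda>x. f x \<bullet> b)" using assms(2) by simp
  ultimately show ?thesis unfolding Suc C_k.simps by blast
qed

lemma test_fun_support_interval:
  fixes \<phi> :: "real \<Rightarrow> real"
  assumes "test_fun {0<..<T} \<phi>" "0 < T"
  obtains a b where "0 < a" "a \<le> b" "b < T" "\<And>x. x \<notin> {a..b} \<Longrightarrow> \<phi> x = 0"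
proof -
  let ?K = "closure {x. \<phi> x \<noteq> 0}"
  have K: "compact ?K" "?K \<subseteq> {0<..<T}" using assms(1) by (auto simp: test_fun_def)
  show thesis
  proof (cases "?K = {}")
    case True
    then have "\<phi> x = 0" for x by auto
    then show thesis using that[of "T/2" "T/2"] assms(2) by auto
  next
    case False
    obtain a where a: "a \<in> ?K" "\<And>x. x \<in> ?K \<Longrightarrow> a \<le> x" using compact_attains_inf[OF K(1) False] by blast
    obtain b where b: "b \<in> ?K" "\<And>x. x \<in> ?K \<Longrightarrow> x \<le> b" using compact_attains_sup[OF K(1) False] by blast
    have "\<phi> x = 0" if "x \<notin> {a..b}" for x
      using a(2)[of x] b(2)[of x] that subsetD[OF closure_subset, of x "{x. \<phi> x \<noteq> 0}"] by auto
    moreover have "0 < a" "a \<le> b" "b < T"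
      using subsetD[OF K(2) a(1)] subsetD[OF K(2) b(1)] a(2)[OF b(1)] by auto
    ultimately show thesis by (intro that[of a b])
  qed
qed

text \<open>A primitive is constant on either side of the support of \<kappa>. Vanishing mean makes
  both constants zero, so the primitive is compactly supported again.\<close>

lemma test_fun_antiderivative:
  fixes \<kappa> :: "real \<Rightarrow> real"
  assumes k: "test_fun {0<..<T} \<kappa>" and T: "0 < T" and 0: "(LINT t|lebesgue_on {0<..<T}. \<kappa> t) = 0"
  obtains \<theta> where "test_fun {0<..<T} \<theta>" "\<And>x. (\<theta> has_real_derivative \<kappa> x) (at x)"
proof -
  have c: "continuous_on UNIV \<kappa>" by (rule test_fun_continuous[OF k])
  obtain F where F: "\<And>x. (F has_real_derivative \<kappa> x) (at x)" using continuous_antiderivative[OF c] by blast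
  define \<theta> where "\<theta> x = F x - F 0" for x
  have D: "(\<theta> has_real_derivative \<kappa> x) (at x)" for x unfolding \<theta>_def using F[of x] by (auto intro!: derivative_eq_intros)
  obtain a b where ab: "0 < a" "a \<le> b" "b < T" "\<And>x. x \<notin> {a..b} \<Longrightarrow> \<kappa> x = 0"
    using test_fun_support_interval[OF k T] by blast
  have "\<theta> T - \<theta> 0 = 0"
    using integral_deriv_interval(2)[of 0 T \<kappa> \<theta>] T 0 c D
    by (auto intro: continuous_on_subset has_field_derivative_at_within)
  then have T0: "\<theta> T = 0" "\<theta> 0 = 0" by (auto simp: \<theta>_def)
  have const: "\<theta> x = \<theta> y" if "x \<le> y" "y < a \<or> b < x" for x y
  proof (cases "x = y")
    case False
    have "\<exists>z. x < z \<and> z < y \<and> \<theta> y - \<theta> x = (y - x) * \<kappa> z"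
      using that False D by (intro MVT2) auto
    then obtain z where "x < z" "z < y" "\<theta> y - \<theta> x = (y - x) * \<kappa> z" by blast
    moreover have "\<kappa> z = 0" using that \<open>x < z\<close> \<open>z < y\<close> by (intro ab(4)) auto
    ultimately show ?thesis by simp
  qed simp
  have out: "\<theta> x = 0" if "x \<notin> {a..b}" for x
  proof (cases "x < a")
    case True
    then show ?thesis using const[of x 0] const[of 0 x] ab T0 by (cases "x \<le> 0") auto
  next
    case False
    then have "b < x" using that by auto
    then show ?thesis using const[of x T] const[of T x] ab T0 by (cases "x \<le> T") auto
  qed
  have sub: "closure {x. \<theta> x \<noteq> 0} \<subseteq> {a..b}"
  proof (rule closure_minimal)
    show "{x. \<theta> x \<noteq> 0} \<subseteq> {a..b}" using out by blast
  qed simp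
  then have "compact (closure {x. \<theta> x \<noteq> 0})" using bounded_subset[OF bounded_closed_interval[of a b]]
    by (simp add: compact_eq_bounded_closed)
  moreover have "C_k k \<theta>" for k using k by (intro C_k_antiderivative[OF D]) (auto simp: test_fun_def)
  ultimately have "test_fun {0<..<T} \<theta>" using sub ab unfolding test_fun_def by auto
  then show thesis using D by (rule that)
qed

section \<open>Primitives of integrable functions on (0, T)\<close>

locale time_interval =
  fixes T :: real assumes T_pos: "0 < T"
begin

abbreviation I :: "real measure" where "I \<equiv> lebesgue_on {0<..<T}"

lemma finite_measure_I: "finite_measure I"
  by (intro finite_measure_lebesgue_on) auto

lemma complete_measure_I: "complete_measure I"
  by (intro complete_measure_lebesgue_on) auto

sublocale I: finite_measure I by (rule finite_measure_I)
sublocale I: complete_measure I by (rule complete_measure_I)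
sublocale II: pair_sigma_finite I I ..

lemma continuous_measurable_I: "continuous_on UNIV f \<Longrightarrow> f \<in> borel_measurable I" for f :: "real \<Rightarrow> real"
  by (rule continuous_measurable_lebesgue_on) auto

lemma borel_measurable_I: "f \<in> borel_measurable borel \<Longrightarrow> f \<in> borel_measurable I" for f :: "real \<Rightarrow> 'b::topological_space"
  by (intro measurable_restrict_space1 measurable_completion) auto

lemma ident_measurable_I [measurable]: "(\<lambda>x. x) \<in> borel_measurable I"
  by (rule borel_measurable_I) auto

text \<open>The upper limit sits in an indicator, so all times share one measure and Fubini applies
  directly. The function is total: it is 0 for t \<le> 0, which later gives the value 0 to a delayed
  primitive before time \<tau>.\<close>

definition prim :: "(real \<Rightarrow> real) \<Rightarrow> real \<Rightarrow> real" where
  "prim h t = (LINT s|I. indicator {..<t} s * h s)"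

lemma ind_mult_integrable: "integrable I h \<Longrightarrow> integrable I (\<lambda>s. indicator {..<t} s * h s)" for h :: "real \<Rightarrow> real" and t :: real
  by (rule integrable_bounded_mult[where B=1]) (auto simp: indicator_def intro!: borel_measurable_I)

lemma product_integrable:
  fixes p q :: "real \<Rightarrow> real"
  assumes p: "integrable I p" and q: "integrable I q"
  shows "integrable (I \<Otimes>\<^sub>M I) (\<lambda>x. p (fst x) * q (snd x))"
proof (rule II.Fubini_integrable)
  have [measurable]: "p \<in> borel_measurable I" "q \<in> borel_measurable I" using p q by auto
  show "(\<lambda>x. p (fst x) * q (snd x)) \<in> borel_measurable (I \<Otimes>\<^sub>M I)" by measurable
  show "integrable I (\<lambda>x. \<integral>y. norm (p (fst (x, y)) * q (snd (x, y))) \<partial>I)" using p q by (simp add: abs_mult)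
  show "AE x in I. integrable I (\<lambda>y. p (fst (x, y)) * q (snd (x, y)))" using q by simp
qed

lemma product_integrable_bounded:
  fixes K :: "real \<times> real \<Rightarrow> real"
  assumes p: "integrable I p" and q: "integrable I q" and K: "K \<in> borel_measurable (I \<Otimes>\<^sub>M I)"
    and B: "\<And>x. x \<in> space (I \<Otimes>\<^sub>M I) \<Longrightarrow> \<bar>K x\<bar> \<le> B"
  shows "integrable (I \<Otimes>\<^sub>M I) (\<lambda>x. K x * (p (fst x) * q (snd x)))"
  by (rule integrable_bounded_mult[OF product_integrable[OF p q] K B])

lemma ind_lt_measurable [measurable]: "(\<lambda>x. indicator {..<fst x} (snd x) :: real) \<in> borel_measurable (I \<Otimes>\<^sub>M I)"
proof -
  have "(\<lambda>x. if snd x < fst x then 1 else 0 :: real) \<in> borel_measurable (I \<Otimes>\<^sub>M I)" by measurable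
  then show ?thesis by (simp add: indicator_def of_bool_def lessThan_def)
qed

text \<open>Fubini on the triangle s < t. It takes the place of integration by parts when q is
  merely integrable.\<close>

lemma prim_swap:
  assumes p: "integrable I p" and q: "integrable I q"
  shows "(LINT t|I. p t * prim q t) = (LINT s|I. q s * (LINT t|I. indicator {s<..} t * p t))"
    and "integrable I (\<lambda>t. p t * prim q t)"
proof -
  let ?K = "\<lambda>t s. indicator {..<t} s * (p t * q s) :: real"
  have K: "integrable (I \<Otimes>\<^sub>M I) (case_prod ?K)"
    using product_integrable_bounded[OF p q ind_lt_measurable, of 1] by (simp add: split_beta')
  have e: "(LINT s|I. ?K t s) = p t * prim q t" for t
    unfolding prim_def by (subst integral_mult_right_zero[symmetric]) (simp add: ac_simps)
  have "(LINT t|I. (LINT s|I. ?K t s)) = (LINT s|I. (LINT t|I. ?K t s))"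
    using II.Fubini_integral[OF K] by simp
  also have "\<dots> = (LINT s|I. q s * (LINT t|I. indicator {s<..} t * p t))"
    by (subst integral_mult_right_zero[symmetric])
      (intro Bochner_Integration.integral_cong refl, auto simp: indicator_def)
  finally show "(LINT t|I. p t * prim q t) = (LINT s|I. q s * (LINT t|I. indicator {s<..} t * p t))" by (simp add: e)
  show "integrable I (\<lambda>t. p t * prim q t)" using II.integrable_fst'[OF K] by (simp add: e)
qed

lemma prim_integrable: "integrable I q \<Longrightarrow> integrable I (prim q)"
  using prim_swap(2)[of "\<lambda>_. 1" q] by simp

lemma integral_ind_lt:
  assumes "0 \<le> t" "t \<le> T"
  shows "prim h t = (LINT s|lebesgue_on {0<..<t}. h s)"
proof -
  have "prim h t = (LINT s|lebesgue. indicator {0<..<T} s * (indicator {..<t} s * h s))"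
    unfolding prim_def by (rule lebesgue_on_integral_eq) auto
  also have "\<dots> = (LINT s|lebesgue. indicator {0<..<t} s * h s)"
    using assms by (intro Bochner_Integration.integral_cong) (auto simp: indicator_def)
  also have "\<dots> = (LINT s|lebesgue_on {0<..<t}. h s)" by (rule lebesgue_on_integral_eq[symmetric]) auto
  finally show ?thesis .
qed

lemma integral_ind_gt:
  fixes h :: "real \<Rightarrow> real"
  assumes "0 \<le> t" "t \<le> T"
  shows "(LINT s|I. indicator {t<..} s * h s) = (LINT s|lebesgue_on {t<..<T}. h s)"
proof -
  have "(LINT s|I. indicator {t<..} s * h s) = (LINT s|lebesgue. indicator {0<..<T} s * (indicator {t<..} s * h s))"
    by (rule lebesgue_on_integral_eq) auto
  also have "\<dots> = (LINT s|lebesgue. indicator {t<..<T} s * h s)"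
    using assms by (intro Bochner_Integration.integral_cong) (auto simp: indicator_def)
  also have "\<dots> = (LINT s|lebesgue_on {t<..<T}. h s)" by (rule lebesgue_on_integral_eq[symmetric]) auto
  finally show ?thesis .
qed

lemma bounded_mult_I:
  fixes f :: "real \<Rightarrow> real"
  assumes "integrable I f" "test_fun S \<phi>" shows "integrable I (\<lambda>t. \<phi> t * f t)"
proof -
  obtain B where "\<And>x. \<bar>\<phi> x\<bar> \<le> B" using test_fun_bounded[OF assms(2)] by blast
  then show ?thesis
    by (intro integrable_bounded_mult[OF assms(1) continuous_measurable_I[OF test_fun_continuous[OF assms(2)]]])
qed

lemma test_fun_integrable: "test_fun S \<phi> \<Longrightarrow> integrable I \<phi>" for \<phi> :: "real \<Rightarrow> real"
  using bounded_mult_I[of "\<lambda>_. 1" S \<phi>] by simp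

lemma prim_test_deriv:
  assumes h: "integrable I h" and t: "test_fun {0<..<T} \<theta>" and D: "\<And>x. (\<theta> has_real_derivative \<kappa> x) (at x)" and k: "test_fun S \<kappa>"
  shows "(LINT t|I. \<kappa> t * prim h t) = - (LINT t|I. \<theta> t * h t)"
proof -
  have "(LINT t|I. \<kappa> t * prim h t) = (LINT s|I. h s * (LINT t|I. indicator {s<..} t * \<kappa> t))"
    by (rule prim_swap(1)[OF test_fun_integrable[OF k] h])
  also have "\<dots> = (LINT s|I. h s * (- \<theta> s))"
  proof (intro Bochner_Integration.integral_cong refl)
    fix s assume "s \<in> space I"
    then have s: "0 < s" "s < T" by auto
    have "(LINT t|I. indicator {s<..} t * \<kappa> t) = \<theta> T - \<theta> s"
      using s integral_deriv_interval(2)[of s T \<kappa> \<theta>] test_fun_continuous[OF k] D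
      by (subst integral_ind_gt) (auto intro: continuous_on_subset has_field_derivative_at_within)
    moreover have "\<theta> T = 0" using test_fun_zero_outside[OF t] by simp
    ultimately show "h s * (LINT t|I. indicator {s<..} t * \<kappa> t) = h s * (- \<theta> s)" by simp
  qed
  finally show ?thesis by (simp add: mult.commute)
qed

text \<open>A test function becomes the derivative of a test function once a multiple of a fixed
  bump has corrected its mean to 0. Hence f minus the primitive of h, less a constant, is orthogonal
  to all test functions.\<close>

lemma du_Bois_Reymond:
  assumes f: "integrable I f" and h: "integrable I h"
    and weak: "\<And>\<theta>. test_fun {0<..<T} \<theta> \<Longrightarrow> (LINT t|I. deriv \<theta> t * f t) = - (LINT t|I. \<theta> t * h t)"
  obtains C where "AE t in I. f t = C + prim h t"
proof -
  let ?b = "box_bump 1 (T/4) (3*T/4)"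
  have bt: "test_fun {0<..<T} ?b" using T_pos by (intro test_fun_box_bump) (auto simp: cbox_interval)
  define m where "m = (LINT t|I. ?b t)"
  have "m \<noteq> 0"
  proof
    assume "m = 0"
    moreover have "AE t in I. 0 \<le> ?b t" using box_bump_bounds[of 1] by (intro AE_I2) auto
    ultimately have "AE t in I. ?b t = 0"
      unfolding m_def using integral_nonneg_eq_0_iff_AE[OF test_fun_integrable[OF bt]] by simp
    then have "AE t in I. t \<notin> box (T/4) (3*T/4)"
      by eventually_elim (use box_bump_pos_iff in blast)
    then have "AE t in lebesgue. t \<notin> box (T/4) (3*T/4)"
      using T_pos by (subst (asm) AE_restrict_space_iff) (auto elim!: eventually_mono simp: box_real)
    then have "box (T/4) (3*T/4) \<in> null_sets lebesgue"
      by (subst (asm) AE_iff_null_sets[symmetric]) auto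
    then show False using T_pos by (auto simp: null_sets_def box_real emeasure_lborel_box_eq)
  qed
  \<comment> \<open>The weight \<open>?b t / m\<close> has integral 1, so C is the value which the
    difference must have if it is constant.\<close>
  define C where "C = (LINT t|I. (f t - prim h t) * (?b t / m))"
  let ?F = "\<lambda>t. f t - prim h t"
  have Fi: "integrable I ?F" using f prim_integrable[OF h] by auto
  have "AE t in I. ?F t - C = 0"
  proof (rule fundamental_lemma)
    show "integrable I (\<lambda>t. ?F t - C)" using Fi by auto
    fix \<xi> assume ch: "test_fun {0<..<T} \<xi>"
    define c where "c = (LINT t|I. \<xi> t)"
    let ?k = "\<lambda>x. 1 * \<xi> x + (- c / m) * ?b x"
    have kt: "test_fun {0<..<T} ?k" by (rule test_fun_lin[OF ch bt])
    have "(LINT t|I. ?k t) = c + (- c / m) * m"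
      using test_fun_integrable[OF ch] test_fun_integrable[OF bt] unfolding c_def m_def by simp
    then have "(LINT t|I. ?k t) = 0" using \<open>m \<noteq> 0\<close> by simp
    then obtain \<theta> where th: "test_fun {0<..<T} \<theta>" "\<And>x. (\<theta> has_real_derivative ?k x) (at x)"
      using test_fun_antiderivative[OF kt T_pos] by blast
    have dth: "deriv \<theta> = ?k" using th(2) by (intro ext DERIV_imp_deriv)
    have "(LINT t|I. ?k t * ?F t) = (LINT t|I. ?k t * f t) - (LINT t|I. ?k t * prim h t)"
      unfolding right_diff_distrib
      by (rule Bochner_Integration.integral_diff[OF bounded_mult_I[OF f kt] bounded_mult_I[OF prim_integrable[OF h] kt]])
    also have "\<dots> = 0" using weak[OF th(1)] prim_test_deriv[OF h th kt] unfolding dth by simp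
    finally have z: "(LINT t|I. ?k t * ?F t) = 0" .
    have Ce: "C = (LINT t|I. ?b t * ?F t) / m"
      unfolding C_def by (subst integral_divide_zero[symmetric]) (simp add: mult.commute)
    have i1: "integrable I (\<lambda>t. \<xi> t * ?F t)" by (rule bounded_mult_I[OF Fi ch])
    have i2: "integrable I (\<lambda>t. ?b t * ?F t)" by (rule bounded_mult_I[OF Fi bt])
    have "(LINT t|I. \<xi> t * (?F t - C)) = (LINT t|I. \<xi> t * ?F t) - c * C"
      unfolding c_def right_diff_distrib[of _ "?F _" C] using i1 test_fun_integrable[OF ch] by (simp add: Bochner_Integration.integral_diff)
    also have "c * C = (c / m) * (LINT t|I. ?b t * ?F t)" unfolding Ce by simp
    also have "(LINT t|I. \<xi> t * ?F t) - (c / m) * (LINT t|I. ?b t * ?F t) = (LINT t|I. \<xi> t * ?F t - (c / m) * (?b t * ?F t))"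
      using i1 i2 by (simp add: Bochner_Integration.integral_diff)
    also have "\<dots> = (LINT t|I. ?k t * ?F t)"
      by (intro Bochner_Integration.integral_cong) (auto simp: algebra_simps diff_divide_distrib)
    finally show "(LINT t|I. \<xi> t * (?F t - C)) = 0" using z by simp
  qed auto
  then have "AE t in I. f t = C + prim h t" by eventually_elim simp
  then show thesis by (rule that)
qed

lemma prim_diff:
  assumes h: "integrable I h" and t: "s \<le> t"
  shows "prim h t - prim h s = (LINT r|I. indicator {s..<t} r * h r)"
proof -
  have "prim h t - prim h s = (LINT r|I. indicator {..<t} r * h r - indicator {..<s} r * h r)"
    unfolding prim_def by (rule Bochner_Integration.integral_diff[symmetric]) (intro ind_mult_integrable h)+
  also have "\<dots> = (LINT r|I. indicator {s..<t} r * h r)"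
    using t by (intro Bochner_Integration.integral_cong) (auto simp: indicator_def)
  finally show ?thesis .
qed

lemma prim_abs_diff_le:
  assumes h: "integrable I h" and b: "\<And>r. r \<in> {0<..<T} \<Longrightarrow> \<bar>h r\<bar> \<le> B r" and B: "integrable I B"
  shows "\<bar>prim h t - prim h s\<bar> \<le> \<bar>prim B t - prim B s\<bar>"
proof -
  have *: "\<bar>prim h t - prim h s\<bar> \<le> prim B t - prim B s" if "s \<le> t" for s t
  proof -
    have i: "integrable I (\<lambda>r. indicator {s..<t} r * B r)" "integrable I (\<lambda>r. indicator {s..<t} r * h r)"
      using h B by (auto intro!: integrable_bounded_mult[where B=1] borel_measurable_I simp: indicator_def)
    have "\<bar>prim h t - prim h s\<bar> \<le> (LINT r|I. \<bar>indicator {s..<t} r * h r\<bar>)"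
      unfolding prim_diff[OF h that] by (rule integral_abs_bound)
    also have "\<dots> \<le> (LINT r|I. indicator {s..<t} r * B r)"
      using i b by (intro integral_mono integrable_abs) (auto simp: indicator_def)
    also have "\<dots> = prim B t - prim B s" by (rule prim_diff[OF B that, symmetric])
    finally show ?thesis .
  qed
  show ?thesis
  proof (cases "s \<le> t")
    case True
    then show ?thesis using *[of s t] by linarith
  next
    case False
    then show ?thesis using *[of t s] by linarith
  qed
qed

lemma prim_continuous:
  assumes h: "integrable I h" shows "continuous_on UNIV (prim h)"
proof (rule continuous_at_imp_continuous_on, rule ballI)
  fix t :: real
  have "((\<lambda>s. prim h s) \<longlongrightarrow> prim h t) (at t)"
    unfolding prim_def
  proof (rule tendsto_at_iff_sequentially[THEN iffD2], intro allI impI, unfold comp_def)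
    fix X :: "nat \<Rightarrow> real" assume X: "X \<longlonglongrightarrow> t"
    show "(\<lambda>n. LINT s|I. indicator {..<X n} s * h s) \<longlonglongrightarrow> (LINT s|I. indicator {..<t} s * h s)"
    proof (rule integral_dominated_convergence[where w="\<lambda>s. \<bar>h s\<bar>"])
      have "AE s in lborel. s \<noteq> t" by (rule AE_lborel_singleton)
      then have "AE s in lebesgue. s \<noteq> t" by (rule AE_completion)
      then have "AE s in I. s \<noteq> t" by (subst AE_restrict_space_iff) (auto elim: eventually_mono)
      then show "AE s in I. (\<lambda>n. indicator {..<X n} s * h s) \<longlonglongrightarrow> indicator {..<t} s * h s"
      proof eventually_elim
        case (elim s)
        have "eventually (\<lambda>n. indicator {..<X n} s * h s = indicator {..<t} s * h s) sequentially"
        proof (cases "s < t")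
          case True
          show ?thesis using order_tendstoD(1)[OF X True] by eventually_elim (use True in auto)
        next
          case False
          then have "t < s" using elim by simp
          show ?thesis using order_tendstoD(2)[OF X \<open>t < s\<close>] by eventually_elim (use \<open>t < s\<close> in auto)
        qed
        then show ?case by (rule tendsto_eventually)
      qed
      show "(\<lambda>s. indicator {..<t} s * h s) \<in> borel_measurable I" "(\<lambda>s. indicator {..<X n} s * h s) \<in> borel_measurable I" for n
        using ind_mult_integrable[OF h] by auto
      show "AE s in I. norm (indicator {..<X n} s * h s) \<le> \<bar>h s\<bar>" for n by (intro AE_I2) (auto simp: indicator_def)
    qed (use h in auto)
  qed
  then show "isCont (prim h) t" by (simp add: isCont_def)
qed

lemma prim_0: "t \<le> 0 \<Longrightarrow> prim h t = 0"
  unfolding prim_def by (rule integral_eq_zero_AE) (auto intro!: AE_I2 simp: indicator_def)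

lemma prim_lin: "integrable I f \<Longrightarrow> integrable I h \<Longrightarrow> prim (\<lambda>t. a * f t + b * h t) t = a * prim f t + b * prim h t"
proof -
  assume f: "integrable I f" and h: "integrable I h"
  have "prim (\<lambda>t. a * f t + b * h t) t = (LINT s|I. a * (indicator {..<t} s * f s) + b * (indicator {..<t} s * h s))"
    unfolding prim_def by (intro Bochner_Integration.integral_cong) (auto simp: algebra_simps)
  then show ?thesis unfolding prim_def using ind_mult_integrable[OF f, of t] ind_mult_integrable[OF h, of t] by simp
qed

lemma prim_cong_AE:
  assumes "AE s in I. f s = h s" "integrable I f" "integrable I h" shows "prim f t = prim h t"
  unfolding prim_def using assms(1) ind_mult_integrable[OF assms(2), of t] ind_mult_integrable[OF assms(3), of t]
  by (intro integral_cong_AE) auto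

text \<open>An interval of positive length is not a null set, so sets of full measure are dense.
  This is how almost everywhere statements meet continuity.\<close>

lemma AE_I_dense:
  assumes "AE t in I. P t" "0 \<le> a" "a < b" "b \<le> T" obtains t where "a < t" "t < b" "P t"
proof -
  have "AE t in lebesgue. t \<in> {0<..<T} \<longrightarrow> P t" using assms(1) by (subst (asm) AE_restrict_space_iff) auto
  then obtain N where N: "N \<in> null_sets lebesgue" "{t. \<not> (t \<in> {0<..<T} \<longrightarrow> P t)} \<subseteq> N"
    by (auto simp: eventually_ae_filter)
  have "\<not> {a<..<b} \<subseteq> N"
  proof
    assume "{a<..<b} \<subseteq> N"
    then have "{a<..<b} \<in> null_sets lebesgue" using N(1) completion.complete2 by blast
    then show False using assms(3) by (auto simp: null_sets_def)
  qed
  then obtain t where "t \<in> {a<..<b}" "t \<notin> N" by blast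
  then have t: "a < t" "t < b" "t \<notin> N" by auto
  then have "t \<in> {0<..<T}" using assms(2,4) by auto
  then have "P t" using N(2) t(3) by blast
  then show thesis using that[of t] t by simp
qed

end

section \<open>Completeness of the Lebesgue space and weak time derivatives\<close>

lemma (in complete_measure) integral_cong_AE_complete:
  fixes f g :: "'a \<Rightarrow> real"
  assumes f: "integrable M f" and eq: "AE x in M. f x = g x"
  shows "integrable M g" "integral\<^sup>L M g = integral\<^sup>L M f"
proof -
  have g: "g \<in> borel_measurable M" by (rule borel_measurable_AE_cong[OF _ eq]) (use f in auto)
  show "integrable M g" by (rule integrable_cong_AE_imp[OF f g eq])
  have eq': "AE x in M. g x = f x" using eq by eventually_elim simp
  show "integral\<^sup>L M g = integral\<^sup>L M f" by (rule integral_cong_AE[OF g _ eq']) (use f in auto)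
qed

context bounded_open begin

lemma L2_abs: "f \<in> L2 \<Omega> \<Longrightarrow> (\<lambda>x. \<bar>f x\<bar>) \<in> L2 \<Omega>" for f :: "'a \<Rightarrow> real"
  by (auto simp: L2_def)

lemma L1_le_L2:
  fixes f :: "'a \<Rightarrow> real" assumes f: "f \<in> L2 \<Omega>"
  shows "(LINT x|lebesgue_on \<Omega>. \<bar>f x\<bar>) \<le> L2_norm \<Omega> (\<lambda>x. 1::real) * L2_norm \<Omega> f"
proof -
  have 1: "(\<lambda>x. 1::real) \<in> L2 \<Omega>" by (rule bounded_continuous_L2[where B=1]) auto
  have "L2_norm \<Omega> (\<lambda>x. \<bar>f x\<bar>) = L2_norm \<Omega> f" by (simp add: L2_norm_def L2_inner_def)
  moreover have "(LINT x|lebesgue_on \<Omega>. \<bar>f x\<bar>) = L2_inner \<Omega> (\<lambda>x. 1) (\<lambda>x. \<bar>f x\<bar>)" by (simp add: L2_inner_def)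
  ultimately show ?thesis
    using L2i.Cauchy_Schwarz[OF 1 L2_abs[OF f]] by (simp add: L2i_nrm)
qed

lemma nn_integral_L2_sq:
  fixes f :: "'a \<Rightarrow> real" assumes f: "f \<in> L2 \<Omega>"
  shows "(\<integral>\<^sup>+x. ennreal ((f x)\<^sup>2) \<partial>lebesgue_on \<Omega>) = ennreal ((L2_norm \<Omega> f)\<^sup>2)"
proof -
  have "integrable (lebesgue_on \<Omega>) (\<lambda>x. (f x)\<^sup>2)" using f by (simp add: L2_def)
  then have "(\<integral>\<^sup>+x. ennreal ((f x)\<^sup>2) \<partial>lebesgue_on \<Omega>) = ennreal (LINT x|lebesgue_on \<Omega>. (f x)\<^sup>2)"
    by (rule nn_integral_eq_integral) simp
  also have "(LINT x|lebesgue_on \<Omega>. (f x)\<^sup>2) = (L2_norm \<Omega> f)\<^sup>2"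
    unfolding L2_norm_def real_sqrt_pow2[OF L2_inner_nonneg] by (simp add: L2_inner_def power2_eq_square)
  finally show ?thesis .
qed

text \<open>Riesz-Fischer. Along a fast subsequence the increments are summable in
  \<open>L2\<close>, hence in the mean because \<Omega> has finite measure, which yields a pointwise
  limit almost everywhere; Fatou then gives convergence in norm.\<close>

theorem L2_complete:
  fixes f :: "nat \<Rightarrow> 'a \<Rightarrow> real"
  assumes f: "\<And>n. f n \<in> L2 \<Omega>"
    and C: "\<And>e. 0 < e \<Longrightarrow> \<exists>N. \<forall>m\<ge>N. \<forall>n\<ge>N. L2_norm \<Omega> (\<lambda>x. f m x - f n x) < e"
  obtains g where "g \<in> L2 \<Omega>" "(\<lambda>n. L2_norm \<Omega> (\<lambda>x. f n x - g x)) \<longlonglongrightarrow> 0"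
proof -
  let ?M = "lebesgue_on \<Omega>"
  note fm [measurable] = L2_meas[OF f]
  have df: "(\<lambda>x. f m x - f n x) \<in> L2 \<Omega>" for m n by (rule L2i.diff_mem[OF f f])
  have "\<forall>k. \<exists>N. \<forall>m\<ge>N. \<forall>n\<ge>N. L2_norm \<Omega> (\<lambda>x. f m x - f n x) < (1/2)^k" using C by simp
  then obtain N where N: "\<forall>k. \<forall>m\<ge>N k. \<forall>n\<ge>N k. L2_norm \<Omega> (\<lambda>x. f m x - f n x) < (1/2)^k" by (rule choice[THEN exE])
  \<comment> \<open>Summing the thresholds makes r monotone, and adding k makes it
    unbounded.\<close>
  define r where "r k = (\<Sum>j\<le>k. N j) + k" for k
  have rN: "N k \<le> r k" "r k \<le> r (Suc k)" "k \<le> r k" for k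
    unfolding r_def using member_le_sum[of k "{..k}" N] by auto
  define a where "a k x = f (r (Suc k)) x - f (r k) x" for k x
  have a2: "a k \<in> L2 \<Omega>" for k unfolding a_def by (rule df)
  have am [measurable]: "a k \<in> borel_measurable ?M" for k by (rule L2_meas[OF a2])
  let ?K = "L2_norm \<Omega> (\<lambda>x. 1::real)"
  have K0: "0 \<le> ?K" by (simp add: L2_norm_def L2_inner_nonneg)
  have ia: "(\<integral>\<^sup>+x. ennreal \<bar>a k x\<bar> \<partial>?M) \<le> ennreal (?K * (1/2)^k)" for k
  proof -
    have "L2_norm \<Omega> (a k) \<le> (1/2)^k" using N rN[of k] unfolding a_def by (meson le_trans less_imp_le)
    then have "(LINT x|?M. \<bar>a k x\<bar>) \<le> ?K * (1/2)^k"
      using L1_le_L2[OF a2[of k]] mult_left_mono[OF _ K0] order_trans by blast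
    then show ?thesis
      using L2_integrable[OF a2[of k]] by (subst nn_integral_eq_integral) (auto intro: ennreal_leI)
  qed
  have "(\<integral>\<^sup>+x. (\<Sum>k. ennreal \<bar>a k x\<bar>) \<partial>?M) = (\<Sum>k. \<integral>\<^sup>+x. ennreal \<bar>a k x\<bar> \<partial>?M)"
    by (intro nn_integral_suminf) measurable
  also have "\<dots> \<le> (\<Sum>k. ennreal (?K * (1/2)^k))" by (intro suminf_le ia) auto
  also have "\<dots> = ennreal (\<Sum>k. ?K * (1/2)^k)"
    using K0 by (intro suminf_ennreal2) (auto intro!: summable_mult summable_geometric)
  also have "\<dots> < \<infinity>" by simp
  finally have "(\<integral>\<^sup>+x. (\<Sum>k. ennreal \<bar>a k x\<bar>) \<partial>?M) \<noteq> \<infinity>" by simp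
  then have "AE x in ?M. (\<Sum>k. ennreal \<bar>a k x\<bar>) \<noteq> \<infinity>" by (intro nn_integral_PInf_AE) measurable
  then have conv: "AE x in ?M. convergent (\<lambda>n. f (r n) x)"
  proof eventually_elim
    case (elim x)
    have "summable (\<lambda>k. \<bar>a k x\<bar>)" using elim by (intro summable_suminf_not_top) auto
    then have "summable (\<lambda>k. a k x)" by (rule summable_rabs_cancel)
    then have "convergent (\<lambda>n. \<Sum>k<n. a k x)" by (simp add: summable_iff_convergent)
    then have "convergent (\<lambda>n. f (r 0) x + (\<Sum>k<n. a k x))" by (intro convergent_add convergent_const)
    moreover have "f (r 0) x + (\<Sum>k<n. a k x) = f (r n) x" for n by (induction n) (auto simp: a_def)
    ultimately show ?case by simp
  qed
  define g where "g x = lim (\<lambda>n. f (r n) x)" for x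
  have gm [measurable]: "g \<in> borel_measurable ?M" unfolding g_def by (intro borel_measurable_lim_metric fm)
  have glim: "AE x in ?M. (\<lambda>n. f (r n) x) \<longlonglongrightarrow> g x"
    using conv by eventually_elim (simp add: g_def convergent_LIMSEQ_iff)
  \<comment> \<open>Fatou is applied along the subsequence with m fixed. The Cauchy property for
    arbitrary m makes the whole sequence converge, not only the subsequence.\<close>
  have bound: "(\<integral>\<^sup>+x. ennreal ((f m x - g x)\<^sup>2) \<partial>?M) \<le> ennreal (e\<^sup>2)"
    if e: "0 < e" and n0: "\<forall>m\<ge>n0. \<forall>n\<ge>n0. L2_norm \<Omega> (\<lambda>x. f m x - f n x) < e" and m: "m \<ge> n0" for m n0 e
  proof -
    have "(\<integral>\<^sup>+x. ennreal ((f m x - g x)\<^sup>2) \<partial>?M) = (\<integral>\<^sup>+x. liminf (\<lambda>n. ennreal ((f m x - f (r n) x)\<^sup>2)) \<partial>?M)"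
    proof (rule nn_integral_cong_AE)
      show "AE x in ?M. ennreal ((f m x - g x)\<^sup>2) = liminf (\<lambda>n. ennreal ((f m x - f (r n) x)\<^sup>2))"
        using glim
      proof eventually_elim
        case (elim x)
        have "(\<lambda>n. ennreal ((f m x - f (r n) x)\<^sup>2)) \<longlonglongrightarrow> ennreal ((f m x - g x)\<^sup>2)"
          by (intro tendsto_ennrealI tendsto_intros elim)
        then show ?case by (intro lim_imp_Liminf[symmetric]) simp_all
      qed
    qed
    also have "\<dots> \<le> liminf (\<lambda>n. \<integral>\<^sup>+x. ennreal ((f m x - f (r n) x)\<^sup>2) \<partial>?M)"
      by (rule nn_integral_liminf) measurable
    also have "\<dots> \<le> limsup (\<lambda>n. \<integral>\<^sup>+x. ennreal ((f m x - f (r n) x)\<^sup>2) \<partial>?M)"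
      by (rule Liminf_le_Limsup) simp
    also have "\<dots> \<le> ennreal (e\<^sup>2)"
    proof (rule Limsup_bounded)
      show "\<forall>\<^sub>F n in sequentially. (\<integral>\<^sup>+x. ennreal ((f m x - f (r n) x)\<^sup>2) \<partial>?M) \<le> ennreal (e\<^sup>2)"
        using eventually_ge_at_top[of n0]
      proof eventually_elim
        case (elim n)
        have "L2_norm \<Omega> (\<lambda>x. f m x - f (r n) x) < e" using n0 m elim rN(3)[of n] by auto
        moreover have "0 \<le> L2_norm \<Omega> (\<lambda>x. f m x - f (r n) x)" by (simp add: L2_norm_def L2_inner_nonneg)
        ultimately show ?case unfolding nn_integral_L2_sq[OF df] by (intro ennreal_leI power_mono) auto
      qed
    qed
    finally show ?thesis .
  qed
  have dg: "(\<lambda>x. f m x - g x) \<in> L2 \<Omega>"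
    if "0 < e" "\<forall>m\<ge>n0. \<forall>n\<ge>n0. L2_norm \<Omega> (\<lambda>x. f m x - f n x) < e" "m \<ge> n0" for m n0 e
  proof -
    have "integrable ?M (\<lambda>x. (f m x - g x)\<^sup>2)"
      using le_less_trans[OF bound[OF that]] by (intro integrableI_bounded) auto
    then show ?thesis unfolding L2_def by simp
  qed
  obtain n1 where n1: "\<forall>m\<ge>n1. \<forall>n\<ge>n1. L2_norm \<Omega> (\<lambda>x. f m x - f n x) < 1" using C[of 1] by auto
  have "(\<lambda>x. f n1 x - g x) \<in> L2 \<Omega>" by (rule dg[OF _ n1]) auto
  from L2i.diff_mem[OF f[of n1] this] have g2: "g \<in> L2 \<Omega>" by simp
  moreover have "(\<lambda>n. L2_norm \<Omega> (\<lambda>x. f n x - g x)) \<longlonglongrightarrow> 0"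
  proof (rule LIMSEQ_I)
    fix e :: real assume "0 < e"
    then have e2: "0 < e / 2" by simp
    obtain n0 where n0: "\<forall>m\<ge>n0. \<forall>n\<ge>n0. L2_norm \<Omega> (\<lambda>x. f m x - f n x) < e / 2" using C[OF e2] by blast
    have "norm (L2_norm \<Omega> (\<lambda>x. f m x - g x) - 0) < e" if m: "m \<ge> n0" for m
    proof -
      have nn: "0 \<le> L2_norm \<Omega> (\<lambda>x. f m x - g x)" by (simp add: L2_norm_def L2_inner_nonneg)
      have "ennreal ((L2_norm \<Omega> (\<lambda>x. f m x - g x))\<^sup>2) \<le> ennreal ((e/2)\<^sup>2)"
        using bound[OF e2 n0 m] unfolding nn_integral_L2_sq[OF dg[OF e2 n0 m]] .
      then have "(L2_norm \<Omega> (\<lambda>x. f m x - g x))\<^sup>2 \<le> (e/2)\<^sup>2" by (simp add: ennreal_le_iff)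
      then have "L2_norm \<Omega> (\<lambda>x. f m x - g x) \<le> e / 2" by (rule power2_le_imp_le) (use e2 in linarith)
      then show ?thesis using nn \<open>0 < e\<close> by simp
    qed
    then show "\<exists>no. \<forall>n\<ge>no. norm (L2_norm \<Omega> (\<lambda>x. f n x - g x) - 0) < e" by blast
  qed
  ultimately show thesis by (rule that)
qed

end

section \<open>Weak time derivatives through scalar pairings\<close>

locale evolution = bounded_open \<Omega> + time_interval T for \<Omega> :: "'a::euclidean_space set" and T :: real
begin

lemma regularize_L2:
  assumes "u \<in> L2_Bochner 0 T (L2 \<Omega>) (L2_norm \<Omega>)"
  obtains u' s B where "L2i.regular \<Omega> I u' s B" "AE t in I. u' t = u t"
proof -
  have 1: "strongly_measurable I (L2 \<Omega>) (L2i.nrm \<Omega>) u" and 2: "integrable I (\<lambda>t. (L2i.nrm \<Omega> (u t))\<^sup>2)"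
    using assms by (simp_all add: L2_Bochner_def L2i_nrm)
  show thesis by (rule L2i.regularize[OF finite_measure_I 1 2]) (rule that)
qed

lemma regularize_H01:
  assumes "u \<in> L2_Bochner 0 T (H01 \<Omega>) (H1_norm \<Omega>)"
  obtains u' s B where "H01s.regular I u' s B" "AE t in I. u' t = u t"
proof -
  have e: "H01s.nrm = H1_norm \<Omega>" by (rule ext) (rule H01s_nrm)
  have 1: "strongly_measurable I (H01 \<Omega>) H01s.nrm u" and 2: "integrable I (\<lambda>t. (H01s.nrm (u t))\<^sup>2)"
    unfolding e using assms by (simp_all add: L2_Bochner_def)
  show thesis by (rule H01s.regularize[OF finite_measure_I 1 2]) (rule that)
qed

text \<open>The approximations obtained for the full Sobolev norm serve every weaker seminorm, so
  one regularisation of z can be used both in \<open>L2\<close> pairings and in the Dirichlet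
  form.\<close>

lemma regular_H01_L2:
  assumes "H01s.regular I u s B" shows "L2i.regular \<Omega> I u s B"
proof -
  have N: "L2_norm \<Omega> f \<le> H01s.nrm f" if "f \<in> H01 \<Omega>" for f
    using L2_norm_le_H1_norm[OF H01_H1[OF that]] by (simp add: H01s_nrm)
  note r = H01s.regularD[OF assms]
  show ?thesis unfolding L2i.regular_def L2i_nrm
  proof (intro conjI allI ballI)
    show "u t \<in> L2 \<Omega>" "s k t \<in> L2 \<Omega>" for t k by (intro H01_L2 r(1) r(2))+
    show "L2_norm \<Omega> (u t) \<le> B t" if "t \<in> space I" for t by (rule order_trans[OF N[OF r(1)] r(4)[OF that]])
    show "L2_norm \<Omega> (s k t) \<le> B t" if "t \<in> space I" for t k by (rule order_trans[OF N[OF r(2)] r(5)[OF that]])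
    show "(\<lambda>k. L2_norm \<Omega> (\<lambda>x. s k t x - u t x)) \<longlonglongrightarrow> 0" if "t \<in> space I" for t
      by (rule Lim_null_comparison[OF _ r(6)[OF that]])
        (use N[OF H01s.diff_mem[OF r(2) r(1)]] in \<open>simp add: L2_norm_def L2_inner_nonneg\<close>)
  qed (rule r(3) r(7) r(8))+
qed

lemma regular_H01_grad:
  assumes "H01s.regular I u s B" shows "H01g.regular I u s B"
proof -
  have N: "H01g.nrm f \<le> H01s.nrm f" if "f \<in> H01 \<Omega>" for f
    using grad_nrm_le_H1_norm[OF H01_H1[OF that]] by (simp add: H01s_nrm H01g.nrm_def H1g.nrm_def)
  note r = H01s.regularD[OF assms]
  show ?thesis unfolding H01g.regular_def
  proof (intro conjI allI ballI)
    show "u t \<in> H01 \<Omega>" "s k t \<in> H01 \<Omega>" for t k by (intro r(1) r(2))+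
    show "H01g.nrm (u t) \<le> B t" if "t \<in> space I" for t by (rule order_trans[OF N[OF r(1)] r(4)[OF that]])
    show "H01g.nrm (s k t) \<le> B t" if "t \<in> space I" for t k by (rule order_trans[OF N[OF r(2)] r(5)[OF that]])
    show "(\<lambda>k. H01g.nrm (\<lambda>x. s k t x - u t x)) \<longlonglongrightarrow> 0" if "t \<in> space I" for t
      by (rule Lim_null_comparison[OF _ r(6)[OF that]])
        (use N[OF H01s.diff_mem[OF r(2) r(1)]] H01g.nrm_nonneg[OF H01s.diff_mem[OF r(2) r(1)]] in simp)
  qed (rule r(3) r(7) r(8))+
qed

text \<open>The scalar shadow of \<open>weak_time_deriv\<close>, with both Bochner integrals paired
  with a fixed \<psi>. Differences and almost everywhere changes can then be handled with ordinary
  integrals.\<close>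

definition weakly_deriv :: "(real \<Rightarrow> 'a \<Rightarrow> real) \<Rightarrow> (real \<Rightarrow> 'a \<Rightarrow> real) \<Rightarrow> bool" where
  "weakly_deriv u w \<longleftrightarrow> (\<forall>\<psi>\<in>L2 \<Omega>. \<forall>\<theta>. test_fun {0<..<T} \<theta> \<longrightarrow>
     (LINT t|I. deriv \<theta> t * L2_inner \<Omega> (u t) \<psi>) = - (LINT t|I. \<theta> t * L2_inner \<Omega> (w t) \<psi>))"

lemma weak_time_deriv_pairing:
  assumes w: "weak_time_deriv T \<Omega> u w" and u2: "AE t in I. u t \<in> L2 \<Omega>" and w2: "AE t in I. w t \<in> L2 \<Omega>"
  shows "weakly_deriv u w"
  unfolding weakly_deriv_def
proof (intro ballI allI impI)
  fix \<psi> :: "'a \<Rightarrow> real" and \<theta> assume psi: "\<psi> \<in> L2 \<Omega>" and th: "test_fun {0<..<T} \<theta>"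
  obtain J where J: "is_Bochner_integral I (L2 \<Omega>) (L2_norm \<Omega>) (\<lambda>t x. deriv \<theta> t * u t x) J"
    "is_Bochner_integral I (L2 \<Omega>) (L2_norm \<Omega>) (\<lambda>t x. - \<theta> t * w t x) J"
    using w[unfolded weak_time_deriv_def, rule_format, OF th] by (elim exE conjE)
  note B = L2i.Bochner_integral_ip[OF finite_measure_I complete_measure_I, of \<Omega>, unfolded L2i_nrm]
  have "AE t in I. L2_inner \<Omega> (\<lambda>x. deriv \<theta> t * u t x) \<psi> = deriv \<theta> t * L2_inner \<Omega> (u t) \<psi>"
    using u2 by eventually_elim (rule L2i.ip_scale_left[OF _ psi])
  from I.integral_cong_AE_complete(2)[OF B(1)[OF J(1) psi] this] B(2)[OF J(1) psi]
  have 1: "(LINT t|I. deriv \<theta> t * L2_inner \<Omega> (u t) \<psi>) = L2_inner \<Omega> J \<psi>" by simp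
  have "AE t in I. L2_inner \<Omega> (\<lambda>x. - \<theta> t * w t x) \<psi> = - \<theta> t * L2_inner \<Omega> (w t) \<psi>"
    using w2 by eventually_elim (rule L2i.ip_scale_left[OF _ psi])
  from I.integral_cong_AE_complete(2)[OF B(1)[OF J(2) psi] this] B(2)[OF J(2) psi]
  have 2: "(LINT t|I. - \<theta> t * L2_inner \<Omega> (w t) \<psi>) = L2_inner \<Omega> J \<psi>" by simp
  show "(LINT t|I. deriv \<theta> t * L2_inner \<Omega> (u t) \<psi>) = - (LINT t|I. \<theta> t * L2_inner \<Omega> (w t) \<psi>)"
    using 1 2 by simp
qed

lemma test_fun_deriv:
  fixes \<theta> :: "real \<Rightarrow> real"
  assumes th: "test_fun S \<theta>" shows "test_fun S (deriv \<theta>)" "(\<theta> has_real_derivative deriv \<theta> x) (at x)"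
proof -
  obtain D where D: "\<And>x. GDERIV \<theta> x :> D x" using test_fun_ex_gderiv[OF th] by blast
  then have dth: "deriv \<theta> = D" by (intro ext DERIV_imp_deriv) simp
  have "test_fun S (\<lambda>x. D x \<bullet> 1)" by (rule test_fun_gderiv[OF th D]) simp
  then show "test_fun S (deriv \<theta>)" unfolding dth by simp
  show "(\<theta> has_real_derivative deriv \<theta> x) (at x)" unfolding dth using D[of x] by simp
qed

lemma weakly_deriv_cong_AE:
  assumes w: "weakly_deriv u w" and r: "L2i.regular \<Omega> I u' s B" "L2i.regular \<Omega> I w' r C"
    and eq: "AE t in I. u' t = u t" "AE t in I. w' t = w t"
  shows "weakly_deriv u' w'"
  unfolding weakly_deriv_def
proof (intro ballI allI impI)
  fix \<psi> :: "'a \<Rightarrow> real" and \<theta> assume psi: "\<psi> \<in> L2 \<Omega>" and th: "test_fun {0<..<T} \<theta>"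
  note dt = test_fun_deriv(1)[OF th]
  note iu = L2i.ip_const_integrable[OF finite_measure_I r(1) psi] L2i.ip_const_integrable[OF finite_measure_I r(2) psi]
  have "AE t in I. deriv \<theta> t * L2_inner \<Omega> (u' t) \<psi> = deriv \<theta> t * L2_inner \<Omega> (u t) \<psi>"
    using eq(1) by eventually_elim simp
  note 1 = I.integral_cong_AE_complete(2)[OF bounded_mult_I[OF iu(1) dt] this]
  have "AE t in I. \<theta> t * L2_inner \<Omega> (w' t) \<psi> = \<theta> t * L2_inner \<Omega> (w t) \<psi>"
    using eq(2) by eventually_elim simp
  note 2 = I.integral_cong_AE_complete(2)[OF bounded_mult_I[OF iu(2) th] this]
  show "(LINT t|I. deriv \<theta> t * L2_inner \<Omega> (u' t) \<psi>) = - (LINT t|I. \<theta> t * L2_inner \<Omega> (w' t) \<psi>)"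
    using w[unfolded weakly_deriv_def, rule_format, OF psi th] 1 2 by simp
qed

lemma weakly_deriv_diff:
  assumes w: "weakly_deriv u1 w1" "weakly_deriv u2 w2"
    and r: "L2i.regular \<Omega> I u1 s1 B1" "L2i.regular \<Omega> I u2 s2 B2" "L2i.regular \<Omega> I w1 r1 C1" "L2i.regular \<Omega> I w2 r2 C2"
  shows "weakly_deriv (\<lambda>t x. u1 t x - u2 t x) (\<lambda>t x. w1 t x - w2 t x)"
  unfolding weakly_deriv_def
proof (intro ballI allI impI)
  fix \<psi> :: "'a \<Rightarrow> real" and \<theta> assume psi: "\<psi> \<in> L2 \<Omega>" and th: "test_fun {0<..<T} \<theta>"
  note i = L2i.ip_const_integrable[OF finite_measure_I _ psi]
  note i = r[THEN i]
  have e: "L2_inner \<Omega> (\<lambda>x. u1 t x - u2 t x) \<psi> = L2_inner \<Omega> (u1 t) \<psi> - L2_inner \<Omega> (u2 t) \<psi>"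
    "L2_inner \<Omega> (\<lambda>x. w1 t x - w2 t x) \<psi> = L2_inner \<Omega> (w1 t) \<psi> - L2_inner \<Omega> (w2 t) \<psi>" for t
    by (intro L2i.ip_diff_left psi r[THEN L2i.regularD(1)])+
  show "(LINT t|I. deriv \<theta> t * L2_inner \<Omega> (\<lambda>x. u1 t x - u2 t x) \<psi>) = - (LINT t|I. \<theta> t * L2_inner \<Omega> (\<lambda>x. w1 t x - w2 t x) \<psi>)"
    unfolding e right_diff_distrib
    using w[unfolded weakly_deriv_def, rule_format, OF psi th] i[THEN bounded_mult_I[OF _ th]] i[THEN bounded_mult_I[OF _ test_fun_deriv(1)[OF th]]]
    by (simp add: Bochner_Integration.integral_diff)
qed

text \<open>For each \<psi> the fundamental lemma in time gives orthogonality off a null set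
  depending on \<psi>; regularity of the difference removes this dependence.\<close>

lemma weakly_deriv_unique:
  assumes w: "weakly_deriv u w1" "weakly_deriv u w2"
    and r: "L2i.regular \<Omega> I w1 r1 C1" "L2i.regular \<Omega> I w2 r2 C2"
  shows "AE t in I. L2_norm \<Omega> (\<lambda>x. w1 t x - w2 t x) = 0"
proof -
  have d: "L2i.regular \<Omega> I (\<lambda>t x. 1 * w1 t x + (- 1) * w2 t x) (\<lambda>k t x. 1 * r1 k t x + (- 1) * r2 k t x) (\<lambda>t. \<bar>1\<bar> * C1 t + \<bar>- 1\<bar> * C2 t)"
    by (rule L2i.regular_lin[OF r])
  have "AE t in I. L2i.nrm \<Omega> (\<lambda>x. 1 * w1 t x + (- 1) * w2 t x) = 0"
  proof (rule L2i.AE_zero_if_weakly_zero[OF d])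
    fix \<psi> :: "'a \<Rightarrow> real" assume psi: "\<psi> \<in> L2 \<Omega>"
    show "AE t in I. L2_inner \<Omega> (\<lambda>x. 1 * w1 t x + - 1 * w2 t x) \<psi> = 0"
    proof (rule fundamental_lemma)
      show "integrable I (\<lambda>t. L2_inner \<Omega> (\<lambda>x. 1 * w1 t x + - 1 * w2 t x) \<psi>)"
        by (rule L2i.ip_const_integrable[OF finite_measure_I d psi])
      fix \<theta> assume th: "test_fun {0<..<T} \<theta>"
      note i = L2i.ip_const_integrable[OF finite_measure_I _ psi]
  note i = r[THEN i]
      have e: "L2_inner \<Omega> (\<lambda>x. 1 * w1 t x + - 1 * w2 t x) \<psi> = L2_inner \<Omega> (w1 t) \<psi> - L2_inner \<Omega> (w2 t) \<psi>" for t
        by (subst L2i.ip_lin[OF L2i.regularD(1)[OF r(1), of t] L2i.regularD(1)[OF r(2), of t] psi, of 1 "-1"]) simp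
      show "(LINT t|I. \<theta> t * L2_inner \<Omega> (\<lambda>x. 1 * w1 t x + - 1 * w2 t x) \<psi>) = 0"
        unfolding e right_diff_distrib
        using w[unfolded weakly_deriv_def, rule_format, OF psi th] i[THEN bounded_mult_I[OF _ th]]
        by (simp add: Bochner_Integration.integral_diff)
    qed auto
  qed
  then show ?thesis by (simp add: L2i_nrm)
qed

lemma weakly_deriv_prim:
  assumes w: "weakly_deriv u w" and r: "L2i.regular \<Omega> I u s B" "L2i.regular \<Omega> I w r C" and psi: "\<psi> \<in> L2 \<Omega>"
  obtains c where "AE t in I. L2_inner \<Omega> (u t) \<psi> = c + prim (\<lambda>t. L2_inner \<Omega> (w t) \<psi>) t"
  by (rule du_Bois_Reymond[OF r[THEN L2i.ip_const_integrable[OF finite_measure_I _ psi]]])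
    (use w psi in \<open>auto simp: weakly_deriv_def\<close>)

lemma U_space_props:
  assumes "u \<in> U_space T \<Omega>"
  shows "u \<in> L2_Bochner 0 T (H01 \<Omega>) (H1_norm \<Omega>)" "time_deriv T \<Omega> u \<in> L2_Bochner 0 T (L2 \<Omega>) (L2_norm \<Omega>)"
    "weak_time_deriv T \<Omega> u (time_deriv T \<Omega> u)"
proof -
  show "u \<in> L2_Bochner 0 T (H01 \<Omega>) (H1_norm \<Omega>)" using assms by (simp add: U_space_def)
  have "\<exists>w. w \<in> L2_Bochner 0 T (L2 \<Omega>) (L2_norm \<Omega>) \<and> weak_time_deriv T \<Omega> u w" using assms by (auto simp: U_space_def)
  from someI_ex[OF this] show "time_deriv T \<Omega> u \<in> L2_Bochner 0 T (L2 \<Omega>) (L2_norm \<Omega>)"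
    "weak_time_deriv T \<Omega> u (time_deriv T \<Omega> u)" by (simp_all add: time_deriv_def)
qed

text \<open>From here on an element of \<open>U_space\<close> and its chosen derivative are replaced
  by a pair that is well behaved at every time.\<close>

lemma U_space_regular:
  assumes u: "u \<in> U_space T \<Omega>"
  obtains u' s B y r C where "H01s.regular I u' s B" "AE t in I. u' t = u t"
    "L2i.regular \<Omega> I y r C" "AE t in I. y t = time_deriv T \<Omega> u t" "weakly_deriv u' y"
proof -
  obtain u' s B where u': "H01s.regular I u' s B" "AE t in I. u' t = u t"
    by (rule regularize_H01[OF U_space_props(1)[OF u]])
  obtain y r C where y: "L2i.regular \<Omega> I y r C" "AE t in I. y t = time_deriv T \<Omega> u t"
    by (rule regularize_L2[OF U_space_props(2)[OF u]])
  have "AE t in I. u t \<in> L2 \<Omega>"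
    using u'(2) by eventually_elim (erule subst, intro H01_L2 H01s.regularD(1)[OF u'(1)])
  moreover have "AE t in I. time_deriv T \<Omega> u t \<in> L2 \<Omega>"
    using y(2) by eventually_elim (erule subst, rule L2i.regularD(1)[OF y(1)])
  ultimately have "weakly_deriv u (time_deriv T \<Omega> u)"
    by (rule weak_time_deriv_pairing[OF U_space_props(3)[OF u]])
  then have "weakly_deriv u' y"
    by (rule weakly_deriv_cong_AE[OF _ regular_H01_L2[OF u'(1)] y(1) u'(2) y(2)])
  then show thesis using u' y by (intro that)
qed

end

section \<open>Continuous representatives\<close>

lemma (in semi_inner) nrm_sub_le:
  assumes "f \<in> X" "h \<in> X" shows "nrm (\<lambda>x. f x - h x) \<le> nrm f + nrm h"
  using nrm_add[OF assms(1) scale_mem[OF assms(2), of "-1"]] nrm_scale[OF assms(2), of "-1"] by simp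

context time_interval begin

lemma continuous_AE_zero:
  fixes f :: "real \<Rightarrow> real"
  assumes c: "continuous_on {0..T} f" and 0: "AE t in I. f t = 0" and t: "t \<in> {0..T}"
  shows "f t = 0"
proof (rule ccontr)
  assume ne: "f t \<noteq> 0"
  then obtain d where d: "0 < d" "\<And>s. s \<in> {0..T} \<Longrightarrow> dist s t < d \<Longrightarrow> dist (f s) (f t) < \<bar>f t\<bar>"
    using c t unfolding continuous_on_iff by (metis zero_less_abs_iff)
  have "max 0 (t - d) < min T (t + d)" using t d(1) T_pos by auto
  then obtain s where "max 0 (t - d) < s" "s < min T (t + d)" "f s = 0"
    using AE_I_dense[OF 0, of "max 0 (t - d)" "min T (t + d)"] by auto
  moreover from this have "\<bar>s - t\<bar> < d" "s \<in> {0..T}" by auto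
  ultimately show False using d(2)[of s] by (simp add: dist_real_def)
qed

lemma continuous_integrable_I:
  fixes f :: "real \<Rightarrow> real"
  assumes "continuous_on UNIV f" shows "integrable I f"
proof -
  obtain F where "\<And>x. (F has_real_derivative f x) (at x)" using continuous_antiderivative[OF assms] by blast
  then show ?thesis
    using T_pos assms by (intro integral_deriv_interval(1)[of 0 T f F])
      (auto intro: continuous_on_subset has_field_derivative_at_within)
qed

end

section \<open>Continuous functions of time with values in \<open>L2\<close>\<close>

context evolution begin

abbreviation CL2 :: "(real \<Rightarrow> 'a \<Rightarrow> real) set" where "CL2 \<equiv> C_interval T (L2 \<Omega>) (L2_norm \<Omega>)"

lemma CL2_mem: "c \<in> CL2 \<Longrightarrow> t \<in> {0..T} \<Longrightarrow> c t \<in> L2 \<Omega>" by (simp add: C_interval_def)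

lemma CL2_tendsto: "c \<in> CL2 \<Longrightarrow> t \<in> {0..T} \<Longrightarrow> ((\<lambda>s. L2_norm \<Omega> (\<lambda>x. c s x - c t x)) \<longlongrightarrow> 0) (at t within {0..T})"
  by (simp add: C_interval_def)

lemma CL2_ip_continuous:
  assumes c: "c \<in> CL2" and psi: "\<psi> \<in> L2 \<Omega>"
  shows "continuous_on {0..T} (\<lambda>t. L2_inner \<Omega> (c t) \<psi>)"
  unfolding continuous_on_def
proof (intro ballI)
  fix t assume t: "t \<in> {0..T}"
  have "((\<lambda>s. L2_inner \<Omega> (c s) \<psi> - L2_inner \<Omega> (c t) \<psi>) \<longlongrightarrow> 0) (at t within {0..T})"
  proof (rule Lim_null_comparison)
    show "\<forall>\<^sub>F s in at t within {0..T}. norm (L2_inner \<Omega> (c s) \<psi> - L2_inner \<Omega> (c t) \<psi>) \<le> L2_norm \<Omega> (\<lambda>x. c s x - c t x) * L2_norm \<Omega> \<psi>"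
      unfolding eventually_at_filter
    proof (intro always_eventually allI impI)
      fix s assume s: "s \<in> {0..T}"
      show "norm (L2_inner \<Omega> (c s) \<psi> - L2_inner \<Omega> (c t) \<psi>) \<le> L2_norm \<Omega> (\<lambda>x. c s x - c t x) * L2_norm \<Omega> \<psi>"
        using L2i.Cauchy_Schwarz[OF L2i.diff_mem[OF CL2_mem[OF c s] CL2_mem[OF c t]] psi]
          L2i.ip_diff_left[OF CL2_mem[OF c s] CL2_mem[OF c t] psi] by (simp add: L2i_nrm)
    qed
    show "((\<lambda>s. L2_norm \<Omega> (\<lambda>x. c s x - c t x) * L2_norm \<Omega> \<psi>) \<longlongrightarrow> 0) (at t within {0..T})"
      using tendsto_mult[OF CL2_tendsto[OF c t] tendsto_const[of "L2_norm \<Omega> \<psi>"]] by simp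
  qed
  then show "((\<lambda>t. L2_inner \<Omega> (c t) \<psi>) \<longlongrightarrow> L2_inner \<Omega> (c t) \<psi>) (at t within {0..T})" by (simp add: LIM_zero_iff)
qed

lemma CL2_norm_continuous:
  assumes c: "c \<in> CL2" shows "continuous_on {0..T} (\<lambda>t. L2_norm \<Omega> (c t))"
  unfolding continuous_on_def
proof (intro ballI)
  fix t assume t: "t \<in> {0..T}"
  have "((\<lambda>s. L2_norm \<Omega> (c s) - L2_norm \<Omega> (c t)) \<longlongrightarrow> 0) (at t within {0..T})"
  proof (rule Lim_null_comparison[OF _ CL2_tendsto[OF c t]])
    show "\<forall>\<^sub>F s in at t within {0..T}. norm (L2_norm \<Omega> (c s) - L2_norm \<Omega> (c t)) \<le> L2_norm \<Omega> (\<lambda>x. c s x - c t x)"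
      unfolding eventually_at_filter
    proof (intro always_eventually allI impI)
      fix s assume s: "s \<in> {0..T}"
      show "norm (L2_norm \<Omega> (c s) - L2_norm \<Omega> (c t)) \<le> L2_norm \<Omega> (\<lambda>x. c s x - c t x)"
        using L2i.nrm_diff_abs[OF CL2_mem[OF c s] CL2_mem[OF c t]] by (simp add: L2i_nrm)
    qed
  qed
  then show "((\<lambda>t. L2_norm \<Omega> (c t)) \<longlongrightarrow> L2_norm \<Omega> (c t)) (at t within {0..T})" by (simp add: LIM_zero_iff)
qed

lemma CL2_diff:
  assumes c: "c \<in> CL2" and e: "e \<in> CL2" shows "(\<lambda>t x. c t x - e t x) \<in> CL2"
  unfolding C_interval_def
proof (intro CollectI ballI conjI)
  fix t assume t: "t \<in> {0..T}"
  show "(\<lambda>x. c t x - e t x) \<in> L2 \<Omega>" by (intro L2i.diff_mem CL2_mem c e t)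
  show "((\<lambda>s. L2_norm \<Omega> (\<lambda>x. c s x - e s x - (c t x - e t x))) \<longlongrightarrow> 0) (at t within {0..T})"
  proof (rule Lim_null_comparison)
    show "((\<lambda>s. L2_norm \<Omega> (\<lambda>x. c s x - c t x) + L2_norm \<Omega> (\<lambda>x. e s x - e t x)) \<longlongrightarrow> 0) (at t within {0..T})"
      using tendsto_add[OF CL2_tendsto[OF c t] CL2_tendsto[OF e t]] by simp
    show "\<forall>\<^sub>F s in at t within {0..T}. norm (L2_norm \<Omega> (\<lambda>x. c s x - e s x - (c t x - e t x))) \<le> L2_norm \<Omega> (\<lambda>x. c s x - c t x) + L2_norm \<Omega> (\<lambda>x. e s x - e t x)"
      unfolding eventually_at_filter
    proof (intro always_eventually allI impI)
      fix s assume s: "s \<in> {0..T}"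
      have m: "(\<lambda>x. c s x - c t x) \<in> L2 \<Omega>" "(\<lambda>x. e s x - e t x) \<in> L2 \<Omega>"
        by (intro L2i.diff_mem CL2_mem c e t s)+
      have q: "(\<lambda>x. c s x - e s x - (c t x - e t x)) = (\<lambda>x. (c s x - c t x) - (e s x - e t x))" by (auto simp: algebra_simps)
      have "L2_norm \<Omega> (\<lambda>x. (c s x - c t x) - (e s x - e t x)) \<le> L2_norm \<Omega> (\<lambda>x. c s x - c t x) + L2_norm \<Omega> (\<lambda>x. e s x - e t x)"
        using L2i.nrm_sub_le[OF m] by (simp only: L2i_nrm)
      moreover have "0 \<le> L2_norm \<Omega> (\<lambda>x. (c s x - c t x) - (e s x - e t x))" by (simp add: L2_norm_def L2_inner_nonneg)
      ultimately show "norm (L2_norm \<Omega> (\<lambda>x. c s x - e s x - (c t x - e t x))) \<le> L2_norm \<Omega> (\<lambda>x. c s x - c t x) + L2_norm \<Omega> (\<lambda>x. e s x - e t x)"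
        unfolding q by simp
    qed
  qed
qed

lemma L2_norm_cong_AE_zero:
  fixes f :: "'a \<Rightarrow> real"
  assumes "f \<in> L2 \<Omega>" "AE x in lebesgue_on \<Omega>. f x = 0" shows "L2_norm \<Omega> f = 0"
proof -
  have "L2_inner \<Omega> f f = L2_inner \<Omega> (\<lambda>x. 0::real) (\<lambda>x. 0)"
    by (rule L2_inner_cong_AE[where f'="\<lambda>x. 0" and h'="\<lambda>x. 0"])
      (use assms in \<open>auto intro: L2_zero\<close>)
  then show ?thesis by (simp add: L2_norm_def L2_inner_def)
qed

lemma CL2_unique:
  assumes c: "c \<in> CL2" and e: "e \<in> CL2" and eq: "AE t in I. AE x in lebesgue_on \<Omega>. c t x = e t x" and t: "t \<in> {0..T}"
  shows "L2_norm \<Omega> (\<lambda>x. c t x - e t x) = 0"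
proof -
  note ce = CL2_diff[OF c e]
  have "AE t in I. L2_norm \<Omega> (\<lambda>x. c t x - e t x) = 0"
    using eq AE_space
  proof eventually_elim
    case (elim t)
    then have "(\<lambda>x. c t x - e t x) \<in> L2 \<Omega>" by (intro CL2_mem[OF ce]) auto
    then show ?case by (rule L2_norm_cong_AE_zero) (use elim(1) in eventually_elim, simp)
  qed
  from continuous_AE_zero[OF CL2_norm_continuous[OF ce] this t] show ?thesis .
qed

lemma cont_rep_props:
  assumes c: "c \<in> CL2" "AE t in I. AE x in lebesgue_on \<Omega>. c t x = u t x"
  shows "cont_rep T \<Omega> u \<in> CL2" "AE t in I. AE x in lebesgue_on \<Omega>. cont_rep T \<Omega> u t x = u t x"
proof -
  have "\<exists>c. c \<in> CL2 \<and> (AE t in I. AE x in lebesgue_on \<Omega>. c t x = u t x)" using c by (intro exI[of _ c] conjI)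
  from someI_ex[OF this] show "cont_rep T \<Omega> u \<in> CL2" "AE t in I. AE x in lebesgue_on \<Omega>. cont_rep T \<Omega> u t x = u t x"
    by (simp_all add: cont_rep_def)
qed

text \<open>Each pairing of u is a constant plus a primitive, off a null set depending on the test
  function; only the countably many values of the approximations are used as test functions. Testing
  u t - u t' with the difference of its approximations, and passing to the limit, bounds the norm by
  the integral of C, a majorant of the norm of y.\<close>

lemma difference_quotient_bound:
  assumes u: "L2i.regular \<Omega> I u s B" and y: "L2i.regular \<Omega> I y r C" and d: "weakly_deriv u y"
  obtains D where "AE t in I. t \<in> D" "D \<subseteq> {0<..<T}"
    "\<forall>t\<in>D. \<forall>t'\<in>D. L2_norm \<Omega> (\<lambda>x. u t x - u t' x) \<le> \<bar>prim C t - prim C t'\<bar>"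
proof -
  let ?S = "\<Union>k. s k ` space I"
  have cS: "countable ?S"
  proof (rule countable_UN)
    show "countable (s k ` space I)" for k
      by (rule countable_finite[OF simple_functionD(1)[OF L2i.regularD(3)[OF u]]])
  qed simp
  have SX: "c \<in> L2 \<Omega>" if "c \<in> ?S" for c using that L2i.regularD(2)[OF u] by auto
  have "\<exists>a. AE t in I. L2_inner \<Omega> (u t) c = a + prim (\<lambda>t. L2_inner \<Omega> (y t) c) t" if "c \<in> ?S" for c
    by (rule weakly_deriv_prim[OF d u y SX[OF that]]) (rule exI)
  then have "\<forall>c\<in>?S. \<exists>a. AE t in I. L2_inner \<Omega> (u t) c = a + prim (\<lambda>t. L2_inner \<Omega> (y t) c) t" by blast
  then obtain a where a: "\<forall>c\<in>?S. AE t in I. L2_inner \<Omega> (u t) c = a c + prim (\<lambda>t. L2_inner \<Omega> (y t) c) t" by (rule bchoice[THEN exE])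
  define D where "D = {t \<in> {0<..<T}. \<forall>c\<in>?S. L2_inner \<Omega> (u t) c = a c + prim (\<lambda>t. L2_inner \<Omega> (y t) c) t}"
  have "AE t in I. \<forall>c\<in>?S. L2_inner \<Omega> (u t) c = a c + prim (\<lambda>t. L2_inner \<Omega> (y t) c) t"
    by (rule AE_ball_countable'[OF _ cS]) (rule bspec[OF a])
  then have D1: "AE t in I. t \<in> D" using AE_space by eventually_elim (simp add: D_def)
  have D2: "D \<subseteq> {0<..<T}" by (auto simp: D_def)
  note yi = L2i.ip_const_integrable[OF finite_measure_I y]
  note Ci = L2i.regular_B_integrable[OF finite_measure_I y]
  have "L2_norm \<Omega> (\<lambda>x. u t x - u t' x) \<le> \<bar>prim C t - prim C t'\<bar>" if t: "t \<in> D" and t': "t' \<in> D" for t t'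
  proof -
    let ?d = "\<lambda>x. u t x - u t' x" and ?P = "\<bar>prim C t - prim C t'\<bar>"
    have ts: "t \<in> space I" "t' \<in> space I" using t t' D2 by auto
    have dX: "?d \<in> L2 \<Omega>" by (intro L2i.diff_mem L2i.regularD(1)[OF u])
    have sX: "(\<lambda>x. s k t x - s k t' x) \<in> L2 \<Omega>" for k by (intro L2i.diff_mem L2i.regularD(2)[OF u])
    have le: "\<bar>L2_inner \<Omega> ?d (\<lambda>x. s k t x - s k t' x)\<bar> \<le> L2_norm \<Omega> (\<lambda>x. s k t x - s k t' x) * ?P" for k
    proof -
      let ?e = "\<lambda>x. s k t x - s k t' x"
      have S: "s k t \<in> ?S" "s k t' \<in> ?S"
        by (rule UN_I[of k], rule UNIV_I, rule imageI, rule ts)+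
      have *: "L2_inner \<Omega> ?d c = prim (\<lambda>t. L2_inner \<Omega> (y t) c) t - prim (\<lambda>t. L2_inner \<Omega> (y t) c) t'" if c: "c \<in> ?S" for c
      proof -
        have "L2_inner \<Omega> (u t) c = a c + prim (\<lambda>t. L2_inner \<Omega> (y t) c) t" using t c unfolding D_def by blast
        moreover have "L2_inner \<Omega> (u t') c = a c + prim (\<lambda>t. L2_inner \<Omega> (y t) c) t'" using t' c unfolding D_def by blast
        ultimately show ?thesis
          using L2i.ip_diff_left[OF L2i.regularD(1)[OF u, of t] L2i.regularD(1)[OF u, of t'] SX[OF c]] by linarith
      qed
      have pl: "prim (\<lambda>r. L2_inner \<Omega> (y r) ?e) q = prim (\<lambda>r. L2_inner \<Omega> (y r) (s k t)) q - prim (\<lambda>r. L2_inner \<Omega> (y r) (s k t')) q" for q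
      proof -
        have "(\<lambda>r. L2_inner \<Omega> (y r) ?e) = (\<lambda>r. 1 * L2_inner \<Omega> (y r) (s k t) + (-1) * L2_inner \<Omega> (y r) (s k t'))"
          using L2i.ip_diff_right[OF L2i.regularD(2)[OF u] L2i.regularD(2)[OF u] L2i.regularD(1)[OF y]] by auto
        then show ?thesis using prim_lin[OF yi yi, OF SX[OF S(1)] SX[OF S(2)], of 1 "-1" q] by simp
      qed
      have "L2_inner \<Omega> ?d ?e = L2_inner \<Omega> ?d (s k t) - L2_inner \<Omega> ?d (s k t')"
        by (rule L2i.ip_diff_right[OF SX[OF S(1)] SX[OF S(2)] dX])
      also have "\<dots> = prim (\<lambda>r. L2_inner \<Omega> (y r) ?e) t - prim (\<lambda>r. L2_inner \<Omega> (y r) ?e) t'"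
        unfolding *[OF S(1)] *[OF S(2)] pl by simp
      finally have e1: "L2_inner \<Omega> ?d ?e = prim (\<lambda>r. L2_inner \<Omega> (y r) ?e) t - prim (\<lambda>r. L2_inner \<Omega> (y r) ?e) t'" .
      \<comment> \<open>The summand \<open>0 * C r\<close> only brings the majorant into the
        two-term form in which linearity of \<open>prim\<close> is stated.\<close>
      have "\<bar>prim (\<lambda>r. L2_inner \<Omega> (y r) ?e) t - prim (\<lambda>r. L2_inner \<Omega> (y r) ?e) t'\<bar>
          \<le> \<bar>prim (\<lambda>r. L2_norm \<Omega> ?e * C r + 0 * C r) t - prim (\<lambda>r. L2_norm \<Omega> ?e * C r + 0 * C r) t'\<bar>"
      proof (rule prim_abs_diff_le[OF yi[OF sX]])
        fix q assume q: "q \<in> {0<..<T}"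
        have "\<bar>L2_inner \<Omega> (y q) ?e\<bar> \<le> L2_norm \<Omega> (y q) * L2_norm \<Omega> ?e"
          using L2i.Cauchy_Schwarz[OF L2i.regularD(1)[OF y] sX] by (simp add: L2i_nrm)
        also have "\<dots> \<le> C q * L2_norm \<Omega> ?e"
          using L2i.regularD(4)[OF y, of q] q by (intro mult_right_mono) (auto simp: L2i_nrm L2_norm_def L2_inner_nonneg)
        finally show "\<bar>L2_inner \<Omega> (y q) ?e\<bar> \<le> L2_norm \<Omega> ?e * C q + 0 * C q" by (simp add: mult.commute)
      qed (use Ci in auto)
      also have "\<dots> = L2_norm \<Omega> ?e * ?P"
        unfolding prim_lin[OF Ci Ci] by (simp add: L2_norm_def L2_inner_nonneg abs_mult flip: right_diff_distrib)
      finally show ?thesis unfolding e1 .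
    qed
    have lim0: "(\<lambda>k. L2_norm \<Omega> (\<lambda>x. s k t x - s k t' x - (u t x - u t' x))) \<longlonglongrightarrow> 0"
    proof -
      note w = L2i.regularD(6)[OF u, unfolded L2i_nrm]
      show ?thesis
      proof (rule Lim_null_comparison)
        show "(\<lambda>k. L2_norm \<Omega> (\<lambda>x. s k t x - u t x) + L2_norm \<Omega> (\<lambda>x. s k t' x - u t' x)) \<longlonglongrightarrow> 0"
          using tendsto_add[OF w[OF ts(1)] w[OF ts(2)]] by simp
        show "\<forall>\<^sub>F k in sequentially. norm (L2_norm \<Omega> (\<lambda>x. s k t x - s k t' x - (u t x - u t' x))) \<le> L2_norm \<Omega> (\<lambda>x. s k t x - u t x) + L2_norm \<Omega> (\<lambda>x. s k t' x - u t' x)"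
        proof (intro always_eventually allI)
          fix k
          have m: "(\<lambda>x. s k t x - u t x) \<in> L2 \<Omega>" "(\<lambda>x. s k t' x - u t' x) \<in> L2 \<Omega>"
            by (intro L2i.diff_mem L2i.regularD(1,2)[OF u])+
          have q: "(\<lambda>x. s k t x - s k t' x - (u t x - u t' x)) = (\<lambda>x. (s k t x - u t x) - (s k t' x - u t' x))" by (auto simp: algebra_simps)
          have "L2_norm \<Omega> (\<lambda>x. (s k t x - u t x) - (s k t' x - u t' x)) \<le> L2_norm \<Omega> (\<lambda>x. s k t x - u t x) + L2_norm \<Omega> (\<lambda>x. s k t' x - u t' x)"
            using L2i.nrm_sub_le[OF m] by (simp only: L2i_nrm)
          moreover have "0 \<le> L2_norm \<Omega> (\<lambda>x. (s k t x - u t x) - (s k t' x - u t' x))" by (simp add: L2_norm_def L2_inner_nonneg)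
          ultimately show "norm (L2_norm \<Omega> (\<lambda>x. s k t x - s k t' x - (u t x - u t' x))) \<le> L2_norm \<Omega> (\<lambda>x. s k t x - u t x) + L2_norm \<Omega> (\<lambda>x. s k t' x - u t' x)"
            unfolding q by simp
        qed
      qed
    qed
    note lim1 = L2i.tendsto_nrm[OF sX dX, unfolded L2i_nrm, OF lim0]
    have lim2: "(\<lambda>k. L2_inner \<Omega> ?d (\<lambda>x. s k t x - s k t' x)) \<longlonglongrightarrow> L2_inner \<Omega> ?d ?d"
      by (rule L2i.tendsto_ip[OF dX dX _ sX dX]) (use lim0 in \<open>simp_all add: L2i_nrm L2i.nrm_zero[unfolded L2i_nrm]\<close>)
    \<comment> \<open>In the limit the difference is tested with itself; one factor of its norm then
      cancels.\<close>
    have "L2_inner \<Omega> ?d ?d \<le> L2_norm \<Omega> ?d * ?P"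
    proof (rule LIMSEQ_le[OF lim2])
      show "(\<lambda>k. L2_norm \<Omega> (\<lambda>x. s k t x - s k t' x) * ?P) \<longlonglongrightarrow> L2_norm \<Omega> ?d * ?P" by (intro tendsto_intros lim1)
      show "\<exists>N. \<forall>n\<ge>N. L2_inner \<Omega> ?d (\<lambda>x. s n t x - s n t' x) \<le> L2_norm \<Omega> (\<lambda>x. s n t x - s n t' x) * ?P"
        using le abs_le_D1 by blast
    qed
    then have sq: "L2_norm \<Omega> ?d * L2_norm \<Omega> ?d \<le> L2_norm \<Omega> ?d * ?P"
      using L2i.nrm_sq[OF dX] by (simp add: L2i_nrm power2_eq_square)
    show ?thesis
    proof (cases "L2_norm \<Omega> ?d = 0")
      case False
      then have "0 < L2_norm \<Omega> ?d" using L2i.nrm_nonneg[OF dX] by (simp add: L2i_nrm)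
      then show ?thesis using sq by simp
    qed simp
  qed
  then show thesis by (intro that[OF D1 D2] ballI)
qed

text \<open>On a dense set of times u has the modulus of continuity of the continuous function
  \<open>prim C\<close>. Completeness of \<open>L2\<close> extends it to the closed interval, end
  points included, with the same modulus.\<close>

lemma ex_continuous_rep:
  assumes u: "L2i.regular \<Omega> I u s B" and y: "L2i.regular \<Omega> I y r C" and d: "weakly_deriv u y"
  obtains c where "c \<in> CL2" "AE t in I. AE x in lebesgue_on \<Omega>. c t x = u t x"
proof -
  obtain D where D: "AE t in I. t \<in> D" "D \<subseteq> {0<..<T}"
    "\<forall>t\<in>D. \<forall>t'\<in>D. L2_norm \<Omega> (\<lambda>x. u t x - u t' x) \<le> \<bar>prim C t - prim C t'\<bar>"
    by (rule difference_quotient_bound[OF u y d])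
  note D3 = D(3)[rule_format]
  note uX = L2i.regularD(1)[OF u]
  let ?P = "prim C"
  have Pc: "isCont ?P t" for t
    using prim_continuous[OF L2i.regular_B_integrable[OF finite_measure_I y]] by (simp add: continuous_on_eq_continuous_at)
  have seq: "\<exists>q. (\<forall>n. q n \<in> D) \<and> q \<longlonglongrightarrow> t" if t: "t \<in> {0..T}" for t
  proof -
    have "\<exists>q. q \<in> D \<and> \<bar>q - t\<bar> < inverse (real (Suc n))" for n
    proof -
      let ?e = "inverse (real (Suc n))"
      have "max 0 (t - ?e) < min T (t + ?e)" proof -
        have "0 < ?e" by simp
        then show ?thesis using t T_pos by (simp only: max_less_iff_conj min_less_iff_conj atLeastAtMost_iff) (intro conjI TrueI; linarith)
      qed
      then obtain q where "max 0 (t - ?e) < q" "q < min T (t + ?e)" "q \<in> D"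
        using AE_I_dense[OF D(1), of "max 0 (t - ?e)" "min T (t + ?e)"] by auto
      then show ?thesis by (intro exI[of _ q]) auto
    qed
    then obtain q where q: "\<And>n. q n \<in> D" "\<And>n. \<bar>q n - t\<bar> < inverse (real (Suc n))" by metis
    have "(\<lambda>n. q n - t) \<longlonglongrightarrow> 0"
      by (rule Lim_null_comparison[OF _ LIMSEQ_inverse_real_of_nat]) (use q(2) in \<open>auto intro!: always_eventually less_imp_le\<close>)
    then show ?thesis using q(1) by (auto simp: LIM_zero_iff)
  qed
  \<comment> \<open>The value at t is specified by its distances to all u s with s in D, not through
    one chosen sequence, so values at two times can be compared without matching sequences.\<close>
  have "\<exists>c. c \<in> L2 \<Omega> \<and> (\<forall>s\<in>D. L2_norm \<Omega> (\<lambda>x. c x - u s x) \<le> \<bar>?P t - ?P s\<bar>)" if t: "t \<in> {0..T}" for t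
  proof -
    obtain q where q: "\<forall>n. q n \<in> D" "q \<longlonglongrightarrow> t" using seq[OF t] by blast
    have Pq: "(\<lambda>n. ?P (q n)) \<longlonglongrightarrow> ?P t" by (rule isCont_tendsto_compose[OF Pc q(2)])
    have C: "\<exists>N. \<forall>m\<ge>N. \<forall>n\<ge>N. L2_norm \<Omega> (\<lambda>x. u (q m) x - u (q n) x) < e" if e: "0 < e" for e
    proof -
      have "Cauchy (\<lambda>n. ?P (q n))" using Pq by (rule LIMSEQ_imp_Cauchy)
      then obtain N where N: "\<forall>m\<ge>N. \<forall>n\<ge>N. \<bar>?P (q m) - ?P (q n)\<bar> < e" using e unfolding Cauchy_def dist_real_def by blast
      show ?thesis
      proof (intro exI[of _ N] allI impI)
        fix m n assume "N \<le> m" "N \<le> n"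
        then show "L2_norm \<Omega> (\<lambda>x. u (q m) x - u (q n) x) < e"
          using D3[of "q m" "q n"] q(1) N by (meson le_less_trans)
      qed
    qed
    obtain c where c: "c \<in> L2 \<Omega>" "(\<lambda>n. L2_norm \<Omega> (\<lambda>x. u (q n) x - c x)) \<longlonglongrightarrow> 0"
      by (rule L2_complete[of "\<lambda>n. u (q n)", OF uX C])
    have "L2_norm \<Omega> (\<lambda>x. c x - u s x) \<le> \<bar>?P t - ?P s\<bar>" if s: "s \<in> D" for s
    proof (rule LIMSEQ_le)
      show "(\<lambda>n. \<bar>?P (q n) - ?P s\<bar>) \<longlonglongrightarrow> \<bar>?P t - ?P s\<bar>" by (intro tendsto_intros Pq)
      show "\<exists>N. \<forall>n\<ge>N. L2_norm \<Omega> (\<lambda>x. u (q n) x - u s x) \<le> \<bar>?P (q n) - ?P s\<bar>"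
        using D3[OF _ s] q(1) by blast
      show "(\<lambda>n. L2_norm \<Omega> (\<lambda>x. u (q n) x - u s x)) \<longlonglongrightarrow> L2_norm \<Omega> (\<lambda>x. c x - u s x)"
      proof (rule L2i.tendsto_nrm[of "\<lambda>n x. u (q n) x - u s x" \<Omega> "\<lambda>x. c x - u s x", unfolded L2i_nrm])
        show "(\<lambda>x. u (q n) x - u s x) \<in> L2 \<Omega>" for n by (intro L2i.diff_mem uX)
        show "(\<lambda>x. c x - u s x) \<in> L2 \<Omega>" by (intro L2i.diff_mem uX c)
        show "(\<lambda>k. L2_norm \<Omega> (\<lambda>x. u (q k) x - u s x - (c x - u s x))) \<longlonglongrightarrow> 0" using c(2) by simp
      qed
    qed
    then show ?thesis using c(1) by blast
  qed
  then have "\<forall>t\<in>{0..T}. \<exists>c. c \<in> L2 \<Omega> \<and> (\<forall>s\<in>D. L2_norm \<Omega> (\<lambda>x. c x - u s x) \<le> \<bar>?P t - ?P s\<bar>)" by blast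
  then obtain c where c': "\<forall>t\<in>{0..T}. c t \<in> L2 \<Omega> \<and> (\<forall>s\<in>D. L2_norm \<Omega> (\<lambda>x. c t x - u s x) \<le> \<bar>?P t - ?P s\<bar>)"
    by (rule bchoice[THEN exE])
  have cX: "c t \<in> L2 \<Omega>" and cb: "s \<in> D \<Longrightarrow> L2_norm \<Omega> (\<lambda>x. c t x - u s x) \<le> \<bar>?P t - ?P s\<bar>" if "t \<in> {0..T}" for t s
    using c' that by auto
  have cc: "L2_norm \<Omega> (\<lambda>x. c t x - c t' x) \<le> \<bar>?P t - ?P t'\<bar>" if t: "t \<in> {0..T}" "t' \<in> {0..T}" for t t'
  proof -
    obtain q where q: "\<forall>n. q n \<in> D" "q \<longlonglongrightarrow> t'" using seq[OF t(2)] by blast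
    have Pq: "(\<lambda>n. ?P (q n)) \<longlonglongrightarrow> ?P t'" by (rule isCont_tendsto_compose[OF Pc q(2)])
    have "(\<lambda>n. \<bar>?P t - ?P (q n)\<bar> + \<bar>?P t' - ?P (q n)\<bar>) \<longlonglongrightarrow> \<bar>?P t - ?P t'\<bar> + \<bar>?P t' - ?P t'\<bar>" by (intro tendsto_intros Pq)
    moreover have "L2_norm \<Omega> (\<lambda>x. c t x - c t' x) \<le> \<bar>?P t - ?P (q n)\<bar> + \<bar>?P t' - ?P (q n)\<bar>" for n
    proof -
      have "L2_norm \<Omega> (\<lambda>x. c t x - c t' x) \<le> L2_norm \<Omega> (\<lambda>x. c t x - u (q n) x) + L2_norm \<Omega> (\<lambda>x. u (q n) x - c t' x)"
        using L2i.nrm_triangle[OF cX[OF t(1)] uX cX[OF t(2)], of "q n"] by (simp add: L2i_nrm)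
      moreover have "L2_norm \<Omega> (\<lambda>x. u (q n) x - c t' x) = L2_norm \<Omega> (\<lambda>x. c t' x - u (q n) x)"
        using L2i.nrm_diff_commute[OF uX cX[OF t(2)], of "q n"] by (simp add: L2i_nrm)
      ultimately show ?thesis using cb[OF t(1) q(1)[rule_format, of n]] cb[OF t(2) q(1)[rule_format, of n]] by linarith
    qed
    ultimately have "L2_norm \<Omega> (\<lambda>x. c t x - c t' x) \<le> \<bar>?P t - ?P t'\<bar> + \<bar>?P t' - ?P t'\<bar>"
      by (intro LIMSEQ_le_const) auto
    then show ?thesis by simp
  qed
  have "c \<in> CL2" unfolding C_interval_def
  proof (intro CollectI ballI conjI cX)
    fix t assume t: "t \<in> {0..T}"
    show "((\<lambda>s. L2_norm \<Omega> (\<lambda>x. c s x - c t x)) \<longlongrightarrow> 0) (at t within {0..T})"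
    proof (rule Lim_null_comparison)
      have "((\<lambda>s. \<bar>?P s - ?P t\<bar>) \<longlongrightarrow> \<bar>?P t - ?P t\<bar>) (at t within {0..T})"
        using Pc[of t] by (intro tendsto_intros) (auto simp: isCont_def intro: tendsto_within_subset)
      then show "((\<lambda>s. \<bar>?P s - ?P t\<bar>) \<longlongrightarrow> 0) (at t within {0..T})" by simp
      show "\<forall>\<^sub>F s in at t within {0..T}. norm (L2_norm \<Omega> (\<lambda>x. c s x - c t x)) \<le> \<bar>?P s - ?P t\<bar>"
        unfolding eventually_at_filter using cc t by (intro always_eventually allI impI) (simp add: L2_norm_def L2_inner_nonneg)
    qed
  qed
  moreover have "AE t in I. AE x in lebesgue_on \<Omega>. c t x = u t x"
    using D(1)
  proof eventually_elim
    case (elim t)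
    then have t: "t \<in> {0..T}" using D(2) by auto
    have m: "(\<lambda>x. c t x - u t x) \<in> L2 \<Omega>" by (intro L2i.diff_mem uX cX t)
    have "L2_norm \<Omega> (\<lambda>x. c t x - u t x) \<le> 0" using cb[OF t elim] by simp
    then have "L2_norm \<Omega> (\<lambda>x. c t x - u t x) = 0" using L2i.nrm_nonneg[OF m] by (simp add: L2i_nrm)
    from L2_norm_0_AE[OF m this] show ?case by eventually_elim simp
  qed
  ultimately show thesis by (rule that)
qed

text \<open>Provides the existence on which the choice in \<open>cont_rep\<close> rests.\<close>

lemma U_space_cont_rep:
  assumes u: "u \<in> U_space T \<Omega>"
  shows "cont_rep T \<Omega> u \<in> CL2" "AE t in I. AE x in lebesgue_on \<Omega>. cont_rep T \<Omega> u t x = u t x"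
proof -
  obtain u' s B y r C where r: "H01s.regular I u' s B" "AE t in I. u' t = u t"
    "L2i.regular \<Omega> I y r C" "AE t in I. y t = time_deriv T \<Omega> u t" "weakly_deriv u' y"
    by (rule U_space_regular[OF u])
  obtain c where c: "c \<in> CL2" "AE t in I. AE x in lebesgue_on \<Omega>. c t x = u' t x"
    by (rule ex_continuous_rep[OF regular_H01_L2[OF r(1)] r(3) r(5)])
  have "AE t in I. AE x in lebesgue_on \<Omega>. c t x = u t x"
    using c(2) r(2) by eventually_elim simp
  from cont_rep_props[OF c(1) this]
  show "cont_rep T \<Omega> u \<in> CL2" "AE t in I. AE x in lebesgue_on \<Omega>. cont_rep T \<Omega> u t x = u t x" .
qed

end

section \<open>Shifts, product test functions and memory terms\<close>

lemma DERIV_continuous_on_UNIV: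
  fixes f f' :: "real \<Rightarrow> real"
  assumes "\<And>x. (f has_real_derivative f' x) (at x)" shows "continuous_on UNIV f"
  using assms by (meson DERIV_isCont continuous_at_imp_continuous_on)

lemma
  fixes c :: real
  shows lebesgue_shift_measurable: "(\<lambda>x. x - c) \<in> lebesgue \<rightarrow>\<^sub>M lebesgue"
    and distr_lebesgue_shift_eq: "distr lebesgue lebesgue (\<lambda>x. x - c) = lebesgue"
proof -
  have "(\<lambda>x. x - c) = (\<lambda>x. - c + (\<Sum>j\<in>Basis. (1 * (x \<bullet> j)) *\<^sub>R j))" by (auto simp: euclidean_representation)
  then show "(\<lambda>x. x - c) \<in> lebesgue \<rightarrow>\<^sub>M lebesgue"
    using lebesgue_affine_measurable[of "\<lambda>_. 1::real" "- c"] by simp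
  have "(\<lambda>x. x - c) = (\<lambda>x. - c + 1 * x)" by auto
  then show "distr lebesgue lebesgue (\<lambda>x. x - c) = lebesgue"
    using lebesgue_real_affine[of 1 "- c"] by (simp add: density_1)
qed

lemma integrable_lebesgue_shift:
  fixes h :: "real \<Rightarrow> real" assumes "integrable lebesgue h"
  shows "integrable lebesgue (\<lambda>x. h (x - c))" "(LINT x|lebesgue. h (x - c)) = (LINT x|lebesgue. h x)"
proof -
  have h: "h \<in> borel_measurable lebesgue" using assms by auto
  show "integrable lebesgue (\<lambda>x. h (x - c))"
    using integrable_distr[OF lebesgue_shift_measurable[of c], of h] assms by (simp add: distr_lebesgue_shift_eq)
  show "(LINT x|lebesgue. h (x - c)) = (LINT x|lebesgue. h x)"
    using integral_distr[OF lebesgue_shift_measurable[of c] h] by (simp add: distr_lebesgue_shift_eq)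
qed

lemma AE_lebesgue_shift:
  fixes c :: real assumes "AE x in lebesgue. P x" shows "AE x in lebesgue. P (x - c)"
proof (rule AE_distrD[OF lebesgue_shift_measurable])
  show "AE x in distr lebesgue lebesgue (\<lambda>x. x - c). P x" unfolding distr_lebesgue_shift_eq by (rule assms)
qed

section \<open>The delay as a translation in time\<close>

context time_interval begin

lemma AE_I_iff: "(AE t in I. P t) \<longleftrightarrow> (AE t in lebesgue. t \<in> {0<..<T} \<longrightarrow> P t)"
  by (subst AE_restrict_space_iff) auto

lemma AE_lebesgue_ne: "AE t in lebesgue. t \<noteq> (c::real)"
proof -
  have "AE t in lborel. t \<noteq> c" by (rule AE_lborel_singleton)
  then show ?thesis by (rule AE_completion)
qed

lemma integrable_I_of_lebesgue: "integrable lebesgue f \<Longrightarrow> integrable I f" for f :: "real \<Rightarrow> real"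
  unfolding lebesgue_on_integrable_iff[OF lmeasurable_interval(2)[THEN fmeasurableD]]
  by (erule integrable_bounded_mult[where B=1], rule borel_measurable_indicator) (auto simp: indicator_def)

lemma shift_history:
  fixes h :: "real \<Rightarrow> real"
  assumes h: "integrable (lebesgue_on {- \<tau><..<0}) h"
  shows "integrable I (\<lambda>t. indicator {..<\<tau>} t * h (t - \<tau>))"
proof -
  have "integrable lebesgue (\<lambda>r. indicator {- \<tau><..<0} r * h r)"
    using h by (subst (asm) lebesgue_on_integrable_iff) auto
  from integrable_lebesgue_shift(1)[OF this, of \<tau>]
  have i: "integrable I (\<lambda>t. indicator {- \<tau><..<0} (t - \<tau>) * h (t - \<tau>))" by (rule integrable_I_of_lebesgue)
  have "AE t in I. indicator {- \<tau><..<0} (t - \<tau>) * h (t - \<tau>) = indicator {..<\<tau>} t * h (t - \<tau>)"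
    using AE_space by eventually_elim (auto simp: indicator_def)
  then show ?thesis by (rule I.integral_cong_AE_complete(1)[OF i])
qed

lemma AE_history:
  assumes "AE r in lebesgue_on {- \<tau><..<0}. P r" shows "AE t in I. t < \<tau> \<longrightarrow> P (t - \<tau>)"
proof -
  have "AE r in lebesgue. r \<in> {- \<tau><..<0} \<longrightarrow> P r" using assms by (subst (asm) AE_restrict_space_iff) auto
  from AE_lebesgue_shift[OF this, of \<tau>] show ?thesis
    unfolding AE_I_iff by eventually_elim auto
qed

text \<open>The case split of the delayed term is at t \<ge> \<tau>, the domain of the shifted
  function begins at t > \<tau>; the two differ in a single point.\<close>

lemma shift_eq_AE:
  assumes "0 < \<tau>"
  shows "AE t in lebesgue. indicator {0<..<T} t * (indicator {\<tau>..} t * h (t - \<tau>))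
     = (indicator {0<..<T} t * (indicator {0<..<T} (t - \<tau>) * h (t - \<tau>)) :: real)"
  using AE_lebesgue_ne[of \<tau>] by eventually_elim (use assms in \<open>auto simp: indicator_def\<close>)

lemma shift_integrable:
  fixes h :: "real \<Rightarrow> real"
  assumes h: "integrable I h" and \<tau>: "0 < \<tau>"
  shows "integrable I (\<lambda>t. indicator {\<tau>..} t * h (t - \<tau>))"
proof -
  have "integrable lebesgue (\<lambda>r. indicator {0<..<T} r * h r)"
    using h by (subst (asm) lebesgue_on_integrable_iff) auto
  from integrable_lebesgue_shift(1)[OF this, of \<tau>]
  have i: "integrable I (\<lambda>t. indicator {0<..<T} (t - \<tau>) * h (t - \<tau>))" by (rule integrable_I_of_lebesgue)
  have "AE t in I. indicator {0<..<T} (t - \<tau>) * h (t - \<tau>) = indicator {\<tau>..} t * h (t - \<tau>)"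
    unfolding AE_I_iff using shift_eq_AE[OF \<tau>, of h] by eventually_elim (auto simp: indicator_def split: if_splits)
  then show ?thesis by (rule I.integral_cong_AE_complete(1)[OF i])
qed

lemma AE_shift:
  assumes "AE r in I. P r" "0 < \<tau>" shows "AE t in I. t \<ge> \<tau> \<longrightarrow> P (t - \<tau>)"
proof -
  have "AE r in lebesgue. r \<in> {0<..<T} \<longrightarrow> P r" using assms(1) by (simp only: AE_I_iff)
  from AE_lebesgue_shift[OF this, of \<tau>] AE_lebesgue_ne[of \<tau>] show ?thesis
    unfolding AE_I_iff by eventually_elim (use assms(2) in auto)
qed

text \<open>Integrating the delayed function gives the primitive at the delayed time. Since
  primitives vanish at nonpositive times, no case distinction at \<tau> remains.\<close>

lemma prim_shift:
  assumes h: "integrable I h" and \<tau>: "0 < \<tau>" and t: "t \<le> T"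
  shows "prim (\<lambda>t. indicator {\<tau>..} t * h (t - \<tau>)) t = prim h (t - \<tau>)"
proof -
  let ?f = "\<lambda>r. indicator {0<..<T} r * (indicator {..<t - \<tau>} r * h r)"
  have f: "integrable lebesgue ?f"
    using ind_mult_integrable[OF h, of "t - \<tau>"] by (subst (asm) lebesgue_on_integrable_iff) auto
  have "prim (\<lambda>t. indicator {\<tau>..} t * h (t - \<tau>)) t = (LINT s|lebesgue. indicator {0<..<T} s * (indicator {..<t} s * (indicator {\<tau>..} s * h (s - \<tau>))))"
    unfolding prim_def by (rule lebesgue_on_integral_eq) auto
  also have "\<dots> = (LINT s|lebesgue. ?f (s - \<tau>))"
  proof (rule completion.integral_cong_AE_complete(2)[OF integrable_lebesgue_shift(1)[OF f]])
    show "AE s in lebesgue. ?f (s - \<tau>) = indicator {0<..<T} s * (indicator {..<t} s * (indicator {\<tau>..} s * h (s - \<tau>)))"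
      using AE_lebesgue_ne[of \<tau>] by eventually_elim (use \<tau> t in \<open>auto simp: indicator_def\<close>)
  qed
  also have "\<dots> = (LINT s|lebesgue. ?f s)" by (rule integrable_lebesgue_shift(2)[OF f])
  also have "\<dots> = prim h (t - \<tau>)" unfolding prim_def by (rule lebesgue_on_integral_eq[symmetric]) auto
  finally show ?thesis .
qed

end

section \<open>Products of a time factor and a space factor, and memory terms\<close>

context evolution begin

lemma nrm_H01_eq: "H01s.nrm = H1_norm \<Omega>" by (rule ext) (rule H01s_nrm)

context
  fixes \<phi> \<phi>' :: "real \<Rightarrow> real" and \<psi> :: "'a \<Rightarrow> real"
  assumes D: "\<And>x. (\<phi> has_real_derivative \<phi>' x) (at x)" and c': "continuous_on UNIV \<phi>'" and psi: "\<psi> \<in> H01 \<Omega>"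
begin

lemma product_L2_Bochner_H01: "(\<lambda>t x. \<phi> t * \<psi> x) \<in> L2_Bochner 0 T (H01 \<Omega>) (H1_norm \<Omega>)"
proof -
  have "is_Bochner_integral I (H01 \<Omega>) H01s.nrm (\<lambda>t x. \<phi> t * \<psi> x) (\<lambda>x. (LINT t|I. \<phi> t) * \<psi> x)"
    by (rule H01s.scalar_mult_Bochner[OF finite_measure_I continuous_integrable_I[OF DERIV_continuous_on_UNIV[OF D]] psi])
  then have sm: "strongly_measurable I (H01 \<Omega>) H01s.nrm (\<lambda>t x. \<phi> t * \<psi> x)"
    unfolding is_Bochner_integral_def by (elim conjE)
  have "continuous_on UNIV (\<lambda>t. (\<phi> t)\<^sup>2 * (H01s.nrm \<psi>)\<^sup>2)" using DERIV_continuous_on_UNIV[OF D] by (intro continuous_intros)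
  from continuous_integrable_I[OF this]
  have "integrable I (\<lambda>t. (H01s.nrm (\<lambda>x. \<phi> t * \<psi> x))\<^sup>2)" by (simp add: H01s.nrm_scale[OF psi] power_mult_distrib)
  with sm show ?thesis unfolding L2_Bochner_def nrm_H01_eq by simp
qed

lemma product_deriv_L2_Bochner: "(\<lambda>t x. \<phi>' t * \<psi> x) \<in> L2_Bochner 0 T (L2 \<Omega>) (L2_norm \<Omega>)"
proof -
  have "is_Bochner_integral I (L2 \<Omega>) (L2i.nrm \<Omega>) (\<lambda>t x. \<phi>' t * \<psi> x) (\<lambda>x. (LINT t|I. \<phi>' t) * \<psi> x)"
    by (rule L2i.scalar_mult_Bochner[OF finite_measure_I continuous_integrable_I[OF c'] H01_L2[OF psi]])
  then have sm: "strongly_measurable I (L2 \<Omega>) (L2i.nrm \<Omega>) (\<lambda>t x. \<phi>' t * \<psi> x)"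
    unfolding is_Bochner_integral_def by (elim conjE)
  have "continuous_on UNIV (\<lambda>t. (\<phi>' t)\<^sup>2 * (L2i.nrm \<Omega> \<psi>)\<^sup>2)" using c' by (intro continuous_intros)
  from continuous_integrable_I[OF this]
  have "integrable I (\<lambda>t. (L2i.nrm \<Omega> (\<lambda>x. \<phi>' t * \<psi> x))\<^sup>2)" by (simp add: L2i.nrm_scale[OF H01_L2[OF psi]] power_mult_distrib)
  with sm show ?thesis unfolding L2_Bochner_def L2i_nrm by simp
qed

text \<open>Classical integration by parts for the scalar factors shows that both Bochner integrals
  are the same multiple of \<psi>.\<close>

lemma product_weak_time_deriv: "weak_time_deriv T \<Omega> (\<lambda>t x. \<phi> t * \<psi> x) (\<lambda>t x. \<phi>' t * \<psi> x)"
  unfolding weak_time_deriv_def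
proof (intro allI impI)
  fix \<theta> assume th: "test_fun {0<..<T} \<theta>"
  note dth = test_fun_deriv[OF th]
  have c1: "continuous_on UNIV (\<lambda>t. deriv \<theta> t * \<phi> t)" "continuous_on UNIV (\<lambda>t. - \<theta> t * \<phi>' t)"
    by (intro continuous_intros DERIV_continuous_on_UNIV[OF D] c' test_fun_continuous[OF dth(1)] test_fun_continuous[OF th])+
  note i = c1[THEN continuous_integrable_I]
  have "(LINT t|I. deriv \<theta> t * \<phi> t - (- \<theta> t * \<phi>' t)) = \<theta> T * \<phi> T - \<theta> 0 * \<phi> 0"
  proof (rule integral_deriv_interval(2))
    show "0 \<le> T" using T_pos by simp
    show "continuous_on {0..T} (\<lambda>t. deriv \<theta> t * \<phi> t - - \<theta> t * \<phi>' t)"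
      by (rule continuous_on_subset[OF continuous_on_diff[OF c1]]) auto
    show "((\<lambda>t. \<theta> t * \<phi> t) has_real_derivative deriv \<theta> x * \<phi> x - - \<theta> x * \<phi>' x) (at x within {0..T})" for x
      using DERIV_mult[OF dth(2) D, of x] by (auto intro: has_field_derivative_at_within simp: mult.commute)
  qed
  moreover have "\<theta> T = 0" "\<theta> 0 = 0" using test_fun_zero_outside[OF th] by auto
  ultimately have e: "(LINT t|I. deriv \<theta> t * \<phi> t) = (LINT t|I. - \<theta> t * \<phi>' t)"
    using Bochner_Integration.integral_diff[OF i] by simp
  have "is_Bochner_integral I (L2 \<Omega>) (L2_norm \<Omega>) (\<lambda>t x. (deriv \<theta> t * \<phi> t) * \<psi> x) (\<lambda>x. (LINT t|I. deriv \<theta> t * \<phi> t) * \<psi> x)"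
    using L2i.scalar_mult_Bochner[OF finite_measure_I i(1) H01_L2[OF psi]] unfolding L2i_nrm .
  moreover have "is_Bochner_integral I (L2 \<Omega>) (L2_norm \<Omega>) (\<lambda>t x. (- \<theta> t * \<phi>' t) * \<psi> x) (\<lambda>x. (LINT t|I. deriv \<theta> t * \<phi> t) * \<psi> x)"
    using L2i.scalar_mult_Bochner[OF finite_measure_I i(2) H01_L2[OF psi]] unfolding L2i_nrm e .
  ultimately show "\<exists>J. is_Bochner_integral I (L2 \<Omega>) (L2_norm \<Omega>) (\<lambda>t x. deriv \<theta> t * (\<phi> t * \<psi> x)) J \<and>
     is_Bochner_integral I (L2 \<Omega>) (L2_norm \<Omega>) (\<lambda>t x. - \<theta> t * (\<phi>' t * \<psi> x)) J"
    unfolding mult.assoc by (intro exI[of _ "\<lambda>x. (LINT t|I. deriv \<theta> t * \<phi> t) * \<psi> x"] conjI)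
qed

lemma product_U_space: "(\<lambda>t x. \<phi> t * \<psi> x) \<in> U_space T \<Omega>"
  unfolding U_space_def using product_L2_Bochner_H01 product_deriv_L2_Bochner product_weak_time_deriv by blast

text \<open>The chosen derivative of a product is known only for almost all times and up to a null
  set in space, hence a vanishing seminorm and not an equation. Membership in \<open>L2\<close> is
  part of the claim, as the value of a seminorm does not imply it.\<close>

lemma product_time_deriv:
  "AE t in I. time_deriv T \<Omega> (\<lambda>t x. \<phi> t * \<psi> x) t \<in> L2 \<Omega> \<and>
     L2_norm \<Omega> (\<lambda>x. time_deriv T \<Omega> (\<lambda>t x. \<phi> t * \<psi> x) t x - \<phi>' t * \<psi> x) = 0"
proof -
  let ?v = "\<lambda>t x. \<phi> t * \<psi> x" and ?w = "\<lambda>t x. \<phi>' t * \<psi> x"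
  obtain v' s B y r C where r: "H01s.regular I v' s B" "AE t in I. v' t = ?v t"
    "L2i.regular \<Omega> I y r C" "AE t in I. y t = time_deriv T \<Omega> ?v t" "weakly_deriv v' y"
    by (rule U_space_regular[OF product_U_space])
  obtain w' q E where w: "L2i.regular \<Omega> I w' q E" "AE t in I. w' t = ?w t"
    by (rule regularize_L2[OF product_deriv_L2_Bochner])
  have "weakly_deriv ?v ?w"
    by (rule weak_time_deriv_pairing[OF product_weak_time_deriv]) (auto intro!: AE_I2 L2i.scale_mem H01_L2[OF psi])
  from weakly_deriv_unique[OF r(5) weakly_deriv_cong_AE[OF this regular_H01_L2[OF r(1)] w(1) r(2) w(2)] r(3) w(1)]
  have "AE t in I. L2_norm \<Omega> (\<lambda>x. y t x - w' t x) = 0" .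
  with r(4) w(2) show ?thesis
  proof eventually_elim
    case (elim t)
    have "y t \<in> L2 \<Omega>" by (rule L2i.regularD(1)[OF r(3)])
    with elim show ?case by simp
  qed
qed

text \<open>The product is itself continuous in time, so uniqueness of continuous representatives
  transfers its zero at T to \<open>cont_rep\<close>.\<close>

lemma product_V_space:
  assumes "\<phi> T = 0" shows "(\<lambda>t x. \<phi> t * \<psi> x) \<in> V_space T \<Omega>"
proof -
  let ?v = "\<lambda>t x. \<phi> t * \<psi> x"
  have vC: "?v \<in> CL2" unfolding C_interval_def
  proof (intro CollectI ballI conjI L2i.scale_mem H01_L2[OF psi])
    fix t assume "t \<in> {0..T}"
    have "L2_norm \<Omega> (\<lambda>x. \<phi> s * \<psi> x - \<phi> t * \<psi> x) = \<bar>\<phi> s - \<phi> t\<bar> * L2_norm \<Omega> \<psi>" for s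
      using L2i.nrm_scale[OF H01_L2[OF psi], of "\<phi> s - \<phi> t"] by (simp add: left_diff_distrib L2i_nrm)
    moreover have "((\<lambda>s. \<bar>\<phi> s - \<phi> t\<bar> * L2_norm \<Omega> \<psi>) \<longlongrightarrow> \<bar>\<phi> t - \<phi> t\<bar> * L2_norm \<Omega> \<psi>) (at t within {0..T})"
      using DERIV_isCont[OF D[of t]] by (intro tendsto_intros) (auto simp: isCont_def intro: tendsto_within_subset)
    ultimately show "((\<lambda>s. L2_norm \<Omega> (\<lambda>x. \<phi> s * \<psi> x - \<phi> t * \<psi> x)) \<longlongrightarrow> 0) (at t within {0..T})" by simp
  qed
  note cr = U_space_cont_rep[OF product_U_space]
  have Tm: "T \<in> {0..T}" using T_pos by simp
  have n0: "L2_norm \<Omega> (\<lambda>x. cont_rep T \<Omega> ?v T x - \<phi> T * \<psi> x) = 0"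
    by (rule CL2_unique[OF cr(1) vC cr(2) Tm])
  have m: "(\<lambda>x. cont_rep T \<Omega> ?v T x - \<phi> T * \<psi> x) \<in> L2 \<Omega>"
    by (intro L2i.diff_mem CL2_mem[OF cr(1) Tm] L2i.scale_mem H01_L2[OF psi])
  have "AE x in lebesgue_on \<Omega>. cont_rep T \<Omega> ?v T x = 0"
    using L2_norm_0_AE[OF m n0] assms by simp
  then show ?thesis using product_U_space by (simp add: V_space_def)
qed

end

lemma L2_inner_null_right:
  fixes f k k' :: "'a \<Rightarrow> real"
  assumes "f \<in> L2 \<Omega>" "k \<in> L2 \<Omega>" "k' \<in> L2 \<Omega>" "L2_norm \<Omega> (\<lambda>x. k x - k' x) = 0"
  shows "L2_inner \<Omega> f k = L2_inner \<Omega> f k'"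
  using L2i.Cauchy_Schwarz[OF assms(1) L2i.diff_mem[OF assms(2,3)]] L2i.ip_diff_right[OF assms(2,3,1)] assms(4)
  by (simp add: L2i_nrm)

text \<open>A Volterra convolution, written over the fixed measure \<open>I\<close> for the same
  reason as \<open>prim\<close>.\<close>

definition memory :: "(real \<Rightarrow> real) \<Rightarrow> (real \<Rightarrow> real) \<Rightarrow> real \<Rightarrow> real" where
  "memory G k t = (LINT s|I. indicator {..<t} s * (G (t - s) * k s))"

lemma ind_kernel_measurable:
  fixes G :: "real \<Rightarrow> real"
  assumes "continuous_on UNIV G"
  shows "(\<lambda>x. indicator {..<fst x} (snd x) * G (fst x - snd x)) \<in> borel_measurable (I \<Otimes>\<^sub>M I)"
proof -
  have [measurable]: "G \<in> borel_measurable borel" using assms by (rule borel_measurable_continuous_onI)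
  have "(\<lambda>x. fst x - snd x) \<in> borel_measurable (I \<Otimes>\<^sub>M I)" by measurable
  then have "(\<lambda>x. G (fst x - snd x)) \<in> borel_measurable (I \<Otimes>\<^sub>M I)" by (rule measurable_compose) measurable
  then show ?thesis using ind_lt_measurable by (intro borel_measurable_times) 
qed

text \<open>On the triangle s < t the argument t - s stays in (0, T), so only the values of G on a
  compact interval matter.\<close>

lemma ind_kernel_bounded:
  fixes G :: "real \<Rightarrow> real"
  assumes "continuous_on UNIV G"
  obtains B where "\<And>x. x \<in> space (I \<Otimes>\<^sub>M I) \<Longrightarrow> \<bar>indicator {..<fst x} (snd x) * G (fst x - snd x)\<bar> \<le> B" "0 \<le> B"
proof -
  have "compact (G ` {0..T})" using assms by (intro compact_continuous_image) (auto intro: continuous_on_subset)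
  then obtain B where B: "\<forall>x\<in>{0..T}. \<bar>G x\<bar> \<le> B" by (auto dest!: compact_imp_bounded simp: bounded_iff)
  then have "0 \<le> B" using T_pos abs_ge_zero[of "G 0"] by (meson atLeastAtMost_iff less_imp_le order.refl order_trans)
  moreover have "\<bar>indicator {..<fst x} (snd x) * G (fst x - snd x)\<bar> \<le> B" if "x \<in> space (I \<Otimes>\<^sub>M I)" for x
    using that B \<open>0 \<le> B\<close> by (cases x) (auto simp: space_pair_measure indicator_def)
  ultimately show thesis using that by blast
qed

lemma memory_product_integrable:
  fixes G :: "real \<Rightarrow> real"
  assumes G: "continuous_on UNIV G" and p: "integrable I p" and k: "integrable I k"
  shows "integrable (I \<Otimes>\<^sub>M I) (\<lambda>x. (indicator {..<fst x} (snd x) * G (fst x - snd x)) * (p (fst x) * k (snd x)))"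
proof -
  obtain B where B: "\<And>x. x \<in> space (I \<Otimes>\<^sub>M I) \<Longrightarrow> \<bar>indicator {..<fst x} (snd x) * G (fst x - snd x) :: real\<bar> \<le> B" "0 \<le> B"
    using ind_kernel_bounded[OF G] by blast
  show ?thesis by (rule product_integrable_bounded[OF p k ind_kernel_measurable[OF G] B(1)])
qed

lemma memory_integrable:
  fixes G :: "real \<Rightarrow> real"
  assumes G: "continuous_on UNIV G" and k: "integrable I k"
  shows "integrable I (memory G k)"
    and "t \<in> {0<..<T} \<Longrightarrow> integrable I (\<lambda>s. indicator {..<t} s * (G (t - s) * k s))"
proof -
  have "integrable I (\<lambda>_. 1::real)" by simp
  from II.integrable_fst'[OF memory_product_integrable[OF G this k]]
  show "integrable I (memory G k)" by (simp add: memory_def[abs_def] mult.assoc)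
  assume t: "t \<in> {0<..<T}"
  obtain B where B: "\<And>x. x \<in> space (I \<Otimes>\<^sub>M I) \<Longrightarrow> \<bar>indicator {..<fst x} (snd x) * G (fst x - snd x) :: real\<bar> \<le> B" "0 \<le> B"
    using ind_kernel_bounded[OF G] by blast
  have [measurable]: "G \<in> borel_measurable borel" using G by (rule borel_measurable_continuous_onI)
  have "integrable I (\<lambda>s. (indicator {..<t} s * G (t - s)) * k s)"
  proof (rule integrable_bounded_mult[OF k])
    show "(\<lambda>s. indicator {..<t} s * G (t - s)) \<in> borel_measurable I" by (rule borel_measurable_I) measurable
    show "\<bar>indicator {..<t} s * G (t - s)\<bar> \<le> B" if "s \<in> space I" for s
      using B(1)[of "(t, s)"] that t by (simp add: space_pair_measure)
  qed
  then show "integrable I (\<lambda>s. indicator {..<t} s * (G (t - s) * k s))" by (simp add: mult.assoc)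
qed

text \<open>After Fubini the inner integral runs over r < s < t and equals G (t - r) - G 0.
  Integrating a memory term in time thus replaces its kernel by the primitive of the kernel.\<close>

lemma prim_memory:
  assumes G: "continuous_on UNIV g" "\<And>x. (G has_real_derivative g x) (at x)" "G 0 = 0" and k: "integrable I k" and t: "t \<in> {0<..<T}"
  shows "prim (memory g k) t = memory G k t"
proof -
  have p: "integrable I (\<lambda>s. indicator {..<t} s :: real)" using ind_mult_integrable[of "\<lambda>_. 1" t] by simp
  let ?K = "\<lambda>s r. (indicator {..<s} r * g (s - r)) * (indicator {..<t} s * k r) :: real"
  have K: "integrable (I \<Otimes>\<^sub>M I) (case_prod ?K)"
    using memory_product_integrable[OF G(1) p k] by (simp add: split_beta')
  have "prim (memory g k) t = (LINT s|I. (LINT r|I. ?K s r))"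
    unfolding prim_def memory_def
    by (intro Bochner_Integration.integral_cong refl, subst integral_mult_right_zero[symmetric])
      (intro Bochner_Integration.integral_cong refl, simp add: ac_simps)
  also have "\<dots> = (LINT r|I. (LINT s|I. ?K s r))" using II.Fubini_integral[OF K] by simp
  also have "\<dots> = (LINT r|I. indicator {..<t} r * (G (t - r) * k r))"
  proof (intro Bochner_Integration.integral_cong refl)
    fix r assume "r \<in> space I"
    then have r: "0 < r" "r < T" by auto
    have "(LINT s|I. ?K s r) = k r * (LINT s|I. indicator {..<s} r * (indicator {..<t} s * g (s - r)))"
      by (subst integral_mult_right_zero[symmetric]) (intro Bochner_Integration.integral_cong refl, simp add: ac_simps)
    also have "(LINT s|I. indicator {..<s} r * (indicator {..<t} s * g (s - r))) = indicator {..<t} r * G (t - r)"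
    proof (cases "r < t")
      case True
      have "(LINT s|I. indicator {..<s} r * (indicator {..<t} s * g (s - r)))
          = (LINT s|lebesgue. indicator {0<..<T} s * (indicator {..<s} r * (indicator {..<t} s * g (s - r))))"
        by (rule lebesgue_on_integral_eq) auto
      also have "\<dots> = (LINT s|lebesgue. indicator {r<..<t} s * g (s - r))"
        using r t by (intro Bochner_Integration.integral_cong) (auto simp: indicator_def)
      also have "\<dots> = (LINT s|lebesgue_on {r<..<t}. g (s - r))" by (rule lebesgue_on_integral_eq[symmetric]) auto
      also have "\<dots> = G (t - r) - G (r - r)"
      proof (rule integral_deriv_interval(2))
        show "continuous_on {r..t} (\<lambda>s. g (s - r))"
          by (rule continuous_on_compose2[OF G(1)]) (auto intro: continuous_intros)
        show "((\<lambda>s. G (s - r)) has_real_derivative g (x - r)) (at x within {r..t})" for x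
        proof -
          have "((\<lambda>s. s - r) has_real_derivative 1) (at x within {r..t})" by (auto intro!: derivative_eq_intros)
          from DERIV_chain2[OF G(2) this] show ?thesis by simp
        qed
      qed (use True in simp)
      finally show ?thesis using True G(3) by simp
    next
      case False
      then have "indicator {..<s} r * (indicator {..<t} s * g (s - r)) = (0::real)" for s by (auto simp: indicator_def)
      then show ?thesis using False by (simp only: Bochner_Integration.integral_zero) simp
    qed
    finally show "(LINT s|I. ?K s r) = indicator {..<t} r * (G (t - r) * k r)" by simp
  qed
  also have "\<dots> = memory G k t" by (simp add: memory_def)
  finally show ?thesis .
qed

end

section \<open>The equation for the difference of two solutions\<close>

context time_interval begin

lemma continuous_mult_integrable_I:
  fixes \<phi> f :: "real \<Rightarrow> real"
  assumes c: "continuous_on UNIV \<phi>" and f: "integrable I f" shows "integrable I (\<lambda>t. \<phi> t * f t)"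
proof -
  have "compact (\<phi> ` {0..T})" using c by (intro compact_continuous_image) (auto intro: continuous_on_subset)
  then obtain B where B: "\<forall>x\<in>{0..T}. \<bar>\<phi> x\<bar> \<le> B" by (auto dest!: compact_imp_bounded simp: bounded_iff)
  show ?thesis by (rule integrable_bounded_mult[OF f continuous_measurable_I[OF c]]) (use B in auto)
qed

lemma I_AE_eqI:
  fixes f h :: "real \<Rightarrow> real"
  assumes "integrable I f" "AE t in I. f t = h t" shows "(LINT t|I. h t) = (LINT t|I. f t)"
  by (rule I.integral_cong_AE_complete(2)[OF assms])

end

section \<open>Testing the weak formulation and integrating in time\<close>

context evolution begin

text \<open>The defining identity at a product, rewritten by means of representatives that are
  regular at every time, so that two such identities can be subtracted. The delayed term is split at
  \<tau> into the part carrying the history and the part carrying the solution.\<close>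

lemma weak_identity:
  assumes sol: "weak_solution \<Omega> T \<tau> g \<mu>1 \<mu>2 u0 u1 f0 u" and tau: "0 < \<tau>"
    and gg: "continuous_on UNIV gg" "\<And>x. 0 < x \<Longrightarrow> gg x = g x"
    and u: "H01s.regular I u' s B" "AE t in I. u' t = u t"
    and y: "L2i.regular \<Omega> I y r C" "AE t in I. y t = time_deriv T \<Omega> u t"
    and f: "L2i.regular \<Omega> (lebesgue_on {- \<tau><..<0}) f q E" "AE t in lebesgue_on {- \<tau><..<0}. f t = f0 t"
    and D: "\<And>x. (\<phi> has_real_derivative \<phi>' x) (at x)" and c': "continuous_on UNIV \<phi>'" and psi: "\<psi> \<in> H01 \<Omega>"
    and phiT: "\<phi> T = 0"
  shows "- (LINT t|I. \<phi>' t * L2_inner \<Omega> (y t) \<psi>) + (LINT t|I. \<phi> t * grad_inner (u' t) \<psi>)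
     - (LINT t|I. \<phi> t * memory gg (\<lambda>t. grad_inner (u' t) \<psi>) t)
     + \<mu>1 * (LINT t|I. \<phi> t * L2_inner \<Omega> (y t) \<psi>)
     + \<mu>2 * ((LINT t|I. \<phi> t * (indicator {..<\<tau>} t * L2_inner \<Omega> (f (t - \<tau>)) \<psi>))
        + (LINT t|I. \<phi> t * (indicator {\<tau>..} t * L2_inner \<Omega> (y (t - \<tau>)) \<psi>)))
     = L2_inner \<Omega> u1 (cont_rep T \<Omega> (\<lambda>t x. \<phi> t * \<psi> x) 0)"
proof -
  let ?v = "\<lambda>t x. \<phi> t * \<psi> x"
  let ?Y = "\<lambda>t. L2_inner \<Omega> (y t) \<psi>" and ?k = "\<lambda>t. grad_inner (u' t) \<psi>"
  have c: "continuous_on UNIV \<phi>" by (rule DERIV_continuous_on_UNIV[OF D])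
  have psi2: "\<psi> \<in> L2 \<Omega>" by (rule H01_L2[OF psi])
  have Yi: "integrable I ?Y" by (rule L2i.ip_const_integrable[OF finite_measure_I y(1) psi2])
  have ki: "integrable I ?k" by (rule H01g.ip_const_integrable[OF finite_measure_I regular_H01_grad[OF u(1)] psi])
  have yX: "y t \<in> L2 \<Omega>" and uX: "u' t \<in> H01 \<Omega>" and fX: "f t \<in> L2 \<Omega>" for t
    by (rule L2i.regularD(1)[OF y(1)], rule H01s.regularD(1)[OF u(1)], rule L2i.regularD(1)[OF f(1)])
  have "?v \<in> V_space T \<Omega>" by (rule product_V_space[OF D c' psi phiT])
  from sol[unfolded weak_solution_def, THEN conjunct2, THEN conjunct1, THEN bspec, OF this]
  have main: "- (LINT t|I. L2_inner \<Omega> (time_deriv T \<Omega> u t) (time_deriv T \<Omega> ?v t))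
        + (LINT t|I. L2_inner \<Omega> (grad \<Omega> (u t)) (grad \<Omega> (?v t)))
        - (LINT t|I. LINT s|lebesgue_on {0<..<t}. g (t - s) * L2_inner \<Omega> (grad \<Omega> (u s)) (grad \<Omega> (?v t)))
        + \<mu>1 * (LINT t|I. L2_inner \<Omega> (time_deriv T \<Omega> u t) (?v t))
        + \<mu>2 * (LINT t|I. L2_inner \<Omega> (delayed_deriv T \<Omega> \<tau> f0 u t) (?v t))
        - L2_inner \<Omega> u1 (cont_rep T \<Omega> ?v 0) = 0" .
  have T1: "(LINT t|I. L2_inner \<Omega> (time_deriv T \<Omega> u t) (time_deriv T \<Omega> ?v t)) = (LINT t|I. \<phi>' t * ?Y t)"
  proof (rule I_AE_eqI[OF continuous_mult_integrable_I[OF c' Yi]])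
    show "AE t in I. \<phi>' t * ?Y t = L2_inner \<Omega> (time_deriv T \<Omega> u t) (time_deriv T \<Omega> ?v t)"
      using y(2) product_time_deriv[OF D c' psi]
    proof eventually_elim
      case (elim t)
      have "L2_inner \<Omega> (y t) (time_deriv T \<Omega> ?v t) = L2_inner \<Omega> (y t) (\<lambda>x. \<phi>' t * \<psi> x)"
        using elim(2) by (intro L2_inner_null_right yX L2i.scale_mem psi2) auto
      also have "\<dots> = \<phi>' t * ?Y t" by (rule L2i.ip_scale_right[OF psi2 yX])
      finally show ?case using elim(1) by simp
    qed
  qed
  have gr: "grad_inner (u' t) (?v r) = \<phi> r * ?k t" for t r
    by (rule H01g.ip_scale_right[OF psi uX])
  have T2: "(LINT t|I. L2_inner \<Omega> (grad \<Omega> (u t)) (grad \<Omega> (?v t))) = (LINT t|I. \<phi> t * ?k t)"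
  proof (rule I_AE_eqI[OF continuous_mult_integrable_I[OF c ki]])
    show "AE t in I. \<phi> t * ?k t = L2_inner \<Omega> (grad \<Omega> (u t)) (grad \<Omega> (?v t))"
      using u(2)
    proof eventually_elim
      case (elim t)
      show ?case using gr[of t t] unfolding grad_inner_def elim by simp
    qed
  qed
  have T3: "(LINT t|I. LINT s|lebesgue_on {0<..<t}. g (t - s) * L2_inner \<Omega> (grad \<Omega> (u s)) (grad \<Omega> (?v t)))
      = (LINT t|I. \<phi> t * memory gg ?k t)"
  proof (intro Bochner_Integration.integral_cong refl)
    fix t assume "t \<in> space I"
    then have t: "t \<in> {0<..<T}" by simp
    have "(LINT s|lebesgue_on {0<..<t}. g (t - s) * L2_inner \<Omega> (grad \<Omega> (u s)) (grad \<Omega> (?v t)))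
      = (LINT s|I. indicator {..<t} s * (g (t - s) * L2_inner \<Omega> (grad \<Omega> (u s)) (grad \<Omega> (?v t))))"
      using t by (subst integral_ind_lt[symmetric]) (auto simp: prim_def)
    also have "\<dots> = (LINT s|I. \<phi> t * (indicator {..<t} s * (gg (t - s) * ?k s)))"
    proof (rule I_AE_eqI)
      show "integrable I (\<lambda>s. \<phi> t * (indicator {..<t} s * (gg (t - s) * ?k s)))"
        by (intro integrable_mult_right memory_integrable(2)[OF gg(1) ki t])
      show "AE s in I. \<phi> t * (indicator {..<t} s * (gg (t - s) * ?k s)) = indicator {..<t} s * (g (t - s) * L2_inner \<Omega> (grad \<Omega> (u s)) (grad \<Omega> (?v t)))"
        using u(2)
      proof eventually_elim
        case (elim s)
        have "L2_inner \<Omega> (grad \<Omega> (u s)) (grad \<Omega> (?v t)) = \<phi> t * ?k s"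
          using gr[of s t] unfolding grad_inner_def elim by simp
        then show ?case using gg(2)[of "t - s"] by (auto simp: indicator_def)
      qed
    qed
    also have "\<dots> = \<phi> t * memory gg ?k t" unfolding memory_def by (rule integral_mult_right_zero)
    finally show "(LINT s|lebesgue_on {0<..<t}. g (t - s) * L2_inner \<Omega> (grad \<Omega> (u s)) (grad \<Omega> (?v t))) = \<phi> t * memory gg ?k t" .
  qed
  have T4: "(LINT t|I. L2_inner \<Omega> (time_deriv T \<Omega> u t) (?v t)) = (LINT t|I. \<phi> t * ?Y t)"
  proof (rule I_AE_eqI[OF continuous_mult_integrable_I[OF c Yi]])
    show "AE t in I. \<phi> t * ?Y t = L2_inner \<Omega> (time_deriv T \<Omega> u t) (?v t)"
      using y(2)
    proof eventually_elim
      case (elim t)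
      show ?case using L2i.ip_scale_right[OF psi2 yX[of t], of "\<phi> t"] unfolding elim by simp
    qed
  qed
  have fm: "finite_measure (lebesgue_on {- \<tau><..<0})" by (intro finite_measure_lebesgue_on) auto
  have i1: "integrable I (\<lambda>t. \<phi> t * (indicator {..<\<tau>} t * L2_inner \<Omega> (f (t - \<tau>)) \<psi>))"
    by (rule continuous_mult_integrable_I[OF c shift_history[OF L2i.ip_const_integrable[OF fm f(1) psi2]]])
  have i2: "integrable I (\<lambda>t. \<phi> t * (indicator {\<tau>..} t * ?Y (t - \<tau>)))"
    by (rule continuous_mult_integrable_I[OF c shift_integrable[OF Yi tau]])
  have T5: "(LINT t|I. L2_inner \<Omega> (delayed_deriv T \<Omega> \<tau> f0 u t) (?v t))
      = (LINT t|I. \<phi> t * (indicator {..<\<tau>} t * L2_inner \<Omega> (f (t - \<tau>)) \<psi>) + \<phi> t * (indicator {\<tau>..} t * ?Y (t - \<tau>)))"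
  proof (rule I_AE_eqI[OF Bochner_Integration.integrable_add[OF i1 i2]])
    show "AE t in I. \<phi> t * (indicator {..<\<tau>} t * L2_inner \<Omega> (f (t - \<tau>)) \<psi>) + \<phi> t * (indicator {\<tau>..} t * ?Y (t - \<tau>))
       = L2_inner \<Omega> (delayed_deriv T \<Omega> \<tau> f0 u t) (?v t)"
      using AE_history[OF f(2)] AE_shift[OF y(2) tau]
    proof eventually_elim
      case (elim t)
      show ?case
      proof (cases "t < \<tau>")
        case True
        then have e: "delayed_deriv T \<Omega> \<tau> f0 u t = f (t - \<tau>)" using elim(1) by (simp add: delayed_deriv_def)
        show ?thesis unfolding e using True L2i.ip_scale_right[OF psi2 fX[of "t - \<tau>"], of "\<phi> t"] by simp
      next
        case False
        then have e: "delayed_deriv T \<Omega> \<tau> f0 u t = y (t - \<tau>)" using elim(2) by (simp add: delayed_deriv_def)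
        show ?thesis unfolding e using False L2i.ip_scale_right[OF psi2 yX[of "t - \<tau>"], of "\<phi> t"] by simp
      qed
    qed
  qed
  show ?thesis
    using main unfolding T1 T2 T3 T4 T5 Bochner_Integration.integral_add[OF i1 i2] by simp
qed

text \<open>The time factor \<phi> vanishes at T but is otherwise only an antiderivative of a test
  function. So the integration in time is built into the test, and no unknown constant appears. The
  value of \<phi> at 0 is arbitrary; the boundary term it causes involves only u1 and the test
  function, hence is the same for both solutions and cancels.\<close>

lemma difference_equation:
  assumes sol: "weak_solution \<Omega> T \<tau> g \<mu>1 \<mu>2 u0 u1 f0 u" "weak_solution \<Omega> T \<tau> g \<mu>1 \<mu>2 u0 u1 f0 w"
    and tau: "0 < \<tau>" and f0: "f0 \<in> L2_Bochner (- \<tau>) 0 (L2 \<Omega>) (L2_norm \<Omega>)"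
    and gg: "continuous_on UNIV gg" "\<And>x. 0 < x \<Longrightarrow> gg x = g x"
    and G: "\<And>x. (G has_real_derivative gg x) (at x)" "G 0 = 0"
  obtains z s B y r C where "H01s.regular I z s B" "L2i.regular \<Omega> I y r C" "weakly_deriv z y"
    "AE t in I. z t = (\<lambda>x. u t x - w t x)"
    "\<forall>\<psi>\<in>H01 \<Omega>. AE t in I. L2_inner \<Omega> (y t) \<psi> + memory (\<lambda>x. 1 - G x) (\<lambda>t. grad_inner (z t) \<psi>) t
       + \<mu>1 * prim (\<lambda>t. L2_inner \<Omega> (y t) \<psi>) t + \<mu>2 * prim (\<lambda>t. L2_inner \<Omega> (y t) \<psi>) (t - \<tau>) = 0"
proof -
  have U: "u \<in> U_space T \<Omega>" "w \<in> U_space T \<Omega>" using sol unfolding weak_solution_def by blast+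
  obtain u' s1 B1 y1 r1 C1 where u: "H01s.regular I u' s1 B1" "AE t in I. u' t = u t"
    "L2i.regular \<Omega> I y1 r1 C1" "AE t in I. y1 t = time_deriv T \<Omega> u t" "weakly_deriv u' y1"
    by (rule U_space_regular[OF U(1)])
  obtain w' s2 B2 y2 r2 C2 where w: "H01s.regular I w' s2 B2" "AE t in I. w' t = w t"
    "L2i.regular \<Omega> I y2 r2 C2" "AE t in I. y2 t = time_deriv T \<Omega> w t" "weakly_deriv w' y2"
    by (rule U_space_regular[OF U(2)])
  have fm: "finite_measure (lebesgue_on {- \<tau><..<0})" by (intro finite_measure_lebesgue_on) auto
  have f0': "strongly_measurable (lebesgue_on {- \<tau><..<0}) (L2 \<Omega>) (L2i.nrm \<Omega>) f0" "integrable (lebesgue_on {- \<tau><..<0}) (\<lambda>t. (L2i.nrm \<Omega> (f0 t))\<^sup>2)"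
    using f0 by (simp_all add: L2_Bochner_def L2i_nrm)
  obtain f q E where f: "L2i.regular \<Omega> (lebesgue_on {- \<tau><..<0}) f q E" "AE t in lebesgue_on {- \<tau><..<0}. f t = f0 t"
    by (rule L2i.regularize[OF fm f0'])
  let ?z = "\<lambda>t x. 1 * u' t x + (-1) * w' t x" and ?y = "\<lambda>t x. 1 * y1 t x + (-1) * y2 t x"
  have z: "H01s.regular I ?z (\<lambda>k t x. 1 * s1 k t x + (-1) * s2 k t x) (\<lambda>t. \<bar>1\<bar> * B1 t + \<bar>-1\<bar> * B2 t)"
    by (rule H01s.regular_lin[OF u(1) w(1)])
  have y: "L2i.regular \<Omega> I ?y (\<lambda>k t x. 1 * r1 k t x + (-1) * r2 k t x) (\<lambda>t. \<bar>1\<bar> * C1 t + \<bar>-1\<bar> * C2 t)"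
    by (rule L2i.regular_lin[OF u(3) w(3)])
  have wd: "weakly_deriv ?z ?y"
    using weakly_deriv_diff[OF u(5) w(5) regular_H01_L2[OF u(1)] regular_H01_L2[OF w(1)] u(3) w(3)] by simp
  have zeq: "AE t in I. ?z t = (\<lambda>x. u t x - w t x)"
    using u(2) w(2) by eventually_elim simp
  have eq: "AE t in I. L2_inner \<Omega> (?y t) \<psi> + memory (\<lambda>x. 1 - G x) (\<lambda>t. grad_inner (?z t) \<psi>) t
       + \<mu>1 * prim (\<lambda>t. L2_inner \<Omega> (?y t) \<psi>) t + \<mu>2 * prim (\<lambda>t. L2_inner \<Omega> (?y t) \<psi>) (t - \<tau>) = 0"
    if psi: "\<psi> \<in> H01 \<Omega>" for \<psi>
  proof -
    let ?Y = "\<lambda>t. L2_inner \<Omega> (?y t) \<psi>" and ?k = "\<lambda>t. grad_inner (?z t) \<psi>"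
    let ?Y1 = "\<lambda>t. L2_inner \<Omega> (y1 t) \<psi>" and ?Y2 = "\<lambda>t. L2_inner \<Omega> (y2 t) \<psi>"
    let ?k1 = "\<lambda>t. grad_inner (u' t) \<psi>" and ?k2 = "\<lambda>t. grad_inner (w' t) \<psi>"
    have psi2: "\<psi> \<in> L2 \<Omega>" by (rule H01_L2[OF psi])
    have Yi: "integrable I ?Y" "integrable I ?Y1" "integrable I ?Y2"
      by (rule L2i.ip_const_integrable[OF finite_measure_I _ psi2], rule y u w)+
    have ki: "integrable I ?k" "integrable I ?k1" "integrable I ?k2"
      by (rule H01g.ip_const_integrable[OF finite_measure_I regular_H01_grad psi], rule z u w)+
    have Y: "?Y t = ?Y1 t - ?Y2 t" for t
      by (subst L2i.ip_lin[OF L2i.regularD(1)[OF u(3)] L2i.regularD(1)[OF w(3)] psi2]) simp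
    have k: "?k t = ?k1 t - ?k2 t" for t
      by (subst H01g.ip_lin[OF H01s.regularD(1)[OF u(1)] H01s.regularD(1)[OF w(1)] psi]) simp
    define m where "m = memory gg ?k"
    have mi: "integrable I m" unfolding m_def by (rule memory_integrable(1)[OF gg(1) ki(1)])
    have m: "m t = memory gg ?k1 t - memory gg ?k2 t" if t: "t \<in> {0<..<T}" for t
      unfolding m_def memory_def k right_diff_distrib
      by (rule Bochner_Integration.integral_diff[OF memory_integrable(2)[OF gg(1) ki(2) t] memory_integrable(2)[OF gg(1) ki(3) t]])
    have mi12: "integrable I (memory gg ?k1)" "integrable I (memory gg ?k2)"
      by (rule memory_integrable(1)[OF gg(1) ki(2)], rule memory_integrable(1)[OF gg(1) ki(3)])
    \<comment> \<open>For t < \<tau> both solutions carry the same history, so only the part after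
      time \<tau> survives in the difference.\<close>
    define S where "S t = indicator {\<tau>..} t * ?Y (t - \<tau>)" for t
    have Si: "integrable I S" unfolding S_def by (rule shift_integrable[OF Yi(1) tau])
    \<comment> \<open>R collects all terms of the equation for the difference apart from the second
      time derivative.\<close>
    define R where "R t = ?k t - m t + (\<mu>1 * ?Y t + \<mu>2 * S t)" for t
    have Ri: "integrable I R" unfolding R_def using ki mi Yi Si by auto
    have "AE t in I. ?Y t + prim R t = 0"
    proof (rule fundamental_lemma)
      show "integrable I (\<lambda>t. ?Y t + prim R t)" using Yi prim_integrable[OF Ri] by auto
      fix \<xi> assume xi: "test_fun {0<..<T} \<xi>"
      obtain F where F: "\<And>x. (F has_real_derivative \<xi> x) (at x)"
        using continuous_antiderivative[OF test_fun_continuous[OF xi]] by blast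
      \<comment> \<open>Normalised at T, where test functions in \<open>V_space\<close> have to
        vanish.\<close>
      define \<phi> where "\<phi> x = F x - F T" for x
      have D: "(\<phi> has_real_derivative \<xi> x) (at x)" for x unfolding \<phi>_def using F[of x] by (auto intro!: derivative_eq_intros)
      have c: "continuous_on UNIV \<phi>" by (rule DERIV_continuous_on_UNIV[OF D])
      have p0: "\<phi> T = 0" by (simp add: \<phi>_def)
      note ci = continuous_mult_integrable_I[OF c]
      note cx = bounded_mult_I[OF _ xi]
      note W1 = weak_identity[OF sol(1) tau gg u(1,2) u(3,4) f D test_fun_continuous[OF xi] psi p0]
      note W2 = weak_identity[OF sol(2) tau gg w(1,2) w(3,4) f D test_fun_continuous[OF xi] psi p0]
      have e1: "(LINT t|I. \<xi> t * ?Y t) = (LINT t|I. \<xi> t * ?Y1 t) - (LINT t|I. \<xi> t * ?Y2 t)"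
        unfolding Y right_diff_distrib by (rule Bochner_Integration.integral_diff[OF cx[OF Yi(2)] cx[OF Yi(3)]])
      have e2: "(LINT t|I. \<phi> t * ?k t) = (LINT t|I. \<phi> t * ?k1 t) - (LINT t|I. \<phi> t * ?k2 t)"
        unfolding k right_diff_distrib by (rule Bochner_Integration.integral_diff[OF ci[OF ki(2)] ci[OF ki(3)]])
      have "(LINT t|I. \<phi> t * m t) = (LINT t|I. \<phi> t * memory gg ?k1 t - \<phi> t * memory gg ?k2 t)"
        by (intro Bochner_Integration.integral_cong refl) (simp add: m right_diff_distrib)
      then have e3: "(LINT t|I. \<phi> t * m t) = (LINT t|I. \<phi> t * memory gg ?k1 t) - (LINT t|I. \<phi> t * memory gg ?k2 t)"
        using Bochner_Integration.integral_diff[OF ci[OF mi12(1)] ci[OF mi12(2)]] by simp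
      have e4: "(LINT t|I. \<phi> t * ?Y t) = (LINT t|I. \<phi> t * ?Y1 t) - (LINT t|I. \<phi> t * ?Y2 t)"
        unfolding Y right_diff_distrib by (rule Bochner_Integration.integral_diff[OF ci[OF Yi(2)] ci[OF Yi(3)]])
      have e5: "(LINT t|I. \<phi> t * S t) = (LINT t|I. \<phi> t * (indicator {\<tau>..} t * ?Y1 (t - \<tau>))) - (LINT t|I. \<phi> t * (indicator {\<tau>..} t * ?Y2 (t - \<tau>)))"
        unfolding S_def Y right_diff_distrib
        by (rule Bochner_Integration.integral_diff[OF ci[OF shift_integrable[OF Yi(2) tau]] ci[OF shift_integrable[OF Yi(3) tau]]])
      have weak: "- (LINT t|I. \<xi> t * ?Y t) + (LINT t|I. \<phi> t * ?k t) - (LINT t|I. \<phi> t * m t)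
          + \<mu>1 * (LINT t|I. \<phi> t * ?Y t) + \<mu>2 * (LINT t|I. \<phi> t * S t) = 0"
        using W1 W2 unfolding e1 e2 e3 e4 e5 by (simp add: algebra_simps)
      have "(LINT t|I. \<phi> t * R t) = (LINT t|I. (\<phi> t * ?k t - \<phi> t * m t) + (\<mu>1 * (\<phi> t * ?Y t) + \<mu>2 * (\<phi> t * S t)))"
        by (intro Bochner_Integration.integral_cong refl) (simp add: R_def algebra_simps)
      also have "\<dots> = (LINT t|I. \<phi> t * ?k t) - (LINT t|I. \<phi> t * m t) + (\<mu>1 * (LINT t|I. \<phi> t * ?Y t) + \<mu>2 * (LINT t|I. \<phi> t * S t))"
        using ci[OF ki(1)] ci[OF mi] ci[OF Yi(1)] ci[OF Si]
        by (simp add: Bochner_Integration.integral_add Bochner_Integration.integral_diff)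
      finally have R: "(LINT t|I. \<phi> t * R t) = (LINT t|I. \<xi> t * ?Y t)" using weak by linarith
      have "(LINT t|I. \<xi> t * prim R t) = (LINT s|I. R s * (LINT t|I. indicator {s<..} t * \<xi> t))"
        by (rule prim_swap(1)[OF test_fun_integrable[OF xi] Ri])
      also have "\<dots> = (LINT s|I. - (\<phi> s * R s))"
      proof (intro Bochner_Integration.integral_cong refl)
        fix s assume "s \<in> space I"
        then have s: "0 < s" "s < T" by auto
        have "(LINT t|I. indicator {s<..} t * \<xi> t) = \<phi> T - \<phi> s"
          using s integral_deriv_interval(2)[of s T \<xi> \<phi>] test_fun_continuous[OF xi] D
          by (subst integral_ind_gt) (auto intro: continuous_on_subset has_field_derivative_at_within)
        then show "R s * (LINT t|I. indicator {s<..} t * \<xi> t) = - (\<phi> s * R s)" using p0 by simp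
      qed
      finally have P: "(LINT t|I. \<xi> t * prim R t) = - (LINT t|I. \<phi> t * R t)" by simp
      show "(LINT t|I. \<xi> t * (?Y t + prim R t)) = 0"
        unfolding distrib_left Bochner_Integration.integral_add[OF cx[OF Yi(1)] cx[OF prim_integrable[OF Ri]]] P R by simp
    qed auto
    with AE_space show ?thesis
    proof eventually_elim
      case (elim t)
      then have t: "t \<in> {0<..<T}" by simp
      \<comment> \<open>R is spelled out with explicit coefficients so that linearity of
        \<open>prim\<close> applies three times.\<close>
      have "prim R t = prim (\<lambda>t. 1 * (1 * ?k t + (-1) * m t) + 1 * (\<mu>1 * ?Y t + \<mu>2 * S t)) t"
        unfolding R_def by simp
      also have "\<dots> = (prim ?k t - prim m t) + (\<mu>1 * prim ?Y t + \<mu>2 * prim S t)"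
        using ki mi Yi Si by (subst prim_lin, simp, simp, subst prim_lin, simp, simp, subst prim_lin, simp, simp, simp)
      also have "prim S t = prim ?Y (t - \<tau>)" unfolding S_def by (rule prim_shift[OF Yi(1) tau]) (use t in simp)
      also have "prim m t = memory G ?k t" unfolding m_def by (rule prim_memory[OF gg(1) G ki(1) t])
      \<comment> \<open>A primitive is the memory term with constant kernel 1; subtracting the
        integrated memory term leaves the kernel 1 - G.\<close>
      also have "prim ?k t - memory G ?k t = memory (\<lambda>x. 1 - G x) ?k t"
      proof -
        have cG: "continuous_on UNIV G" by (rule DERIV_continuous_on_UNIV[OF G(1)])
        have c1: "continuous_on UNIV (\<lambda>x::real. 1::real)" by simp
        show ?thesis
          using Bochner_Integration.integral_diff[OF memory_integrable(2)[OF c1 ki(1) t] memory_integrable(2)[OF cG ki(1) t]]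
          by (simp add: prim_def memory_def left_diff_distrib right_diff_distrib)
      qed
      finally show ?case using elim by simp
    qed
  qed
  show thesis
    by (rule that[OF z y wd zeq]) (intro ballI eq)
qed

end

section \<open>Gronwall's inequality and Polya's criterion\<close>

context time_interval begin

lemma continuous_clamp:
  fixes f :: "real \<Rightarrow> real"
  assumes "continuous_on {0..T} f" shows "continuous_on UNIV (\<lambda>x. f (max 0 (min T x)))"
  by (rule continuous_on_compose2[OF assms]) (use T_pos in \<open>auto intro!: continuous_intros\<close>)

lemma continuous_on_integrable_I:
  fixes f :: "real \<Rightarrow> real"
  assumes "continuous_on {0..T} f" shows "integrable I f"
proof (rule I.integral_cong_AE_complete(1)[OF continuous_integrable_I[OF continuous_clamp[OF assms]]])
  show "AE x in I. f (max 0 (min T x)) = f x" by (intro AE_I2) (auto simp: min_def max_def)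
qed

lemma prim_nonneg_mono:
  assumes h: "integrable I h" and nn: "\<And>t. t \<in> {0<..<T} \<Longrightarrow> 0 \<le> h t" and st: "s \<le> t"
  shows "prim h s \<le> prim h t"
proof -
  have "0 \<le> prim h t - prim h s"
    unfolding prim_diff[OF h st] using nn by (intro Bochner_Integration.integral_nonneg) (auto simp: indicator_def)
  then show ?thesis by simp
qed

lemma prim_mono_AE:
  assumes "integrable I f" "integrable I h" "AE t in I. f t \<le> h t" shows "prim f t \<le> prim h t"
  unfolding prim_def using assms(3)
  by (intro integral_mono_AE ind_mult_integrable assms(1,2)) (auto elim!: eventually_mono intro: mult_left_mono)

text \<open>The primitive of E times exp (- C x) is nonincreasing and starts at 0, so the primitive
  is nonpositive. As E is nonnegative the primitive vanishes, and the hypothesis then squeezes E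
  itself to 0.\<close>

lemma Gronwall_zero:
  fixes E :: "real \<Rightarrow> real"
  assumes E: "continuous_on {0..T} E" and nn: "\<And>t. t \<in> {0..T} \<Longrightarrow> 0 \<le> E t"
    and le: "\<And>t. t \<in> {0..T} \<Longrightarrow> E t \<le> C * prim E t" and t: "t \<in> {0..T}"
  shows "E t = 0"
proof -
  \<comment> \<open>Extending E by constants beyond both end points makes its primitive
    differentiable from both sides at 0 and T.\<close>
  let ?E = "\<lambda>x. E (max 0 (min T x))"
  note cE = continuous_clamp[OF E]
  obtain F where F: "\<And>x. (F has_real_derivative ?E x) (at x)" using continuous_antiderivative[OF cE] by blast
  have Ee: "?E b = E b" if "b \<in> {0..T}" for b using that by (auto simp: min_def max_def)
  have P: "prim E b = F b - F 0" if b: "b \<in> {0..T}" for b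
  proof -
    have "prim E b = (LINT s|lebesgue_on {0<..<b}. E s)" using b by (intro integral_ind_lt) auto
    also have "\<dots> = (LINT s|lebesgue_on {0<..<b}. ?E s)"
      using b by (intro Bochner_Integration.integral_cong refl) (auto simp: min_def max_def)
    also have "\<dots> = F b - F 0"
      by (rule integral_deriv_interval(2)[where F=F])
        (use b in simp, rule continuous_on_subset[OF cE], simp, rule has_field_derivative_at_within[OF F])
    finally show ?thesis .
  qed
  let ?h = "\<lambda>x. (F x - F 0) * exp (- C * x)"
  have "?h t \<le> ?h 0"
  proof (rule DERIV_nonpos_imp_nonincreasing[of 0 t ?h])
    show "0 \<le> t" using t by simp
    fix x assume x: "0 \<le> x" "x \<le> t"
    then have xT: "x \<in> {0..T}" using t by simp
    have "(?h has_real_derivative (?E x * exp (- C * x) + (F x - F 0) * (exp (- C * x) * (- C)))) (at x)"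
      using F[of x] by (auto intro!: derivative_eq_intros)
    moreover have "?E x * exp (- C * x) + (F x - F 0) * (exp (- C * x) * (- C)) = (E x - C * prim E x) * exp (- C * x)"
      unfolding P[OF xT] Ee[OF xT] by (simp add: algebra_simps)
    moreover have "\<dots> \<le> 0" using le[OF xT] by (intro mult_nonpos_nonneg) auto
    ultimately show "\<exists>y. (?h has_real_derivative y) (at x) \<and> y \<le> 0" by (intro exI conjI) auto
  qed
  then have "prim E t \<le> 0" using P[OF t] by (simp add: mult_le_0_iff)
  moreover have "0 \<le> prim E t"
    using prim_nonneg_mono[OF continuous_on_integrable_I[OF E], of 0 t] nn t prim_0[of 0 E] by auto
  ultimately have "prim E t = 0" by simp
  then show ?thesis using le[OF t] nn[OF t] by simp
qed

section \<open>Positive kernels on the square\<close>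

lemma AE_pair_ne: "AE p in I \<Otimes>\<^sub>M I. fst p \<noteq> snd p"
proof (rule II.AE_pair_measure)
  show "{x \<in> space (I \<Otimes>\<^sub>M I). fst x \<noteq> snd x} \<in> sets (I \<Otimes>\<^sub>M I)" by measurable
  show "AE x in I. AE y in I. fst (x, y) \<noteq> snd (x, y)"
  proof (rule AE_I2)
    fix x show "AE y in I. fst (x, y) \<noteq> snd (x, y)"
      unfolding AE_I_iff using AE_lebesgue_ne[of x] by eventually_elim auto
  qed
qed

text \<open>Swapping the variables exchanges the two triangles, and the diagonal is a null
  set.\<close>

lemma symmetric_half:
  fixes A :: "real \<times> real \<Rightarrow> real"
  assumes A: "integrable (I \<Otimes>\<^sub>M I) A" and sym: "\<And>t r. A (t, r) = A (r, t)"
  shows "(LINT t|I. LINT r|I. indicator {..<t} r * A (t, r)) = (LINT p|(I \<Otimes>\<^sub>M I). A p) / 2"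
    and "integrable I (\<lambda>t. LINT r|I. indicator {..<t} r * A (t, r))"
proof -
  let ?L = "\<lambda>p. indicator {..<fst p} (snd p) * A p" and ?U = "\<lambda>p. indicator {..<snd p} (fst p) * A p"
  have L: "integrable (I \<Otimes>\<^sub>M I) ?L"
    by (rule integrable_bounded_mult[OF A ind_lt_measurable, of 1]) (auto simp: indicator_def)
  have sw: "(\<lambda>(x, y). ?L (y, x)) = ?U" using sym by (auto simp: fun_eq_iff)
  have U: "integrable (I \<Otimes>\<^sub>M I) ?U" using II.integrable_product_swap[OF L] unfolding sw .
  have UL: "(LINT p|(I \<Otimes>\<^sub>M I). ?U p) = (LINT p|(I \<Otimes>\<^sub>M I). ?L p)"
    using II.integral_product_swap[of ?L] L unfolding sw by auto
  have "(LINT p|(I \<Otimes>\<^sub>M I). A p) = (LINT p|(I \<Otimes>\<^sub>M I). ?L p + ?U p)"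
  proof (rule integral_cong_AE)
    show "AE p in I \<Otimes>\<^sub>M I. A p = ?L p + ?U p"
      using AE_pair_ne by eventually_elim (auto simp: indicator_def)
  qed (use A L U in auto)
  also have "\<dots> = 2 * (LINT p|(I \<Otimes>\<^sub>M I). ?L p)" using L U UL by simp
  also have "(LINT p|(I \<Otimes>\<^sub>M I). ?L p) = (LINT t|I. LINT r|I. indicator {..<t} r * A (t, r))"
    using II.integral_fst'[OF L] by simp
  finally show "(LINT t|I. LINT r|I. indicator {..<t} r * A (t, r)) = (LINT p|(I \<Otimes>\<^sub>M I). A p) / 2" by simp
  show "integrable I (\<lambda>t. LINT r|I. indicator {..<t} r * A (t, r))" using II.integrable_fst'[OF L] by simp
qed

text \<open>Positive semidefiniteness in integrated form, tested only with products of one bounded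
  function with itself. Indicators of intervals are such functions, and triangle functions will be
  averages of their products.\<close>

definition pos_kernel :: "(real \<times> real \<Rightarrow> real) \<Rightarrow> bool" where
  "pos_kernel K \<longleftrightarrow> integrable (I \<Otimes>\<^sub>M I) K \<and>
     (\<forall>a B. a \<in> borel_measurable I \<longrightarrow> (\<forall>t\<in>{0<..<T}. \<bar>a t\<bar> \<le> B) \<longrightarrow> 0 \<le> (LINT p|(I \<Otimes>\<^sub>M I). (a (fst p) * a (snd p)) * K p))"

lemma pos_kernelD:
  "pos_kernel K \<Longrightarrow> a \<in> borel_measurable I \<Longrightarrow> \<forall>t\<in>{0<..<T}. \<bar>a t\<bar> \<le> B \<Longrightarrow> 0 \<le> (LINT p|(I \<Otimes>\<^sub>M I). (a (fst p) * a (snd p)) * K p)"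
  unfolding pos_kernel_def by blast

text \<open>Fubini: a multiplier which is an integral of multipliers with nonnegative outcome has
  nonnegative outcome. Boundedness of \<kappa> and finiteness of N give joint integrability.\<close>

lemma mixture_nonneg:
  fixes K :: "real \<times> real \<Rightarrow> real" and \<kappa> :: "(real \<times> real) \<times> real \<Rightarrow> real"
  assumes K: "integrable (I \<Otimes>\<^sub>M I) K" and N: "finite_measure N"
    and k: "\<kappa> \<in> borel_measurable ((I \<Otimes>\<^sub>M I) \<Otimes>\<^sub>M N)" and B: "\<And>q. q \<in> space ((I \<Otimes>\<^sub>M I) \<Otimes>\<^sub>M N) \<Longrightarrow> \<bar>\<kappa> q\<bar> \<le> B"
    and pos: "\<And>\<omega>. \<omega> \<in> space N \<Longrightarrow> 0 \<le> (LINT p|(I \<Otimes>\<^sub>M I). \<kappa> (p, \<omega>) * K p)"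
  shows "0 \<le> (LINT p|(I \<Otimes>\<^sub>M I). (LINT \<omega>|N. \<kappa> (p, \<omega>)) * K p)"
    and "integrable (I \<Otimes>\<^sub>M I) (\<lambda>p. (LINT \<omega>|N. \<kappa> (p, \<omega>)) * K p)"
proof -
  interpret N: finite_measure N by fact
  interpret P: finite_measure "I \<Otimes>\<^sub>M I" by (rule finite_measure_pair_measure) unfold_locales
  interpret PN: pair_sigma_finite "I \<Otimes>\<^sub>M I" N ..
  have [measurable]: "K \<in> borel_measurable (I \<Otimes>\<^sub>M I)" using K by auto
  have "integrable ((I \<Otimes>\<^sub>M I) \<Otimes>\<^sub>M N) (\<lambda>q. K (fst q))"
    by (rule PN.Fubini_integrable) (use K in auto)
  then have i: "integrable ((I \<Otimes>\<^sub>M I) \<Otimes>\<^sub>M N) (\<lambda>q. \<kappa> q * K (fst q))"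
    by (rule integrable_bounded_mult[OF _ k B])
  then have i': "integrable ((I \<Otimes>\<^sub>M I) \<Otimes>\<^sub>M N) (case_prod (\<lambda>p \<omega>. \<kappa> (p, \<omega>) * K p))" by (simp add: split_beta')
  have "(LINT p|(I \<Otimes>\<^sub>M I). (LINT \<omega>|N. \<kappa> (p, \<omega>)) * K p) = (LINT p|(I \<Otimes>\<^sub>M I). LINT \<omega>|N. \<kappa> (p, \<omega>) * K p)" by simp
  also have "\<dots> = (LINT \<omega>|N. LINT p|(I \<Otimes>\<^sub>M I). \<kappa> (p, \<omega>) * K p)" using PN.Fubini_integral[OF i'] by simp
  also have "0 \<le> \<dots>" by (rule Bochner_Integration.integral_nonneg) (rule pos)
  finally show "0 \<le> (LINT p|(I \<Otimes>\<^sub>M I). (LINT \<omega>|N. \<kappa> (p, \<omega>)) * K p)" .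
  show "integrable (I \<Otimes>\<^sub>M I) (\<lambda>p. (LINT \<omega>|N. \<kappa> (p, \<omega>)) * K p)" using PN.integrable_fst'[OF i] by simp
qed

text \<open>The integral is the length of the overlap of [t, t + u] and [r, r + u]. Both lie in (0,
  2T) since t, r < T and u \<le> T.\<close>

lemma triangle_integral:
  fixes t r u :: real
  assumes t: "t \<in> {0<..<T}" and r: "r \<in> {0<..<T}" and u: "0 \<le> u" "u \<le> T"
  shows "(LINT \<sigma>|lebesgue_on {0<..<2*T}. (if t \<le> \<sigma> \<and> \<sigma> \<le> t + u \<and> r \<le> \<sigma> \<and> \<sigma> \<le> r + u then 1 else 0 :: real)) = max 0 (u - \<bar>t - r\<bar>)"
proof -
  let ?a = "max t r" and ?b = "min t r + u"
  have "(LINT \<sigma>|lebesgue_on {0<..<2*T}. (if t \<le> \<sigma> \<and> \<sigma> \<le> t + u \<and> r \<le> \<sigma> \<and> \<sigma> \<le> r + u then 1 else 0 :: real))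
      = (LINT \<sigma>|lebesgue. indicator {0<..<2*T} \<sigma> * (if t \<le> \<sigma> \<and> \<sigma> \<le> t + u \<and> r \<le> \<sigma> \<and> \<sigma> \<le> r + u then 1 else 0 :: real))"
    by (rule lebesgue_on_integral_eq) auto
  also have "\<dots> = (LINT \<sigma>|lebesgue. indicator {?a..?b} \<sigma>)"
    using t r u by (intro Bochner_Integration.integral_cong) (auto simp: indicator_def)
  also have "\<dots> = measure lebesgue {?a..?b}" by simp
  also have "\<dots> = max 0 (u - \<bar>t - r\<bar>)" by (auto simp: max_def min_def)
  finally show ?thesis .
qed

text \<open>For fixed \<sigma> the integrand of the overlap formula is a product a(t) a(r), so
  \<open>pos_kernel\<close> applies; the triangle arises by integrating over \<sigma>.\<close>

lemma pos_kernel_triangle: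
  assumes K: "pos_kernel K" and u: "0 \<le> u" "u \<le> T"
  shows "0 \<le> (LINT p|(I \<Otimes>\<^sub>M I). max 0 (u - \<bar>fst p - snd p\<bar>) * K p)"
proof -
  let ?N = "lebesgue_on {0<..<2*T}"
  let ?a = "\<lambda>\<sigma> t. if t \<le> \<sigma> \<and> \<sigma> \<le> t + u then 1 else 0 :: real"
  let ?k = "\<lambda>q. ?a (snd q) (fst (fst q)) * ?a (snd q) (snd (fst q))"
  have fN: "finite_measure ?N" by (intro finite_measure_lebesgue_on) auto
  have [measurable]: "(\<lambda>x. x) \<in> borel_measurable ?N" by (intro measurable_restrict_space1 measurable_completion) auto
  have "?k \<in> borel_measurable ((I \<Otimes>\<^sub>M I) \<Otimes>\<^sub>M ?N)" by measurable
  moreover have "\<bar>?k q\<bar> \<le> 1" for q by simp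
  moreover have "0 \<le> (LINT p|(I \<Otimes>\<^sub>M I). ?k (p, \<sigma>) * K p)" for \<sigma>
  proof -
    have "?a \<sigma> \<in> borel_measurable I" by measurable
    moreover have "\<forall>t\<in>{0<..<T}. \<bar>?a \<sigma> t\<bar> \<le> 1" by simp
    ultimately show ?thesis using pos_kernelD[OF K, of "?a \<sigma>" 1] by simp
  qed
  ultimately have "0 \<le> (LINT p|(I \<Otimes>\<^sub>M I). (LINT \<sigma>|?N. ?k (p, \<sigma>)) * K p)"
    using K by (intro mixture_nonneg(1)[OF _ fN, where B=1]) (auto simp: pos_kernel_def)
  also have "\<dots> = (LINT p|(I \<Otimes>\<^sub>M I). max 0 (u - \<bar>fst p - snd p\<bar>) * K p)"
  proof (intro Bochner_Integration.integral_cong refl arg_cong2[where f="(*)"])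
    fix p assume "p \<in> space (I \<Otimes>\<^sub>M I)"
    then have p: "fst p \<in> {0<..<T}" "snd p \<in> {0<..<T}" by (auto simp: space_pair_measure)
    show "(LINT \<sigma>|?N. ?k (p, \<sigma>)) = max 0 (u - \<bar>fst p - snd p\<bar>)"
      unfolding triangle_integral[OF p u, symmetric] by (intro Bochner_Integration.integral_cong refl) auto
  qed
  finally show ?thesis .
qed

text \<open>Polya's criterion: a nonnegative nonincreasing convex function of \<open>\<bar>t - r\<bar>\<close> is a nonnegative
  superposition of triangle functions, each of which is an average of rank-one kernels.\<close>

lemma Polya_nonneg:
  assumes K: "pos_kernel K" and m: "continuous_on UNIV m" "\<And>u. u \<in> {0<..<T} \<Longrightarrow> 0 \<le> m u"
    and c: "0 \<le> c0" "0 \<le> c1"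
    and h: "\<And>x. x \<in> {0..<T} \<Longrightarrow> h x = c0 + c1 * (T - x) + (LINT u|I. max 0 (u - x) * m u)"
  shows "0 \<le> (LINT p|(I \<Otimes>\<^sub>M I). h \<bar>fst p - snd p\<bar> * K p)"
proof -
  have Ki: "integrable (I \<Otimes>\<^sub>M I) K" using K by (simp add: pos_kernel_def)
  have "compact (m ` {0..T})" using m(1) by (intro compact_continuous_image) (auto intro: continuous_on_subset)
  then obtain B where B: "\<forall>x\<in>{0..T}. \<bar>m x\<bar> \<le> B" by (auto dest!: compact_imp_bounded simp: bounded_iff)
  let ?k = "\<lambda>q. max 0 (snd q - \<bar>fst (fst q) - snd (fst q)\<bar>) * m (snd q)"
  have [measurable]: "m \<in> borel_measurable borel" using m(1) by (rule borel_measurable_continuous_onI)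
  have km: "?k \<in> borel_measurable ((I \<Otimes>\<^sub>M I) \<Otimes>\<^sub>M I)" by measurable
  have kB: "\<bar>?k q\<bar> \<le> T * B" if q: "q \<in> space ((I \<Otimes>\<^sub>M I) \<Otimes>\<^sub>M I)" for q
  proof -
    have "snd q \<in> {0<..<T}" using q by (auto simp: space_pair_measure)
    then show ?thesis unfolding abs_mult using B T_pos by (intro mult_mono) auto
  qed
  have kpos: "0 \<le> (LINT p|(I \<Otimes>\<^sub>M I). ?k (p, u) * K p)" if "u \<in> space I" for u
  proof -
    have u: "u \<in> {0<..<T}" using that by simp
    have "0 \<le> m u * (LINT p|(I \<Otimes>\<^sub>M I). max 0 (u - \<bar>fst p - snd p\<bar>) * K p)"
      using u by (intro mult_nonneg_nonneg m(2) pos_kernel_triangle K) auto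
    also have "\<dots> = (LINT p|(I \<Otimes>\<^sub>M I). ?k (p, u) * K p)"
      by (subst integral_mult_right_zero[symmetric]) (simp add: ac_simps)
    finally show ?thesis .
  qed
  note mix = mixture_nonneg[OF Ki finite_measure_I km kB kpos]
  have one: "0 \<le> (LINT p|(I \<Otimes>\<^sub>M I). K p)"
    using pos_kernelD[OF K, of "\<lambda>_. 1" 1] by simp
  have tri: "0 \<le> (LINT p|(I \<Otimes>\<^sub>M I). max 0 (T - \<bar>fst p - snd p\<bar>) * K p)"
    by (rule pos_kernel_triangle[OF K]) (use T_pos in auto)
  have tri_i: "integrable (I \<Otimes>\<^sub>M I) (\<lambda>p. max 0 (T - \<bar>fst p - snd p\<bar>) * K p)"
  proof (rule integrable_bounded_mult[OF Ki])
    show "(\<lambda>p. max 0 (T - \<bar>fst p - snd p\<bar>)) \<in> borel_measurable (I \<Otimes>\<^sub>M I)" by measurable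
    show "\<bar>max 0 (T - \<bar>fst p - snd p\<bar>)\<bar> \<le> T" for p :: "real \<times> real" using T_pos by auto
  qed
  have "(LINT p|(I \<Otimes>\<^sub>M I). h \<bar>fst p - snd p\<bar> * K p)
     = (LINT p|(I \<Otimes>\<^sub>M I). c0 * K p + c1 * (max 0 (T - \<bar>fst p - snd p\<bar>) * K p) + (LINT u|I. ?k (p, u)) * K p)"
  proof (intro Bochner_Integration.integral_cong refl)
    fix p assume "p \<in> space (I \<Otimes>\<^sub>M I)"
    then have p: "0 < fst p" "fst p < T" "0 < snd p" "snd p < T" by (auto simp: space_pair_measure)
    then have x: "\<bar>fst p - snd p\<bar> \<in> {0..<T}" by auto
    then have "max 0 (T - \<bar>fst p - snd p\<bar>) = T - \<bar>fst p - snd p\<bar>" by simp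
    then show "h \<bar>fst p - snd p\<bar> * K p = c0 * K p + c1 * (max 0 (T - \<bar>fst p - snd p\<bar>) * K p) + (LINT u|I. ?k (p, u)) * K p"
      unfolding h[OF x] by (simp only: fst_conv snd_conv distrib_right mult.assoc)
  qed
  also have "\<dots> = c0 * (LINT p|(I \<Otimes>\<^sub>M I). K p) + c1 * (LINT p|(I \<Otimes>\<^sub>M I). max 0 (T - \<bar>fst p - snd p\<bar>) * K p)
      + (LINT p|(I \<Otimes>\<^sub>M I). (LINT u|I. ?k (p, u)) * K p)"
    using Ki tri_i mix(2) by (simp only: Bochner_Integration.integral_add integrable_mult_right Bochner_Integration.integrable_add integral_mult_right_zero)
  also have "\<dots> \<ge> 0" using c one tri mix(1) by (intro add_nonneg_nonneg mult_nonneg_nonneg)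
  finally show ?thesis .
qed

end

section \<open>Nonnegativity of rank-one averages of an inner product kernel\<close>

context semi_inner begin

text \<open>J is the vector integral of a s. It is a finite linear combination of the values of s,
  with the integral of a over each level set as coefficient, so no limit in the function space is
  taken.\<close>

lemma weighted_simple_integral:
  fixes a :: "'t \<Rightarrow> real"
  assumes M: "finite_measure M" and s: "simple_function M s" "\<And>t. s t \<in> X" and a: "integrable M a"
  obtains J where "J \<in> X" "\<And>\<psi>. \<psi> \<in> X \<Longrightarrow> (LINT t|M. a t * ip (s t) \<psi>) = ip J \<psi>"
proof
  let ?S = "s ` space M"
  let ?\<alpha> = "\<lambda>c. LINT t|M. a t * indicator (s -` {c} \<inter> space M) t"
  let ?J = "\<lambda>x. \<Sum>c\<in>?S. ?\<alpha> c * c x"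
  have fin: "finite ?S" using s(1) by (rule simple_functionD)
  have SX: "c \<in> X" if "c \<in> ?S" for c using that s(2) by auto
  show "?J \<in> X" by (intro sum_mem fin SX)
  fix \<psi> assume psi: "\<psi> \<in> X"
  have i: "integrable M (\<lambda>t. a t * indicator (s -` {c} \<inter> space M) t)" for c
    using integrable_real_mult_indicator[OF simple_functionD(2)[OF s(1), of "{c}"] a] by (simp add: mult.commute)
  have "(LINT t|M. a t * ip (s t) \<psi>) = (LINT t|M. (\<Sum>c\<in>?S. (a t * indicator (s -` {c} \<inter> space M) t) * ip c \<psi>))"
  proof (intro Bochner_Integration.integral_cong refl)
    fix t assume t: "t \<in> space M"
    have "(\<Sum>c\<in>?S. (a t * indicator (s -` {c} \<inter> space M) t) * ip c \<psi>) = (\<Sum>c\<in>?S. if c = s t then a t * ip c \<psi> else 0)"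
      using t by (intro sum.cong) (auto simp: indicator_def)
    also have "\<dots> = a t * ip (s t) \<psi>" using fin t by simp
    finally show "a t * ip (s t) \<psi> = (\<Sum>c\<in>?S. (a t * indicator (s -` {c} \<inter> space M) t) * ip c \<psi>)" by simp
  qed
  also have "\<dots> = (\<Sum>c\<in>?S. ?\<alpha> c * ip c \<psi>)"
    using i by (subst Bochner_Integration.integral_sum) auto
  also have "\<dots> = ip ?J \<psi>" by (rule ip_sum_left[symmetric, OF fin SX psi])
  finally show "(LINT t|M. a t * ip (s t) \<psi>) = ip ?J \<psi>" .
qed

text \<open>Formally the double integral is the squared norm of the integral of a u. For the
  approximations this vector is the J of the preceding lemma and the double integral equals
  \<open>ip J J\<close>; dominated convergence passes to u.\<close>

lemma rank_one_nonneg: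
  fixes a :: "'t \<Rightarrow> real"
  assumes M: "finite_measure M" and u: "regular M u s B" and a: "a \<in> borel_measurable M" "\<And>t. t \<in> space M \<Longrightarrow> \<bar>a t\<bar> \<le> C"
  shows "0 \<le> (LINT p|(M \<Otimes>\<^sub>M M). (a (fst p) * a (snd p)) * ip (u (fst p)) (u (snd p)))"
proof -
  interpret finite_measure M by fact
  interpret P: pair_sigma_finite M M ..
  note [measurable] = a(1)
  have ai: "integrable M a" using a by (intro integrable_const_bound[where B=C]) auto
  have C0: "0 \<le> C" if "t \<in> space M" for t using order_trans[OF abs_ge_zero a(2)[OF that]] .
  let ?K = "\<lambda>k p. (a (fst p) * a (snd p)) * ip (s k (fst p)) (s k (snd p))"
  let ?w = "\<lambda>p. (C * C) * (B (fst p) * B (snd p))"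
  have w: "integrable (M \<Otimes>\<^sub>M M) ?w" by (intro integrable_mult_right integrable_B_kernel[OF M u u])
  have rk: "regular M (s k) (\<lambda>_. s k) B" for k
    using u unfolding regular_def by (auto simp: nrm_zero)
  have Km: "?K k \<in> borel_measurable (M \<Otimes>\<^sub>M M)" for k
    using kernel_measurable[OF rk rk, of k k] by (intro borel_measurable_times) measurable
  have Kw: "norm ((a (fst p) * a (snd p)) * ip f h) \<le> ?w p" if p: "p \<in> space (M \<Otimes>\<^sub>M M)" and b: "\<bar>ip f h\<bar> \<le> B (fst p) * B (snd p)" for p f h
  proof -
    have sp: "fst p \<in> space M" "snd p \<in> space M" using p by (auto simp: space_pair_measure)
    show ?thesis unfolding real_norm_def abs_mult
      using b C0[OF sp(1)] by (intro mult_mono a(2) sp) (auto simp: abs_mult)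
  qed
  have Ki: "integrable (M \<Otimes>\<^sub>M M) (?K k)" for k
  proof (rule Bochner_Integration.integrable_bound[OF w Km])
    show "AE p in M \<Otimes>\<^sub>M M. norm (?K k p) \<le> norm (?w p)"
    proof (rule AE_I2)
      fix p assume p: "p \<in> space (M \<Otimes>\<^sub>M M)"
      have "norm (?K k p) \<le> ?w p"
        using p by (intro Kw ip_bound_approx[OF u u]) (auto simp: space_pair_measure)
      then show "norm (?K k p) \<le> norm (?w p)" by (simp add: order_trans[OF _ abs_ge_self])
    qed
  qed
  have pos: "0 \<le> (LINT p|(M \<Otimes>\<^sub>M M). ?K k p)" for k
  proof -
    obtain J where J: "J \<in> X" "\<And>\<psi>. \<psi> \<in> X \<Longrightarrow> (LINT t|M. a t * ip (s k t) \<psi>) = ip J \<psi>"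
      using weighted_simple_integral[OF M regularD(3)[OF u] regularD(2)[OF u] ai] by blast
    note sX = regularD(2)[OF u]
    have "(LINT p|(M \<Otimes>\<^sub>M M). ?K k p) = (LINT t|M. LINT r|M. (a t * a r) * ip (s k t) (s k r))"
      using P.integral_fst'[OF Ki] by simp
    also have "\<dots> = (LINT t|M. a t * ip (s k t) J)"
    proof (intro Bochner_Integration.integral_cong refl)
      fix t
      have "(LINT r|M. (a t * a r) * ip (s k t) (s k r)) = (LINT r|M. a t * (a r * ip (s k r) (s k t)))"
        by (intro Bochner_Integration.integral_cong refl) (simp add: ip_sym[OF sX sX, of k t])
      also have "\<dots> = a t * ip J (s k t)" by (simp add: J(2)[OF sX])
      also have "ip J (s k t) = ip (s k t) J" by (rule ip_sym[OF J(1) sX])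
      finally show "(LINT r|M. (a t * a r) * ip (s k t) (s k r)) = a t * ip (s k t) J" .
    qed
    also have "\<dots> = ip J J" by (rule J(2)[OF J(1)])
    also have "\<dots> \<ge> 0" by (rule ip_nonneg[OF J(1)])
    finally show ?thesis .
  qed
  have "(\<lambda>k. LINT p|(M \<Otimes>\<^sub>M M). ?K k p) \<longlonglongrightarrow> (LINT p|(M \<Otimes>\<^sub>M M). (a (fst p) * a (snd p)) * ip (u (fst p)) (u (snd p)))"
  proof (rule integral_dominated_convergence[OF _ Km w])
    show "(\<lambda>p. (a (fst p) * a (snd p)) * ip (u (fst p)) (u (snd p))) \<in> borel_measurable (M \<Otimes>\<^sub>M M)"
      using kernel_measurable[OF u u] by (intro borel_measurable_times) measurable
    show "AE p in M \<Otimes>\<^sub>M M. (\<lambda>k. ?K k p) \<longlonglongrightarrow> (a (fst p) * a (snd p)) * ip (u (fst p)) (u (snd p))"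
      by (intro AE_I2 tendsto_mult tendsto_const tendsto_ip regularD(1,2)[OF u] regularD(6)[OF u]) (auto simp: space_pair_measure)
    show "AE p in M \<Otimes>\<^sub>M M. norm (?K k p) \<le> ?w p" for k
      by (intro AE_I2 Kw ip_bound_approx[OF u u]) (auto simp: space_pair_measure)
  qed
  then show ?thesis by (rule LIMSEQ_le_const) (use pos in auto)
qed

end

section \<open>Energy estimate\<close>

context time_interval begin

text \<open>Truncating both variables at b turns the integral over the triangle r < t < b into half
  of the integral over a square.\<close>

lemma prim_half_square:
  fixes K :: "real \<times> real \<Rightarrow> real"
  assumes K: "integrable (I \<Otimes>\<^sub>M I) K" and sym: "\<And>t r. K (t, r) = K (r, t)"
  shows "prim (\<lambda>t. LINT r|I. indicator {..<t} r * K (t, r)) b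
     = (LINT p|(I \<Otimes>\<^sub>M I). (indicator {..<b} (fst p) * indicator {..<b} (snd p)) * K p) / 2"
    and "integrable (I \<Otimes>\<^sub>M I) (\<lambda>p. (indicator {..<b} (fst p) * indicator {..<b} (snd p)) * K p)"
proof -
  let ?A = "\<lambda>p. (indicator {..<b} (fst p) * indicator {..<b} (snd p)) * K p"
  have im: "(\<lambda>t. indicator {..<b} t :: real) \<in> borel_measurable I" by (rule borel_measurable_I) auto
  have "(\<lambda>p. indicator {..<b} (fst p) * indicator {..<b} (snd p) :: real) \<in> borel_measurable (I \<Otimes>\<^sub>M I)"
    by (intro borel_measurable_times measurable_compose[OF measurable_fst im] measurable_compose[OF measurable_snd im])
  then show A: "integrable (I \<Otimes>\<^sub>M I) ?A"
    by (rule integrable_bounded_mult[OF K, where B=1]) (auto simp: indicator_def)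
  have "prim (\<lambda>t. LINT r|I. indicator {..<t} r * K (t, r)) b = (LINT t|I. LINT r|I. indicator {..<t} r * ?A (t, r))"
    unfolding prim_def
    by (intro Bochner_Integration.integral_cong refl, subst integral_mult_right_zero[symmetric])
      (intro Bochner_Integration.integral_cong refl, auto simp: indicator_def)
  also have "\<dots> = (LINT p|(I \<Otimes>\<^sub>M I). ?A p) / 2"
    by (rule symmetric_half(1)[OF A]) (simp add: sym mult.commute)
  finally show "prim (\<lambda>t. LINT r|I. indicator {..<t} r * K (t, r)) b
     = (LINT p|(I \<Otimes>\<^sub>M I). (indicator {..<b} (fst p) * indicator {..<b} (snd p)) * K p) / 2" .
qed

end

section \<open>The energy of the difference of two solutions\<close>

context evolution begin

text \<open>The representation as a constant plus a primitive extends by continuity to every time,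
  and at time 0 the constant is seen to vanish. In this form there is no exceptional null set
  depending on \<psi>.\<close>

lemma continuous_rep_prim:
  assumes z: "L2i.regular \<Omega> I z s B" and y: "L2i.regular \<Omega> I y r C" and wd: "weakly_deriv z y"
    and d: "d \<in> CL2" "L2_norm \<Omega> (d 0) = 0" "AE t in I. AE x in lebesgue_on \<Omega>. d t x = z t x"
    and psi: "\<psi> \<in> L2 \<Omega>" and t: "t \<in> {0..T}"
  shows "L2_inner \<Omega> (d t) \<psi> = prim (\<lambda>r. L2_inner \<Omega> (y r) \<psi>) t"
proof -
  let ?Y = "\<lambda>r. L2_inner \<Omega> (y r) \<psi>"
  obtain c where c: "AE t in I. L2_inner \<Omega> (z t) \<psi> = c + prim ?Y t"
    by (rule weakly_deriv_prim[OF wd z y psi])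
  have Yi: "integrable I ?Y" by (rule L2i.ip_const_integrable[OF finite_measure_I y psi])
  let ?f = "\<lambda>t. L2_inner \<Omega> (d t) \<psi> - (c + prim ?Y t)"
  have "AE t in I. ?f t = 0"
    using c d(3) AE_space
  proof eventually_elim
    case (elim t)
    have "d t \<in> L2 \<Omega>" using elim(3) by (intro CL2_mem[OF d(1)]) auto
    then have "L2_inner \<Omega> (d t) \<psi> = L2_inner \<Omega> (z t) \<psi>"
      by (intro L2_inner_cong_AE elim(2) psi L2i.regularD(1)[OF z]) auto
    then show ?case using elim(1) by simp
  qed
  moreover have "continuous_on {0..T} ?f"
    by (intro continuous_intros CL2_ip_continuous[OF d(1) psi] continuous_on_subset[OF prim_continuous[OF Yi]]) auto
  ultimately have f0: "?f b = 0" if "b \<in> {0..T}" for b using continuous_AE_zero that by blast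
  have "0 \<in> {0..T}" using T_pos by simp
  have "\<bar>L2_inner \<Omega> (d 0) \<psi>\<bar> \<le> L2_norm \<Omega> (d 0) * L2_norm \<Omega> \<psi>"
    using L2i.Cauchy_Schwarz[OF CL2_mem[OF d(1) \<open>0 \<in> {0..T}\<close>] psi] by (simp add: L2i_nrm)
  then have "c = 0" using f0[OF \<open>0 \<in> {0..T}\<close>] d(2) by (simp add: prim_0)
  then show ?thesis using f0[OF t] by simp
qed

text \<open>Primitives of pairings are first rewritten as pairings with d, which makes their
  continuity in \<psi> visible. In the memory term the limit along the approximations of z t is
  dominated by a multiple of B r B t.\<close>

lemma equation_at_solution:
  assumes z: "H01s.regular I z s B" and y: "L2i.regular \<Omega> I y r C" and wd: "weakly_deriv z y"
    and d: "d \<in> CL2" "L2_norm \<Omega> (d 0) = 0" "AE t in I. AE x in lebesgue_on \<Omega>. d t x = z t x"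
    and h: "continuous_on UNIV h" and tau: "0 < \<tau>"
    and eq: "\<forall>\<psi>\<in>H01 \<Omega>. AE t in I. L2_inner \<Omega> (y t) \<psi> + memory h (\<lambda>t. grad_inner (z t) \<psi>) t
       + \<mu>1 * prim (\<lambda>t. L2_inner \<Omega> (y t) \<psi>) t + \<mu>2 * prim (\<lambda>t. L2_inner \<Omega> (y t) \<psi>) (t - \<tau>) = 0"
  shows "AE t in I. L2_inner \<Omega> (y t) (z t) + memory h (\<lambda>r. grad_inner (z r) (z t)) t
       + \<mu>1 * L2_inner \<Omega> (d t) (z t) + \<mu>2 * (if \<tau> \<le> t then L2_inner \<Omega> (d (t - \<tau>)) (z t) else 0) = 0"
proof -
  let ?F = "\<lambda>t \<psi>. L2_inner \<Omega> (y t) \<psi> + memory h (\<lambda>r. grad_inner (z r) \<psi>) t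
       + \<mu>1 * L2_inner \<Omega> (d t) \<psi> + \<mu>2 * (if \<tau> \<le> t then L2_inner \<Omega> (d (t - \<tau>)) \<psi> else 0)"
  note z2 = regular_H01_L2[OF z] and zg = regular_H01_grad[OF z]
  note dp = continuous_rep_prim[OF z2 y wd d]
  have zero: "AE t in I. ?F t \<psi> = 0" if psi: "\<psi> \<in> H01 \<Omega>" for \<psi>
    using eq[THEN bspec, OF psi] AE_space
  proof eventually_elim
    case (elim t)
    then have t: "0 < t" "t < T" by auto
    have psi2: "\<psi> \<in> L2 \<Omega>" by (rule H01_L2[OF psi])
    have "prim (\<lambda>t. L2_inner \<Omega> (y t) \<psi>) (t - \<tau>) = (if \<tau> \<le> t then L2_inner \<Omega> (d (t - \<tau>)) \<psi> else 0)"
      using t tau by (auto simp: dp[OF psi2] prim_0)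
    moreover have "prim (\<lambda>t. L2_inner \<Omega> (y t) \<psi>) t = L2_inner \<Omega> (d t) \<psi>" using t by (simp add: dp[OF psi2])
    ultimately show ?case using elim(1) by simp
  qed
  have lim: "(\<lambda>k. ?F t (s k t)) \<longlonglongrightarrow> ?F t (z t)" if tI: "t \<in> space I" for t
  proof -
    have t: "t \<in> {0<..<T}" using tI by simp
    have l2: "(\<lambda>k. L2_inner \<Omega> f (s k t)) \<longlonglongrightarrow> L2_inner \<Omega> f (z t)" if "f \<in> L2 \<Omega>" for f
      by (rule L2i.tendsto_ip[OF that that _ L2i.regularD(2)[OF z2] L2i.regularD(1)[OF z2] L2i.regularD(6)[OF z2 tI]])
        (simp add: L2i.nrm_zero)
    obtain Bh where Bh: "\<And>x. x \<in> space (I \<Otimes>\<^sub>M I) \<Longrightarrow> \<bar>indicator {..<fst x} (snd x) * h (fst x - snd x) :: real\<bar> \<le> Bh" "0 \<le> Bh"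
      using ind_kernel_bounded[OF h] by blast
    have mem: "(\<lambda>k. memory h (\<lambda>r. grad_inner (z r) (s k t)) t) \<longlonglongrightarrow> memory h (\<lambda>r. grad_inner (z r) (z t)) t"
      unfolding memory_def
    proof (rule integral_dominated_convergence[where w="\<lambda>r. Bh * (B r * B t)"])
      have ii: "integrable I (\<lambda>r. indicator {..<t} r * (h (t - r) * grad_inner (z r) \<psi>))" if "\<psi> \<in> H01 \<Omega>" for \<psi>
        by (rule memory_integrable(2)[OF h H01g.ip_const_integrable[OF finite_measure_I zg that] t])
      show "(\<lambda>r. indicator {..<t} r * (h (t - r) * grad_inner (z r) (z t))) \<in> borel_measurable I"
        using ii[OF H01s.regularD(1)[OF z]] by auto
      show "(\<lambda>r. indicator {..<t} r * (h (t - r) * grad_inner (z r) (s k t))) \<in> borel_measurable I" for k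
        using ii[OF H01s.regularD(2)[OF z]] by auto
      show "integrable I (\<lambda>r. Bh * (B r * B t))"
        using H01g.regular_B_integrable[OF finite_measure_I zg] by auto
      show "AE r in I. (\<lambda>k. indicator {..<t} r * (h (t - r) * grad_inner (z r) (s k t))) \<longlonglongrightarrow> indicator {..<t} r * (h (t - r) * grad_inner (z r) (z t))"
      proof (rule AE_I2)
        fix r
        note zX = H01g.regularD(1)[OF zg, of r]
        have "(\<lambda>k. grad_inner (z r) (s k t)) \<longlonglongrightarrow> grad_inner (z r) (z t)"
          by (rule H01g.tendsto_ip[OF zX zX _ H01g.regularD(2)[OF zg] H01g.regularD(1)[OF zg] H01g.regularD(6)[OF zg tI]])
            (simp add: H01g.nrm_zero)
        then show "(\<lambda>k. indicator {..<t} r * (h (t - r) * grad_inner (z r) (s k t))) \<longlonglongrightarrow> indicator {..<t} r * (h (t - r) * grad_inner (z r) (z t))"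
          by (intro tendsto_mult tendsto_const)
      qed
      show "AE r in I. norm (indicator {..<t} r * (h (t - r) * grad_inner (z r) (s k t))) \<le> Bh * (B r * B t)" for k
      proof (rule AE_I2)
        fix r assume r: "r \<in> space I"
        have "\<bar>grad_inner (z r) (s k t)\<bar> \<le> H01g.nrm (z r) * H01g.nrm (s k t)"
          by (rule H01g.Cauchy_Schwarz[OF H01g.regularD(1)[OF zg] H01g.regularD(2)[OF zg]])
        also have "\<dots> \<le> B r * B t"
          by (intro mult_mono H01g.regularD(4)[OF zg r] H01g.regularD(5)[OF zg tI] H01g.regular_B_nonneg[OF zg r] H01g.nrm_nonneg H01g.regularD(2)[OF zg])
        finally have gb: "\<bar>grad_inner (z r) (s k t)\<bar> \<le> B r * B t" .
        have hb: "\<bar>indicator {..<t} r * h (t - r)\<bar> \<le> Bh"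
          using Bh(1)[of "(t, r)"] r tI by (simp add: space_pair_measure)
        have "norm (indicator {..<t} r * (h (t - r) * grad_inner (z r) (s k t))) = \<bar>indicator {..<t} r * h (t - r)\<bar> * \<bar>grad_inner (z r) (s k t)\<bar>"
          by (simp add: abs_mult)
        also have "\<dots> \<le> Bh * (B r * B t)" by (rule mult_mono[OF hb gb Bh(2) abs_ge_zero])
        finally show "norm (indicator {..<t} r * (h (t - r) * grad_inner (z r) (s k t))) \<le> Bh * (B r * B t)" .
      qed
    qed
    have del: "(\<lambda>k. if \<tau> \<le> t then L2_inner \<Omega> (d (t - \<tau>)) (s k t) else 0) \<longlonglongrightarrow> (if \<tau> \<le> t then L2_inner \<Omega> (d (t - \<tau>)) (z t) else 0)"
    proof (cases "\<tau> \<le> t")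
      case True
      have "d (t - \<tau>) \<in> L2 \<Omega>" using True t tau by (intro CL2_mem[OF d(1)]) auto
      from l2[OF this] True show ?thesis by simp
    qed simp
    have dt: "d t \<in> L2 \<Omega>" using t by (intro CL2_mem[OF d(1)]) auto
    show ?thesis by (intro tendsto_add tendsto_mult tendsto_const l2[OF L2i.regularD(1)[OF y]] mem l2[OF dt] del)
  qed
  show ?thesis by (rule H01s.AE_at_regular[OF z, of ?F, OF zero AE_I2[OF lim]])
qed

text \<open>The first term and the memory term of the tested equation both have the form of a
  symmetric kernel integrated over r < t. After integration in time they become halves of integrals
  over a square: the first is a squared norm, the second is nonnegative by assumption on h.\<close>

lemma energy_zero:
  assumes z: "H01s.regular I z s B" and y: "L2i.regular \<Omega> I y r C" and wd: "weakly_deriv z y"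
    and d: "d \<in> CL2" "L2_norm \<Omega> (d 0) = 0" "AE t in I. AE x in lebesgue_on \<Omega>. d t x = z t x"
    and h: "continuous_on UNIV h" and tau: "0 < \<tau>"
    and eq: "\<forall>\<psi>\<in>H01 \<Omega>. AE t in I. L2_inner \<Omega> (y t) \<psi> + memory h (\<lambda>t. grad_inner (z t) \<psi>) t
       + \<mu>1 * prim (\<lambda>t. L2_inner \<Omega> (y t) \<psi>) t + \<mu>2 * prim (\<lambda>t. L2_inner \<Omega> (y t) \<psi>) (t - \<tau>) = 0"
    and hpos: "\<And>K. pos_kernel K \<Longrightarrow> 0 \<le> (LINT p|(I \<Otimes>\<^sub>M I). h \<bar>fst p - snd p\<bar> * K p)"
    and t: "t \<in> {0..T}"
  shows "L2_norm \<Omega> (d t) = 0"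
proof -
  note z2 = regular_H01_L2[OF z] and zg = regular_H01_grad[OF z]
  note dp = continuous_rep_prim[OF z2 y wd d]
  note yX = L2i.regularD(1)[OF y] and zX = L2i.regularD(1)[OF z2]
  define E where "E t = (L2_norm \<Omega> (d t))\<^sup>2" for t
  have Ec: "continuous_on {0..T} E" unfolding E_def by (intro continuous_intros CL2_norm_continuous[OF d(1)])
  have Ei: "integrable I E" by (rule continuous_on_integrable_I[OF Ec])
  have Ee: "E t = L2_inner \<Omega> (d t) (d t)" if "t \<in> {0..T}" for t
    unfolding E_def using L2i.nrm_sq[OF CL2_mem[OF d(1) that]] by (simp add: L2i_nrm)
  define f1 where "f1 t = L2_inner \<Omega> (y t) (z t)" for t
  define f2 where "f2 t = memory h (\<lambda>r. grad_inner (z r) (z t)) t" for t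
  have f1i: "integrable I f1" unfolding f1_def by (rule L2i.ip_integrable[OF y z2])
  have dm: "d t \<in> L2 \<Omega>" if "t \<in> {0..T}" for t by (rule CL2_mem[OF d(1) that])
  have dz: "AE t in I. \<forall>f\<in>L2 \<Omega>. L2_inner \<Omega> f (z t) = L2_inner \<Omega> f (d t)"
    using d(3) AE_space
  proof eventually_elim
    case (elim t)
    then have "d t \<in> L2 \<Omega>" by (intro dm) auto
    moreover have "AE x in lebesgue_on \<Omega>. z t x = d t x" using elim(1) by eventually_elim simp
    ultimately show ?case by (intro ballI L2_inner_cong_AE zX) auto
  qed

  \<comment> \<open>Since d t is the integral of y over (0, t) and agrees with z t, the pairing of y
    t with z t is an integral of this kernel over r < t. Fubini thus replaces the chain rule for the
    squared norm.\<close>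
  let ?M = "\<lambda>p. L2_inner \<Omega> (y (fst p)) (y (snd p))"
  have Mi: "integrable (I \<Otimes>\<^sub>M I) ?M" by (rule L2i.kernel_integrable[OF finite_measure_I y y])
  have Ms: "?M (t, r) = ?M (r, t)" for t r by (simp add: L2_inner_commute)
  have f1e: "AE t in I. f1 t = (LINT r|I. indicator {..<t} r * ?M (t, r))"
    using dz AE_space
  proof eventually_elim
    case (elim t)
    then have tt: "t \<in> {0..T}" by auto
    have "f1 t = L2_inner \<Omega> (y t) (d t)" unfolding f1_def using elim(1) yX by blast
    also have "\<dots> = prim (\<lambda>r. L2_inner \<Omega> (y r) (y t)) t" using dp[OF yX tt] by (simp add: L2_inner_commute)
    also have "\<dots> = (LINT r|I. indicator {..<t} r * ?M (t, r))" unfolding prim_def by (simp add: L2_inner_commute)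
    finally show ?case .
  qed
  have P1: "prim f1 b = E b / 2" if b: "b \<in> {0..T}" for b
  proof -
    note H = prim_half_square[OF Mi Ms, of b]
    have "prim f1 b = prim (\<lambda>t. LINT r|I. indicator {..<t} r * ?M (t, r)) b"
      by (rule prim_cong_AE[OF f1e f1i symmetric_half(2)[OF Mi Ms]])
    also have "\<dots> = (LINT p|(I \<Otimes>\<^sub>M I). (indicator {..<b} (fst p) * indicator {..<b} (snd p)) * ?M p) / 2" by (rule H(1))
    also have "(LINT p|(I \<Otimes>\<^sub>M I). (indicator {..<b} (fst p) * indicator {..<b} (snd p)) * ?M p)
        = (LINT t|I. LINT r|I. (indicator {..<b} t * indicator {..<b} r) * L2_inner \<Omega> (y t) (y r))"
      using II.integral_fst'[OF H(2)] by simp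
    also have "\<dots> = (LINT t|I. indicator {..<b} t * L2_inner \<Omega> (y t) (d b))"
    proof (intro Bochner_Integration.integral_cong refl)
      fix t
      have "(LINT r|I. (indicator {..<b} t * indicator {..<b} r) * L2_inner \<Omega> (y t) (y r))
         = indicator {..<b} t * prim (\<lambda>r. L2_inner \<Omega> (y r) (y t)) b"
        unfolding prim_def by (subst integral_mult_right_zero[symmetric]) (simp add: mult.assoc L2_inner_commute)
      then show "(LINT r|I. (indicator {..<b} t * indicator {..<b} r) * L2_inner \<Omega> (y t) (y r)) = indicator {..<b} t * L2_inner \<Omega> (y t) (d b)"
        using dp[OF yX b, of t] by (simp add: L2_inner_commute)
    qed
    also have "\<dots> = E b" using dp[OF dm[OF b] b] Ee[OF b] by (simp add: prim_def)
    finally show ?thesis .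
  qed

  let ?G = "\<lambda>p. grad_inner (z (fst p)) (z (snd p))"
  \<comment> \<open>The memory term only sees r < t, where \<bar>t - r\<bar> = t - r. The absolute
    value is the symmetric continuation to the whole square.\<close>
  let ?A = "\<lambda>p. h \<bar>fst p - snd p\<bar> * ?G p"
  have Gi: "integrable (I \<Otimes>\<^sub>M I) ?G" by (rule H01g.kernel_integrable[OF finite_measure_I zg zg])
  have Gs: "?G (t, r) = ?G (r, t)" for t r by (simp add: grad_inner_def L2_inner_commute)
  have As: "?A (t, r) = ?A (r, t)" for t r using Gs[of t r] by (simp add: abs_minus_commute)
  have Ai: "integrable (I \<Otimes>\<^sub>M I) ?A"
  proof -
    have "compact (h ` {0..T})" using h by (intro compact_continuous_image) (auto intro: continuous_on_subset)
    then obtain Bh where Bh: "\<forall>x\<in>{0..T}. \<bar>h x\<bar> \<le> Bh" by (auto dest!: compact_imp_bounded simp: bounded_iff)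
    have [measurable]: "h \<in> borel_measurable borel" using h by (rule borel_measurable_continuous_onI)
    show ?thesis
    proof (rule integrable_bounded_mult[OF Gi])
      show "(\<lambda>p. h \<bar>fst p - snd p\<bar>) \<in> borel_measurable (I \<Otimes>\<^sub>M I)" by measurable
      show "\<bar>h \<bar>fst p - snd p\<bar>\<bar> \<le> Bh" if "p \<in> space (I \<Otimes>\<^sub>M I)" for p
        using that by (intro Bh[rule_format]) (auto simp: space_pair_measure)
    qed
  qed
  have f2e: "f2 t = (LINT r|I. indicator {..<t} r * ?A (t, r))" for t
    unfolding f2_def memory_def
    by (intro Bochner_Integration.integral_cong refl) (auto simp: indicator_def grad_inner_def L2_inner_commute)
  have f2i: "integrable I f2" using symmetric_half(2)[OF Ai As] unfolding f2e[abs_def] .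
  have P2: "0 \<le> prim f2 b" for b
  proof -
    \<comment> \<open>Truncation at b multiplies by a product of one function with itself, which is
      absorbed into the test function a; hence the truncated kernel is positive as well.\<close>
    let ?K = "\<lambda>p. (indicator {..<b} (fst p) * indicator {..<b} (snd p)) * ?G p"
    have "pos_kernel ?K" unfolding pos_kernel_def
    proof (intro conjI allI impI)
      show "integrable (I \<Otimes>\<^sub>M I) ?K" by (rule prim_half_square(2)[OF Gi Gs])
      fix a :: "real \<Rightarrow> real" and Ba assume a: "a \<in> borel_measurable I" "\<forall>t\<in>{0<..<T}. \<bar>a t\<bar> \<le> Ba"
      let ?a = "\<lambda>t. a t * indicator {..<b} t"
      have "0 \<le> (LINT p|(I \<Otimes>\<^sub>M I). (?a (fst p) * ?a (snd p)) * ?G p)"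
      proof (rule H01g.rank_one_nonneg[OF finite_measure_I zg])
        show "?a \<in> borel_measurable I" by (intro borel_measurable_times a(1) borel_measurable_I) auto
        show "\<bar>?a t\<bar> \<le> Ba" if "t \<in> space I" for t
          using a(2) that order_trans[OF abs_ge_zero a(2)[rule_format, of t]] by (auto simp: indicator_def)
      qed
      also have "(\<lambda>p. (?a (fst p) * ?a (snd p)) * ?G p) = (\<lambda>p. (a (fst p) * a (snd p)) * ?K p)" by (simp add: ac_simps)
      finally show "0 \<le> (LINT p|(I \<Otimes>\<^sub>M I). (a (fst p) * a (snd p)) * ?K p)" .
    qed
    from hpos[OF this] have "0 \<le> (LINT p|(I \<Otimes>\<^sub>M I). (indicator {..<b} (fst p) * indicator {..<b} (snd p)) * ?A p)"
      by (simp add: ac_simps)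
    then show ?thesis unfolding f2e[abs_def] prim_half_square(1)[OF Ai As] by simp
  qed

  let ?S = "\<lambda>t. indicator {\<tau>..} t * E (t - \<tau>)"
  have Si: "integrable I ?S" by (rule shift_integrable[OF Ei tau])
  \<comment> \<open>The delayed product is split by the inequality 2 p q \<le> p^2 + q^2 into the
    delayed and the present energy.\<close>
  let ?R = "\<lambda>t. \<bar>\<mu>1\<bar> * E t + \<bar>\<mu>2\<bar> * (1/2 * ?S t + 1/2 * E t)"
  have bound: "AE t in I. f1 t + f2 t \<le> ?R t"
    using equation_at_solution[OF z y wd d h tau eq] dz AE_space
  proof eventually_elim
    case (elim t)
    then have tt: "t \<in> {0..T}" by auto
    have e3: "L2_inner \<Omega> (d t) (z t) = E t" using elim(2) dm[OF tt] Ee[OF tt] by simp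
    let ?q = "if \<tau> \<le> t then L2_inner \<Omega> (d (t - \<tau>)) (z t) else 0"
    have q: "\<bar>?q\<bar> \<le> 1/2 * ?S t + 1/2 * E t"
    proof (cases "\<tau> \<le> t")
      case True
      then have td: "t - \<tau> \<in> {0..T}" using tt tau by auto
      have "\<bar>L2_inner \<Omega> (d (t - \<tau>)) (d t)\<bar> \<le> L2_norm \<Omega> (d (t - \<tau>)) * L2_norm \<Omega> (d t)"
        using L2i.Cauchy_Schwarz[OF dm[OF td] dm[OF tt]] by (simp add: L2i_nrm)
      also have "\<dots> \<le> 1/2 * E (t - \<tau>) + 1/2 * E t"
        unfolding E_def using sum_squares_bound[of "L2_norm \<Omega> (d (t - \<tau>))" "L2_norm \<Omega> (d t)"] by simp
      finally show ?thesis using True elim(2) dm[OF td] by simp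
    qed (simp add: E_def)
    have "f1 t + f2 t = - (\<mu>1 * E t) - \<mu>2 * ?q" using elim(1) unfolding f1_def f2_def e3 by linarith
    also have "\<dots> \<le> \<bar>\<mu>1 * E t\<bar> + \<bar>\<mu>2 * ?q\<bar>" by linarith
    also have "\<bar>\<mu>1 * E t\<bar> = \<bar>\<mu>1\<bar> * E t" by (simp add: abs_mult E_def)
    also have "\<bar>\<mu>2 * ?q\<bar> \<le> \<bar>\<mu>2\<bar> * (1/2 * ?S t + 1/2 * E t)" unfolding abs_mult by (rule mult_left_mono[OF q]) simp
    finally show ?case by simp
  qed
  have "E t = 0"
  proof (rule Gronwall_zero[OF Ec _ _ t])
    show "0 \<le> E t" for t by (simp add: E_def)
    fix b assume b: "b \<in> {0..T}"
    have i12: "integrable I (\<lambda>t. 1/2 * ?S t + 1/2 * E t)" using Si Ei by auto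
    have iR: "integrable I ?R" by (intro Bochner_Integration.integrable_add integrable_mult_right Ei Si)
    \<comment> \<open>The delayed energy integrates to the primitive at an earlier time, which
      monotonicity bounds by the present one; so the delay adds nothing to the Gronwall
      argument.\<close>
    have mono: "prim E (b - \<tau>) \<le> prim E b" using tau by (intro prim_nonneg_mono[OF Ei]) (auto simp: E_def)
    have "prim f1 b + prim f2 b = prim (\<lambda>t. f1 t + f2 t) b" using prim_lin[OF f1i f2i, of 1 1 b] by simp
    also have "\<dots> \<le> prim ?R b"
      by (rule prim_mono_AE[OF _ iR bound]) (intro Bochner_Integration.integrable_add f1i f2i)
    also have "\<dots> = \<bar>\<mu>1\<bar> * prim E b + \<bar>\<mu>2\<bar> * (1/2 * prim E (b - \<tau>) + 1/2 * prim E b)"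
      using prim_shift[OF Ei tau, of b] b by (simp only: prim_lin[OF Ei i12] prim_lin[OF Si Ei] atLeastAtMost_iff)
    also have "\<dots> \<le> \<bar>\<mu>1\<bar> * prim E b + \<bar>\<mu>2\<bar> * prim E b"
      using mono by (intro add_left_mono mult_left_mono) auto
    finally have "prim f1 b + prim f2 b \<le> (\<bar>\<mu>1\<bar> + \<bar>\<mu>2\<bar>) * prim E b" by (simp add: distrib_right)
    \<comment> \<open>The factor 2 undoes the one half in front of the energy; the memory
      contribution is dropped by its sign.\<close>
    then show "E b \<le> (2 * (\<bar>\<mu>1\<bar> + \<bar>\<mu>2\<bar>)) * prim E b"
      unfolding mult.assoc using P1[OF b] P2[of b] by linarith
  qed
  then show ?thesis by (simp add: E_def)
qed

text \<open>Taylor's formula at T with integral remainder: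
  \<open>1 - G x = (1 - G T) + g T * (T - x)\<close> plus the integral of (u - x) (- g' u) over (x,
  T). The three coefficients are nonnegative by the bound on the mass of g, by g \<ge> 0 and by g'
  \<le> 0, which is the shape needed for Polya's criterion.\<close>

lemma relaxation_kernel_nonneg:
  assumes g: "\<And>t. t \<ge> 0 \<Longrightarrow> g t \<ge> 0" "\<And>t. t \<ge> 0 \<Longrightarrow> (g has_real_derivative g' t) (at t within {0..})"
    "continuous_on {0..} g'" "set_integrable lebesgue {0..} g" "(LINT s:{0..}|lebesgue. g s) \<le> 1"
    "\<And>t. t > 0 \<Longrightarrow> g' t \<le> 0"
    and G: "\<And>x. (G has_real_derivative g (max 0 x)) (at x)" "G 0 = 0"
    and K: "pos_kernel K"
  shows "0 \<le> (LINT p|(I \<Otimes>\<^sub>M I). (1 - G \<bar>fst p - snd p\<bar>) * K p)"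
proof -
  \<comment> \<open>The clamp extends - g' continuously to negative arguments, where g' is not
    controlled.\<close>
  let ?m = "\<lambda>u. - g' (max 0 u)"
  have gc: "continuous_on {0..} g" using g(2) by (auto simp: continuous_on_eq_continuous_within intro: DERIV_continuous)
  have GT: "G T = (LINT s|I. g s)"
  proof -
    have "(LINT s|I. g s) = G T - G 0"
      by (rule integral_deriv_interval(2)[where F=G])
        (use T_pos in simp, rule continuous_on_subset[OF gc], simp,
         rule has_field_derivative_at_within, insert G(1), metis atLeastAtMost_iff max.absorb2)
    then show ?thesis using G(2) by simp
  qed
  have "(LINT s|I. g s) = (LINT s|lebesgue. indicator {0<..<T} s * g s)" by (rule lebesgue_on_integral_eq) auto
  also have "\<dots> \<le> (LINT s|lebesgue. indicator {0..} s * g s)"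
  proof (rule integral_mono)
    have i: "integrable lebesgue (\<lambda>s. indicator {0..} s * g s)" using g(4) by (simp add: set_integrable_def)
    then show "integrable lebesgue (\<lambda>s. indicator {0..} s * g s)" .
    have "integrable lebesgue (\<lambda>s. indicator {0<..<T} s * (indicator {0..} s * g s))"
      by (rule integrable_bounded_mult[OF i borel_measurable_indicator, of _ 1]) (auto simp: indicator_def)
    also have "(\<lambda>s. indicator {0<..<T} s * (indicator {0..} s * g s)) = (\<lambda>s. indicator {0<..<T} s * g s)"
      by (auto simp: indicator_def)
    finally show "integrable lebesgue (\<lambda>s. indicator {0<..<T} s * g s)" .
    show "indicator {0<..<T} s * g s \<le> indicator {0..} s * g s" for s using g(1)[of s] by (auto simp: indicator_def)
  qed
  also have "\<dots> \<le> 1" using g(5) by (simp add: set_lebesgue_integral_def)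
  finally have c0: "0 \<le> 1 - G T" using GT by simp
  show ?thesis
  proof (rule Polya_nonneg[OF K _ _ c0 g(1)])
    show "continuous_on UNIV ?m"
      by (intro continuous_on_minus continuous_on_compose2[OF g(3)]) (auto intro!: continuous_intros)
    show "0 \<le> ?m u" if "u \<in> {0<..<T}" for u using g(6)[of u] that by simp
    show "0 \<le> T" using T_pos by simp
    fix x assume x: "x \<in> {0..<T}"
    have "(LINT u|I. max 0 (u - x) * ?m u) = (LINT u|I. indicator {x<..} u * ((u - x) * - g' u))"
      by (intro Bochner_Integration.integral_cong refl) (auto simp: indicator_def max_def)
    also have "\<dots> = (LINT u|lebesgue_on {x<..<T}. (u - x) * - g' u)" by (rule integral_ind_gt) (use x in auto)
    \<comment> \<open>The antiderivative comes from one integration by parts, with G serving as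
      antiderivative of g.\<close>
    also have "\<dots> = (- ((T - x) * g T) + G T) - (- ((x - x) * g x) + G x)"
    proof (rule integral_deriv_interval(2)[where F="\<lambda>u. - ((u - x) * g u) + G u"])
      show "x \<le> T" using x by simp
      show "continuous_on {x..T} (\<lambda>u. (u - x) * - g' u)"
        by (intro continuous_intros continuous_on_subset[OF g(3)]) (use x in auto)
      fix u assume u: "u \<in> {x..T}"
      have "(g has_real_derivative g' u) (at u within {x..T})"
        by (rule has_field_derivative_subset[OF g(2)]) (use u x in auto)
      moreover have "(G has_real_derivative g u) (at u within {x..T})"
        using has_field_derivative_at_within[OF G(1)[of u], of "{x..T}"] u x by (simp add: max_def split: if_splits)
      ultimately show "((\<lambda>u. - ((u - x) * g u) + G u) has_real_derivative (u - x) * - g' u) (at u within {x..T})"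
        by (auto intro!: derivative_eq_intros)
    qed
    finally show "1 - G x = 1 - G T + g T * (T - x) + (LINT u|I. max 0 (u - x) * ?m u)" by simp
  qed
qed

end

section \<open>Uniqueness of the weak solution\<close>

theorem theorem3p2:
  fixes \<Omega> :: "(real ^ 'n) set"
    and \<mu>1 \<mu>2 \<tau> T l \<zeta> :: real
    and g g' :: "real \<Rightarrow> real"
    and u0 u1 :: "real ^ 'n \<Rightarrow> real"
    and f0 u w :: "real \<Rightarrow> real ^ 'n \<Rightarrow> real"
  assumes "bounded_C2_domain \<Omega>"
    and "\<tau> > 0" and "T > 0"
    and "\<And>t. t \<ge> 0 \<Longrightarrow> g t \<ge> 0"
    and "\<And>t. t \<ge> 0 \<Longrightarrow> (g has_real_derivative g' t) (at t within {0..})"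
    and "continuous_on {0..} g'"
    and "g 0 > 0"
    and "set_integrable lebesgue {0..} g"
    and "1 - (LINT s:{0..}|lebesgue. g s) = l" and "l > 0"
    and "\<zeta> > 0" and "\<And>t. t > 0 \<Longrightarrow> g' t \<le> - \<zeta> * g t"
    and "u0 \<in> H01 \<Omega>" and "u1 \<in> L2 \<Omega>"
    and "f0 \<in> L2_Bochner (- \<tau>) 0 (L2 \<Omega>) (L2_norm \<Omega>)"
    and "weak_solution \<Omega> T \<tau> g \<mu>1 \<mu>2 u0 u1 f0 u"
    and "weak_solution \<Omega> T \<tau> g \<mu>1 \<mu>2 u0 u1 f0 w"
  shows "AE t in lebesgue_on {0<..<T}. AE x in lebesgue_on \<Omega>. u t x = w t x"
proof -
  interpret evolution \<Omega> T
    using assms(1,3) by unfold_locales (auto simp: bounded_C2_domain_def)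
  \<comment> \<open>Extending g by its value at 0 gives a function continuous on the whole line,
    whose antiderivative is differentiable from both sides at 0.\<close>
  let ?gg = "\<lambda>x. g (max 0 x)"
  have gc: "continuous_on {0..} g" using assms(5) by (auto simp: continuous_on_eq_continuous_within intro: DERIV_continuous)
  have ggc: "continuous_on UNIV ?gg" by (rule continuous_on_compose2[OF gc]) (auto intro!: continuous_intros)
  obtain F where F: "\<And>x. (F has_real_derivative ?gg x) (at x)" using continuous_antiderivative[OF ggc] by blast
  define G where "G x = F x - F 0" for x
  have G: "(G has_real_derivative ?gg x) (at x)" "G 0 = 0" for x
    unfolding G_def using F[of x] by (auto intro!: derivative_eq_intros)
  have hc: "continuous_on UNIV (\<lambda>x. 1 - G x)"
    by (intro continuous_intros DERIV_continuous_on_UNIV[OF G(1)])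
  have ggp: "?gg x = g x" if "0 < x" for x using that by simp
  obtain z s B y r C where z: "H01s.regular I z s B" and y: "L2i.regular \<Omega> I y r C" and wd: "weakly_deriv z y"
    and zeq: "AE t in I. z t = (\<lambda>x. u t x - w t x)"
    and eq: "\<forall>\<psi>\<in>H01 \<Omega>. AE t in I. L2_inner \<Omega> (y t) \<psi> + memory (\<lambda>x. 1 - G x) (\<lambda>t. grad_inner (z t) \<psi>) t
       + \<mu>1 * prim (\<lambda>t. L2_inner \<Omega> (y t) \<psi>) t + \<mu>2 * prim (\<lambda>t. L2_inner \<Omega> (y t) \<psi>) (t - \<tau>) = 0"
    by (rule difference_equation[OF assms(16,17,2,15) ggc ggp G])
  have U: "u \<in> U_space T \<Omega>" "w \<in> U_space T \<Omega>"
    and init: "AE x in lebesgue_on \<Omega>. cont_rep T \<Omega> u 0 x = u0 x" "AE x in lebesgue_on \<Omega>. cont_rep T \<Omega> w 0 x = u0 x"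
    using assms(16,17) unfolding weak_solution_def by blast+
  note cu = U_space_cont_rep[OF U(1)] and cw = U_space_cont_rep[OF U(2)]
  \<comment> \<open>The difference of the continuous representatives carries the initial condition,
    while z is the version regular at every time; they agree almost everywhere.\<close>
  define d where "d t x = cont_rep T \<Omega> u t x - cont_rep T \<Omega> w t x" for t x
  have dC: "d \<in> CL2" using CL2_diff[OF cu(1) cw(1)] unfolding d_def[abs_def] .
  have duw: "AE t in I. AE x in lebesgue_on \<Omega>. d t x = u t x - w t x"
    using cu(2) cw(2)
  proof eventually_elim
    case (elim t)
    then show ?case by eventually_elim (simp add: d_def)
  qed
  have dz: "AE t in I. AE x in lebesgue_on \<Omega>. d t x = z t x"
    using duw zeq by eventually_elim simp
  have "AE x in lebesgue_on \<Omega>. d 0 x = 0" using init by eventually_elim (simp add: d_def)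
  then have d0: "L2_norm \<Omega> (d 0) = 0" using CL2_mem[OF dC, of 0] T_pos by (intro L2_norm_cong_AE_zero) auto
  \<comment> \<open>Nonnegativity of g turns the decay inequality into g' \<le> 0, that is,
    convexity of 1 - G.\<close>
  have g'0: "g' t \<le> 0" if "0 < t" for t
  proof -
    have "0 \<le> \<zeta> * g t" using assms(4)[of t] assms(11) that by simp
    then show ?thesis using assms(12)[OF that] by simp
  qed
  have int1: "(LINT s:{0..}|lebesgue. g s) \<le> 1" using assms(9,10) by simp
  have pos: "0 \<le> (LINT p|(I \<Otimes>\<^sub>M I). (1 - G \<bar>fst p - snd p\<bar>) * K p)" if "pos_kernel K" for K
    by (rule relaxation_kernel_nonneg[OF assms(4,5,6,8) int1 g'0 G that])
  have zero: "L2_norm \<Omega> (d t) = 0" if "t \<in> {0..T}" for t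
    by (rule energy_zero[OF z y wd dC d0 dz hc assms(2) eq pos that])
  show ?thesis
    using duw AE_space
  proof eventually_elim
    case (elim t)
    then have t: "t \<in> {0..T}" by auto
    from L2_norm_0_AE[OF CL2_mem[OF dC t] zero[OF t]] elim(1) show ?case by eventually_elim simp
  qed
qed

end
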